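(* Consider the observations $Y(t_i,x_l)=\int_0^1 f(s,x_l)g(t_i-s,x_l)\,ds+\sigma\xi_{il}$, $i=1,\dots,N$, $l=1,\dots,M$, described in the context, where the error covariance matrices satisfy $c_1N^{1-\alpha_l}\le\lambda_{\min}(\Sigma_N^l)\le\lambda_{\max}(\Sigma_N^l)\le c_2N^{1-\alpha_l}$ with $0<\alpha_l\le 1$, $l=1,\dots,M$, and the kernel $g$ satisfies $K_1|m|^{-2\nu}\le|\tilde g_m(x)|^2\le K_2|m|^{-2\nu}$ for some $\nu,K_1,K_2>0$. Let $\alpha^*=\max\{\alpha_1,\dots,\alpha_M\}$, let $1\le p,q\le\infty$, $A>0$, $\min\{s_1,s_2\}\ge\max\{\frac1p,\frac12\}$, and $s_1^*=s_1+\frac12-\frac1p$. Let $B^{s_1,s_2}_{p,q}(A)$ be the anisotropic Besov ball and $R_{MN}$ the minimax $L^2$-risk defined in the context. Then there is a constant $C>0$, independent of $M$ and $N$, such that, as $M,N\to\infty$, $$R_{MN}\big(B^{s_1,s_2}_{p,q}(A)\big)\ge CA^2\begin{cases}\left[\dfrac{\sigma^2}{A^2MN^{\alpha^*}}\right]^{\frac{2s_2}{2s_2+1}},&\text{if } s_1>s_2(2\nu+1),\\[2mm]\left[\dfrac{\sigma^2}{A^2MN^{\alpha^*}}\right]^{\frac{2s_1}{2s_1+2\nu+1}},&\text{if }(2\nu+1)\left(\frac1p-\frac12\right)\le s_1\le s_2(2\nu+1),\\[2mm]\left[\dfrac{\sigma^2}{A^2MN^{\alpha^*}}\right]^{\frac{2s_1^*}{2s_1^*+2\nu}},&\text{if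 } s_1<(2\nu+1)\left(\frac1p-\frac12\right).\end{cases}$$
   Context: Model. $U=[0,1]\times[0,1]$, $f\in L^2(U)$ is an unknown function, periodic, and $g$ is a known convolution kernel. One observes $Y(t_i,x_l)=\int_0^1 f(s,x_l)g(t_i-s,x_l)\,ds+\sigma\xi_{il}$ for $t_i=i/N$, $i=1,\dots,N$, and $x_l=l/M$, $l=1,\dots,M$, where $\sigma>0$ and the $\xi_{il}$ are zero-mean Gaussian random variables, independent for different $l$ but dependent for different $i$. For each $l$, $\xi_N^l=(\xi_{1l},\dots,\xi_{Nl})^T$ and $\Sigma_N^l=\mathbb{E}[\xi_N^l(\xi_N^l)^T]$ is its covariance matrix, with smallest and largest eigenvalues $\lambda_{\min}(\Sigma_N^l)$, $\lambda_{\max}(\Sigma_N^l)$. Long-memory assumption. For each $\Sigma_N^l$, $l=1,\dots,M$, there exist constants $0<c_1\le c_2<\infty$, independent of $N$, such that $c_1N^{1-\alpha_l}\le\lambda_{\min}(\Sigma_N^l)\le\lambda_{\max}(\Sigma_N^l)\le c_2N^{1-\alpha_l}$, where $\alpha_l\in(0,1]$ is the long-memory parameter of $\xi^l_N$. Kernel assumption. $\tilde g_m(x)$ denotes the Fourier coefficients in $t$ of $g(t,x)$, with respect to $e_m(t)=e^{imt}$, $m\in 2\pi\mathbb{Z}$. There are positive constants $\nu,K_1,K_2$, independent of $m$ and $x$, such that $K_1|m|^{-2\nu}\le|\tilde g_m(x)|^2\le K_2|m|^{-2\nu}$ for $m\neq0$. Wavelet bases. $\psi_{j_1,k_1}(t)$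 is a bounded-bandwidth periodized wavelet basis (Meyer-type) and $\eta_{j_2,k_2}(x)$ a finitely supported periodized $s_o$-regular wavelet basis (Daubechies-type), with $s_o\ge s_2$; both are orthonormal bases of $L^2[0,1]$. Here $m_{i0}\le j_i<\infty$ and $k_i=0,\dots,2^{j_i}-1$, $i=1,2$, where $m_{10},m_{20}$ are the lowest resolution levels. Then $f=\sum_\omega\beta_\omega\psi_{j_1,k_1}(t)\eta_{j_2,k_2}(x)$ with $\omega=(j_1,k_1;j_2,k_2)$. Besov ball. With $s_i^*=s_i+\frac12-\frac1p$, $i=1,2$, $$B^{s_1,s_2}_{p,q}(A)=\left\{f\in L^2(U):\left(\sum_{j_1,j_2}2^{(j_1s_1^*+j_2s_2^* )q}\left(\sum_{k_1,k_2}|\beta_{j_1,k_1,j_2,k_2}|^p\right)^{q/p}\right)^{1/q}\le A\right\},$$ with the usual modification (suprema) if $p=\infty$ or $q=\infty$. Minimax risk. For a set $\Theta$ of functions, $R_{MN}(\Theta)=\inf_{\tilde f_{MN}}\sup_{f\in\Theta}\mathbb{E}\|\tilde f_{MN}-f\|^2$, where $\|\cdot\|$ is the $L^2(U)$-norm and the infimum is over all estimators $\tilde f_{MN}$ of $f$ based on the observations. *)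

theory Defs
  imports "HOL-Probability.Probability" "Jordan_Normal_Form.Gauss_Jordan_Elimination"
    "Jordan_Normal_Form.Spectral_Radius"
begin

definition L2_orthonormal_basis :: "real measure \<Rightarrow> 'i set \<Rightarrow> ('i \<Rightarrow> real \<Rightarrow> real) \<Rightarrow> bool" where
  "L2_orthonormal_basis M I e \<longleftrightarrow>
     (\<forall>i\<in>I. e i \<in> borel_measurable M \<and> integrable M (\<lambda>t. (e i t)\<^sup>2)) \<and>
     (\<forall>i\<in>I. \<forall>j\<in>I. (\<integral>t. e i t * e j t \<partial>M) = (if i = j then 1 else 0)) \<and>
     (\<forall>h\<in>borel_measurable M. integrable M (\<lambda>t. (h t)\<^sup>2) \<longrightarrow>
        (\<forall>i\<in>I. (\<integral>t. h t * e i t \<partial>M) = 0) \<longrightarrow> (AE t in M. h t = 0))"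

definition dyadic :: "(real \<Rightarrow> real) \<Rightarrow> nat \<Rightarrow> int \<Rightarrow> real \<Rightarrow> real" where
  "dyadic h j k t = 2 powr (real j / 2) * h (2 ^ j * t - of_int k)"

definition periodize :: "(real \<Rightarrow> real) \<Rightarrow> real \<Rightarrow> real" where
  "periodize h t = (\<Sum>\<^sub>\<infinity>n::int. h (t + of_int n))"

text \<open>
  Scaling function \<open>\<phi>\<close> and mother wavelet \<open>\<psi>\<close> on the line: the integer translates of \<open>\<phi>\<close> together
  with all \<open>\<psi>\<^sub>j\<^sub>k\<close>, \<open>j \<ge> 0\<close>, form an orthonormal basis of \<open>L\<^sup>2(\<real>)\<close>.
\<close>

definition wavelet_pair :: "(real \<Rightarrow> real) \<Rightarrow> (real \<Rightarrow> real) \<Rightarrow> bool" where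
  "wavelet_pair \<phi> \<psi> \<longleftrightarrow>
     L2_orthonormal_basis lborel (UNIV :: (int + nat \<times> int) set)
       (case_sum (\<lambda>k. dyadic \<phi> 0 k) (\<lambda>(j, k). dyadic \<psi> j k))"

text \<open>
  The periodized basis with lowest resolution level \<open>m0\<close>. For \<open>j \<ge> m0\<close> and \<open>k < 2 ^ j\<close> the
  \<open>(j, k)\<close>-th function is the periodized wavelet. These alone span only the complement of the
  coarse space, so the \<open>2 ^ m0\<close> periodized scaling functions at level \<open>m0\<close> are
  counted in the lowest level, as \<open>k = 2 ^ m0, \<dots>, 2 * 2 ^ m0 - 1\<close>.
\<close>

definition locations :: "nat \<Rightarrow> nat \<Rightarrow> nat set" where
  "locations m0 j = {..< (if j = m0 then 2 * 2 ^ j else 2 ^ j)}"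

definition periodic_wavelet ::
    "(real \<Rightarrow> real) \<Rightarrow> (real \<Rightarrow> real) \<Rightarrow> nat \<Rightarrow> nat \<Rightarrow> real \<Rightarrow> real" where
  "periodic_wavelet \<phi> \<psi> j k =
     (if k < 2 ^ j then periodize (dyadic \<psi> j (int k))
      else periodize (dyadic \<phi> j (int k - 2 ^ j)))"

definition periodized_wavelet_basis ::
    "(real \<Rightarrow> real) \<Rightarrow> (real \<Rightarrow> real) \<Rightarrow> nat \<Rightarrow> bool" where
  "periodized_wavelet_basis \<phi> \<psi> m0 \<longleftrightarrow>
     wavelet_pair \<phi> \<psi> \<and>
     L2_orthonormal_basis (restrict_space lborel {0..1}) (Sigma {m0..} (locations m0))
       (\<lambda>(j, k). periodic_wavelet \<phi> \<psi> j k)"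

definition line_fourier :: "(real \<Rightarrow> real) \<Rightarrow> real \<Rightarrow> complex" where
  "line_fourier h w = (\<integral>t. complex_of_real (h t) * cis (- (w * t)) \<partial>lborel)"

text \<open>
  Meyer-type pairs: band-limited, the wavelet also away from frequency zero (for Meyer's
  own wavelets \<open>a = 2\<pi>/3\<close> and \<open>b = 8\<pi>/3\<close>). The decay makes the Fourier integrals and the periodization
  converge absolutely.
\<close>

definition meyer_type :: "(real \<Rightarrow> real) \<Rightarrow> (real \<Rightarrow> real) \<Rightarrow> bool" where
  "meyer_type \<phi> \<psi> \<longleftrightarrow>
     (\<forall>h\<in>{\<phi>, \<psi>}. continuous_on UNIV h \<and> (\<exists>C. \<forall>t. \<bar>h t\<bar> \<le> C / (1 + \<bar>t\<bar>)\<^sup>2)) \<and>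
     (\<exists>a b. 0 < a \<and> a < b \<and>
        (\<forall>w. line_fourier \<phi> w \<noteq> 0 \<longrightarrow> \<bar>w\<bar> \<le> b) \<and>
        (\<forall>w. line_fourier \<psi> w \<noteq> 0 \<longrightarrow> a \<le> \<bar>w\<bar> \<and> \<bar>w\<bar> \<le> b))"

text \<open>
  \<open>r\<close>-regularity for real \<open>r > 0\<close>: with \<open>n = \<lceil>r\<rceil> - 1\<close>, the \<open>n\<close>-th derivative exists and is Hoelder
  continuous with exponent \<open>r - n \<in> (0, 1]\<close>. For integer \<open>r\<close> this says that the derivative of order
  \<open>r - 1\<close> is Lipschitz, i.e. that the weak \<open>r\<close>-th derivative is bounded, which is Meyer's
  definition (his decay conditions are automatic under compact support).
\<close>

definition regular_function :: "real \<Rightarrow> (real \<Rightarrow> real) \<Rightarrow> bool" where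
  "regular_function r h \<longleftrightarrow> 0 < r \<and>
     (let n = nat (\<lceil>r\<rceil> - 1) in
      \<exists>D :: nat \<Rightarrow> real \<Rightarrow> real. D 0 = h \<and>
        (\<forall>i<n. \<forall>x. (D i has_real_derivative D (Suc i) x) (at x)) \<and>
        (\<exists>L. \<forall>x y. \<bar>D n x - D n y\<bar> \<le> L * \<bar>x - y\<bar> powr (r - real n)))"

definition daubechies_type :: "real \<Rightarrow> (real \<Rightarrow> real) \<Rightarrow> (real \<Rightarrow> real) \<Rightarrow> bool" where
  "daubechies_type r \<phi> \<eta> \<longleftrightarrow>
     (\<forall>h\<in>{\<phi>, \<eta>}. regular_function r h \<and> (\<exists>L. \<forall>x. L < \<bar>x\<bar> \<longrightarrow> h x = 0))"

abbreviation unit_square :: "(real \<times> real) set" where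
  "unit_square \<equiv> {0..1} \<times> {0..1}"

definition L2_square :: "(real \<times> real \<Rightarrow> real) set" where
  "L2_square = {f \<in> borel_measurable lborel. set_integrable lborel unit_square (\<lambda>z. (f z)\<^sup>2)}"

definition wavelet_coeff ::
    "(nat \<Rightarrow> nat \<Rightarrow> real \<Rightarrow> real) \<Rightarrow> (nat \<Rightarrow> nat \<Rightarrow> real \<Rightarrow> real) \<Rightarrow> (real \<times> real \<Rightarrow> real) \<Rightarrow>
     nat \<Rightarrow> nat \<Rightarrow> nat \<Rightarrow> nat \<Rightarrow> real" where
  "wavelet_coeff \<Psi> H f j1 k1 j2 k2 =
     (LINT z:unit_square|lborel. f z * (\<Psi> j1 k1 (fst z) * H j2 k2 (snd z)))"

definition recip :: "ereal \<Rightarrow> real" where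
  "recip p = real_of_ereal (1 / p)"

definition s_star :: "real \<Rightarrow> ereal \<Rightarrow> real" where
  "s_star s p = s + 1/2 - recip p"

definition lp_norm :: "ereal \<Rightarrow> 'i set \<Rightarrow> ('i \<Rightarrow> real) \<Rightarrow> real" where
  "lp_norm p K b =
     (if p = \<infinity> then Max ((\<lambda>k. \<bar>b k\<bar>) ` K)
      else (\<Sum>k\<in>K. \<bar>b k\<bar> powr real_of_ereal p) powr recip p)"

definition lq_norm_le :: "ereal \<Rightarrow> 'i set \<Rightarrow> ('i \<Rightarrow> real) \<Rightarrow> real \<Rightarrow> bool" where
  "lq_norm_le q J a A \<longleftrightarrow>
     (if q = \<infinity> then \<forall>j\<in>J. \<bar>a j\<bar> \<le> A
      else (\<lambda>j. \<bar>a j\<bar> powr real_of_ereal q) summable_on J \<and>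
           (\<Sum>\<^sub>\<infinity>j\<in>J. \<bar>a j\<bar> powr real_of_ereal q) powr recip q \<le> A)"

definition besov_ball ::
    "(nat \<Rightarrow> nat \<Rightarrow> real \<Rightarrow> real) \<Rightarrow> nat \<Rightarrow> (nat \<Rightarrow> nat \<Rightarrow> real \<Rightarrow> real) \<Rightarrow> nat \<Rightarrow>
     ereal \<Rightarrow> ereal \<Rightarrow> real \<Rightarrow> real \<Rightarrow> real \<Rightarrow> (real \<times> real \<Rightarrow> real) set" where
  "besov_ball \<Psi> m1 H m2 p q s1 s2 A =
     {f \<in> L2_square.
        lq_norm_le q ({m1..} \<times> {m2..})
          (\<lambda>(j1, j2). 2 powr (real j1 * s_star s1 p + real j2 * s_star s2 p) *
             lp_norm p (locations m1 j1 \<times> locations m2 j2)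
               (\<lambda>(k1, k2). wavelet_coeff \<Psi> H f j1 k1 j2 k2)) A}"

text \<open>
  The observations involve \<open>f\<close> on the lines \<open>x = l/M\<close>, which are null sets of the square. The unknown
  function is therefore taken to be continuous (and periodic), so that its values on these lines are
  determined by its class in \<open>L\<^sup>2\<close>. Without this, \<open>f\<close> could be altered on the lines and the
  observations would carry no information. If \<open>s1, s2 > 1/p\<close>, every element of the Besov
  ball has such a continuous version.
\<close>

definition regression_functions :: "(real \<times> real \<Rightarrow> real) set" where
  "regression_functions =
     {f. continuous_on UNIV f \<and> (\<forall>t x. f (t + 1, x) = f (t, x) \<and> f (t, x + 1) = f (t, x))}"

definition convolve :: "(real \<times> real \<Rightarrow> real) \<Rightarrow> (real \<times> real \<Rightarrow> real) \<Rightarrow> real \<Rightarrow> real \<Rightarrow> real" where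
  "convolve f g t x = (LINT s:{0..1}|lborel. f (s, x) * g (t - s, x))"

text \<open>Frequency \<open>n\<close> stands for \<open>m = 2\<pi>n \<in> 2\<pi>\<int>\<close>.\<close>

definition kernel_coeff :: "(real \<times> real \<Rightarrow> real) \<Rightarrow> int \<Rightarrow> real \<Rightarrow> complex" where
  "kernel_coeff g n x =
     (LINT t:{0..1}|lborel. complex_of_real (g (t, x)) * cis (- (2 * pi * of_int n * t)))"

definition admissible_kernel :: "(real \<times> real \<Rightarrow> real) \<Rightarrow> bool" where
  "admissible_kernel g \<longleftrightarrow>
     (\<forall>x\<in>{0..1}. set_integrable lborel {0..1} (\<lambda>t. g (t, x)) \<and> (\<forall>t. g (t + 1, x) = g (t, x)))"

definition observation ::
    "(real \<times> real \<Rightarrow> real) \<Rightarrow> (real \<times> real \<Rightarrow> real) \<Rightarrow> real \<Rightarrow> nat \<Rightarrow> nat \<Rightarrow>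
     (nat \<Rightarrow> nat \<Rightarrow> 'w \<Rightarrow> real) \<Rightarrow> 'w \<Rightarrow> nat \<times> nat \<Rightarrow> real" where
  "observation g f \<sigma> M N \<xi> \<omega> =
     (\<lambda>(i, l)\<in>{1..N} \<times> {1..M}.
        convolve f g (real i / real N) (real l / real M) + \<sigma> * \<xi> i l \<omega>)"

definition cov_matrix :: "'w measure \<Rightarrow> nat \<Rightarrow> (nat \<Rightarrow> 'w \<Rightarrow> real) \<Rightarrow> real mat" where
  "cov_matrix P N X = mat N N (\<lambda>(i, j). \<integral>\<omega>. X (Suc i) \<omega> * X (Suc j) \<omega> \<partial>P)"

definition lambda_min :: "real mat \<Rightarrow> real" where
  "lambda_min S = Min {k. eigenvalue S k}"

definition lambda_max :: "real mat \<Rightarrow> real" where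
  "lambda_max S = Max {k. eigenvalue S k}"

text \<open>
  The density of the centred normal law on \<open>\<real>\<^sup>N\<close>, coordinates being numbered from 1, with invertible
  covariance matrix \<open>S\<close>.
\<close>

definition mvn_density :: "nat \<Rightarrow> real mat \<Rightarrow> (nat \<Rightarrow> real) \<Rightarrow> real" where
  "mvn_density N S y =
     (let v = vec N (\<lambda>i. y (Suc i)) in
      exp (- (v \<bullet> (the (mat_inverse S) *\<^sub>v v)) / 2) / sqrt ((2 * pi) ^ N * det S))"

definition gaussian_vector :: "'w measure \<Rightarrow> nat \<Rightarrow> (nat \<Rightarrow> 'w \<Rightarrow> real) \<Rightarrow> real mat \<Rightarrow> bool" where
  "gaussian_vector P N X S \<longleftrightarrow>
     distributed P (PiM {1..N} (\<lambda>_. lborel)) (\<lambda>\<omega>. \<lambda>i\<in>{1..N}. X i \<omega>)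
       (\<lambda>y. ennreal (mvn_density N S y))"

definition estimators :: "nat \<Rightarrow> nat \<Rightarrow> ((nat \<times> nat \<Rightarrow> real) \<Rightarrow> real \<times> real \<Rightarrow> real) set" where
  "estimators M N =
     {T. (\<lambda>(y, z). T y z) \<in>
        borel_measurable (PiM ({1..N} \<times> {1..M}) (\<lambda>_. borel) \<Otimes>\<^sub>M lborel)}"

text \<open>
  The loss is a nonnegative integral with values in \<open>[0, \<infinity>]\<close>, so estimates outside \<open>L\<^sup>2\<close> have
  infinite loss.
\<close>

definition minimax_risk ::
    "'w measure \<Rightarrow> (nat \<Rightarrow> nat \<Rightarrow> 'w \<Rightarrow> real) \<Rightarrow> (real \<times> real \<Rightarrow> real) \<Rightarrow> real \<Rightarrow> nat \<Rightarrow> nat \<Rightarrow>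
     (real \<times> real \<Rightarrow> real) set \<Rightarrow> ennreal" where
  "minimax_risk P \<xi> g \<sigma> M N \<Theta> =
     (INF T\<in>estimators M N. SUP f\<in>\<Theta>.
        \<integral>\<^sup>+\<omega>. (\<integral>\<^sup>+z\<in>unit_square. ennreal ((T (observation g f \<sigma> M N \<xi> \<omega>) z - f z)\<^sup>2) \<partial>lborel) \<partial>P)"

end

theory Submission
  imports Defs
begin

text \<open>
  The alternatives are \<open>\<gamma> \<Sum>\<^sub>k \<epsilon>\<^sub>k u\<^sub>k\<close> with \<open>\<epsilon>\<^sub>k \<in> {0, 1}\<close>, where the \<open>u\<^sub>k\<close> are tensor wavelets of one level
  \<open>(j\<^sub>1, j\<^sub>2)\<close>. Assouad's lemma with Bessel's inequality for the loss reduces the risk to two-point problems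
  between alternatives differing in one \<open>\<epsilon>\<^sub>k\<close>. For Gaussian noise their difficulty is governed by
  \<open>v\<^sup>T \<Sigma>\<^sup>-\<^sup>1 v \<le> \<bar>v\<bar>\<^sup>2 / \<lambda>\<^sub>m\<^sub>i\<^sub>n(\<Sigma>)\<close>, where \<open>v\<close> is the blurred \<open>u\<^sub>k\<close> at the design points. Only the average of these
  energies over \<open>k\<close> matters, and \<open>\<Sum>\<^sub>k \<bar>(u\<^sub>k * g)(t, x)\<bar>\<^sup>2\<close> is \<open>O(2 powr (j\<^sub>1 + j\<^sub>2 - 2 \<nu> j\<^sub>1))\<close> at every single point: the wavelets are
  band-limited in \<open>t\<close> and local in \<open>x\<close>. Hence aliasing does no harm, however \<open>M\<close> and \<open>N\<close> are related.

  The three rates come from \<open>j\<^sub>2\<close> growing with all locations, from \<open>j\<^sub>1\<close> growing with all locations, and from \<open>j\<^sub>1\<close>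
  growing with one location of at most average energy. Each bound holds for all parameters. The case distinction
  only selects one of them.
\<close>

text \<open>Where the exponents come from: put R = M N^a with a the largest long-memory parameter.
  Up to constants, amplitude \<gamma> on level (j1, j2) cannot be detected on average over the
  locations if \<gamma>^2 R 2^(-2 \<nu> j1) <= 1. With all 2^(j1+j2) locations in use the Besov ball
  admits \<gamma> of order 2^(-j1 (s1+1/2) - j2 (s2+1/2)); a single location replaces
  \<open>s + 1/2\<close> by \<open>s_star s p\<close>. The loss is \<gamma>^2 times the number of
  locations. Freezing one level at its minimum and raising the other until R is absorbed leaves a
  loss 2^(-\<theta> j) with 2^(\<Delta> j) of order R, hence the exponent \<theta>/\<Delta>. The
  maximum of the long-memory parameters enters because one constant L, of order N^(1-a), has to
  bound the smallest eigenvalue of every row. The obstacle is a coarse design, on which a single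
  blurred wavelet may have far more than its share of energy. Two-point bounds that are linear in
  the energy meet it: they can be summed over k before anything is estimated.\<close>

unbundle no inner_syntax
unbundle no vec_syntax

section \<open>Quadratic forms of covariance matrices\<close>

text \<open>The unit sphere of R^n is encoded by functions on the naturals that vanish from index n
  on, in the product topology. Compactness is Tychonoff's theorem for a product of intervals and
  points, cut by a closed condition.\<close>

lemma unit_sphere_functions_compact:
  "compact {x::nat \<Rightarrow> real. x \<in> (\<Pi>\<^sub>E i\<in>UNIV. if i < n then {-1..1} else {0}) \<and> (\<Sum>i<n. (x i)\<^sup>2) = 1}"
    (is "compact {x. x \<in> ?P \<and> ?f x = 1}")
proof -
  have "compactin (product_topology (\<lambda>i::nat. euclidean :: real topology) UNIV) ?P"
    by (subst compactin_PiE) auto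
  hence "compact ?P"
    by (simp add: euclidean_product_topology)
  moreover have "closed {x::nat \<Rightarrow> real. ?f x = 1}"
    by (intro closed_Collect_eq continuous_intros continuous_on_product_coordinates)
  ultimately have "compact (?P \<inter> {x. ?f x = 1})"
    by (rule compact_Int_closed)
  thus ?thesis by (simp add: Collect_conj_eq)
qed

lemma real_scalar_prod_ge_0: "0 \<le> (v :: real vec) \<bullet> v"
  by (simp add: scalar_prod_def sum_nonneg)

lemma real_scalar_prod_eq_0:
  assumes "(v :: real vec) \<in> carrier_vec n" shows "v \<bullet> v = 0 \<longleftrightarrow> v = 0\<^sub>v n"
  using conjugate_square_eq_0_vec[OF assms] by (simp add: conjugate_vec_def)

lemma real_scalar_prod_Cauchy_Schwarz:
  assumes v: "(v :: real vec) \<in> carrier_vec n" and w: "w \<in> carrier_vec n"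
  shows "(v \<bullet> w)\<^sup>2 \<le> (v \<bullet> v) * (w \<bullet> w)"
  using v w Cauchy_Schwarz_ineq_sum[of "\<lambda>i. v $ i" "\<lambda>i. w $ i" "{0..<n}"]
  by (simp add: scalar_prod_def power2_eq_square)

lemma scalar_prod_symmetric_mat:
  assumes S: "(S :: real mat) \<in> carrier_mat n n"
    and sym: "\<And>i j. i < n \<Longrightarrow> j < n \<Longrightarrow> S $$ (i, j) = S $$ (j, i)"
    and v: "v \<in> carrier_vec n" and w: "w \<in> carrier_vec n"
  shows "v \<bullet> (S *\<^sub>v w) = w \<bullet> (S *\<^sub>v v)"
proof -
  have "transpose_mat S = S"
    using S sym by (intro eq_matI) auto
  hence "v \<bullet> (S *\<^sub>v w) = (S *\<^sub>v v) \<bullet> w"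
    using transpose_vec_mult_scalar[OF S w v] by simp
  also have "\<dots> = w \<bullet> (S *\<^sub>v v)"
    using S v w by (intro comm_scalar_prod[of _ n]) auto
  finally show ?thesis .
qed

text \<open>Moving from \<open>v\<close> by t w with w = B v changes the form by 2 t |w|^2 + t^2 (w
  . B w). If \<open>w\<close> were nonzero, a small negative \<open>t\<close> would make the form
  negative.\<close>

lemma psd_form_kernel:
  assumes B: "(B :: real mat) \<in> carrier_mat n n"
    and sym: "\<And>i j. i < n \<Longrightarrow> j < n \<Longrightarrow> B $$ (i, j) = B $$ (j, i)"
    and psd: "\<And>w. w \<in> carrier_vec n \<Longrightarrow> 0 \<le> w \<bullet> (B *\<^sub>v w)"
    and v: "v \<in> carrier_vec n" and zero: "v \<bullet> (B *\<^sub>v v) = 0"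
  shows "B *\<^sub>v v = 0\<^sub>v n"
proof -
  define w where "w = B *\<^sub>v v"
  have w: "w \<in> carrier_vec n" using B v by (simp add: w_def)
  have exp: "(v + t \<cdot>\<^sub>v w) \<bullet> (B *\<^sub>v (v + t \<cdot>\<^sub>v w)) = 2 * t * (w \<bullet> w) + t\<^sup>2 * (w \<bullet> (B *\<^sub>v w))" for t
  proof -
    have Bw: "B *\<^sub>v w \<in> carrier_vec n" and Bv: "B *\<^sub>v v \<in> carrier_vec n"
      using B v w by auto
    have "B *\<^sub>v (v + t \<cdot>\<^sub>v w) = B *\<^sub>v v + t \<cdot>\<^sub>v (B *\<^sub>v w)"
      using B v w by (simp add: mult_add_distrib_mat_vec[of _ n n] mult_mat_vec[of _ n n])
    hence "(v + t \<cdot>\<^sub>v w) \<bullet> (B *\<^sub>v (v + t \<cdot>\<^sub>v w)) =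
        v \<bullet> (B *\<^sub>v v) + t * (v \<bullet> (B *\<^sub>v w)) + t * (w \<bullet> (B *\<^sub>v v)) + t * (t * (w \<bullet> (B *\<^sub>v w)))"
      using v w Bw Bv
      by (simp add: add_scalar_prod_distrib[of _ n] scalar_prod_add_distrib[of _ n] algebra_simps)
    also have "v \<bullet> (B *\<^sub>v w) = w \<bullet> w"
      using scalar_prod_symmetric_mat[OF B sym v w] by (simp add: w_def)
    also have "w \<bullet> (B *\<^sub>v v) = w \<bullet> w" by (simp add: w_def)
    finally show ?thesis using zero by (simp add: power2_eq_square)
  qed
  have "w \<bullet> w = 0"
  proof (rule ccontr)
    assume ne: "w \<bullet> w \<noteq> 0"
    define a where "a = w \<bullet> w"
    define b where "b = w \<bullet> (B *\<^sub>v w)"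
    have a: "a > 0" using ne real_scalar_prod_ge_0[of w] by (simp add: a_def)
    have b: "b \<ge> 0" using psd[OF w] by (simp add: b_def)
    \<comment> \<open>The minimiser would be -a/b; the added 1 covers b = 0 and keeps 2 a + t b
      positive.\<close>
    define t where "t = - a / (b + 1)"
    have "0 \<le> 2 * t * a + t\<^sup>2 * b"
      using psd[of "v + t \<cdot>\<^sub>v w"] v w exp[of t] by (simp add: a_def b_def)
    moreover have "2 * t * a + t\<^sup>2 * b < 0"
    proof -
      have "t * (2 * a + t * b) < 0"
      proof (rule mult_neg_pos)
        show "t < 0" using a b by (simp add: t_def divide_simps)
        have "a * b / (b + 1) \<le> a" using a b by (simp add: divide_simps algebra_simps)
        thus "0 < 2 * a + t * b" using a by (simp add: t_def)
      qed
      thus ?thesis by (simp add: algebra_simps power2_eq_square)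
    qed
    ultimately show False by simp
  qed
  thus ?thesis using w unfolding w_def[symmetric]
    using real_scalar_prod_ge_0 real_scalar_prod_eq_0[OF w] by auto
qed

text \<open>Minimising the Rayleigh quotient over the unit sphere exhibits its infimum as an eigenvalue.\<close>

lemma rayleigh_lambda_min:
  assumes n: "0 < n" and S: "(S :: real mat) \<in> carrier_mat n n"
    and sym: "\<And>i j. i < n \<Longrightarrow> j < n \<Longrightarrow> S $$ (i, j) = S $$ (j, i)"
    and w: "w \<in> carrier_vec n"
  shows "lambda_min S * (w \<bullet> w) \<le> w \<bullet> (S *\<^sub>v w)"
proof -
  define D where "D = {x::nat \<Rightarrow> real. x \<in> (\<Pi>\<^sub>E i\<in>UNIV. if i < n then {-1..1} else {0}) \<and>
    (\<Sum>i<n. (x i)\<^sup>2) = 1}"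
  have form: "u \<bullet> (S *\<^sub>v u) = (\<Sum>i<n. \<Sum>j<n. S $$ (i, j) * u $ i * u $ j)"
    if "u \<in> carrier_vec n" for u
    using that S
    by (simp add: scalar_prod_def lessThan_atLeast0 sum_distrib_left mult_ac)
  have nrm: "u \<bullet> u = (\<Sum>i<n. (u $ i)\<^sup>2)" if "u \<in> carrier_vec n" for u :: "real vec"
    using that by (simp add: scalar_prod_def lessThan_atLeast0 power2_eq_square)
  define F where "F x = (\<Sum>i<n. \<Sum>j<n. S $$ (i, j) * x i * x j)" for x :: "nat \<Rightarrow> real"
  have "continuous_on D F"
    unfolding F_def
    by (intro continuous_intros continuous_on_subset[OF continuous_on_product_coordinates]) auto
  moreover have "compact D" unfolding D_def by (rule unit_sphere_functions_compact)
  moreover have "D \<noteq> {}"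
  proof -
    have "(\<Sum>i<n. (if i = 0 then 1 else 0 :: real)\<^sup>2) = (\<Sum>i<n. if i = 0 then 1 else 0)"
      by (intro sum.cong) auto
    also have "\<dots> = 1" using n by simp
    finally have "(\<lambda>i. if i = 0 then 1 else 0) \<in> D"
      unfolding D_def using n by auto
    thus ?thesis by auto
  qed
  ultimately obtain x where x: "x \<in> D" and xmin: "\<And>y. y \<in> D \<Longrightarrow> F x \<le> F y"
    using continuous_attains_inf[of D F] by auto
  define \<mu> where "\<mu> = F x"
  have ray: "\<mu> * (u \<bullet> u) \<le> u \<bullet> (S *\<^sub>v u)" if u: "u \<in> carrier_vec n" for u
  proof (cases "u \<bullet> u = 0")
    case True
    hence "u = 0\<^sub>v n" using real_scalar_prod_eq_0[OF u] by simp
    thus ?thesis using S by simp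
  next
    case False
    define r where "r = sqrt (u \<bullet> u)"
    have r: "r > 0" "r\<^sup>2 = u \<bullet> u"
      using False real_scalar_prod_ge_0[of u] by (simp_all add: r_def)
    define y where "y i = (if i < n then u $ i / r else 0)" for i
    have s1: "(\<Sum>i<n. (y i)\<^sup>2) = 1"
      using r nrm[OF u] False by (simp add: y_def power_divide flip: sum_divide_distrib)
    have "\<bar>y i\<bar> \<le> 1" if "i < n" for i
      using member_le_sum[of i "{..<n}" "\<lambda>i. (y i)\<^sup>2"] that s1 by (simp add: abs_square_le_1)
    hence "y i \<in> (if i < n then {-1..1} else {0})" for i
      using abs_le_iff[of "y i" 1] by (cases "i < n") (auto simp: y_def)
    hence "y \<in> D"
      unfolding D_def using s1 by (auto simp: PiE_iff)
    hence "\<mu> \<le> F y" unfolding \<mu>_def by (rule xmin)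
    also have "F y = (u \<bullet> (S *\<^sub>v u)) / r\<^sup>2"
      by (simp add: F_def y_def form[OF u] sum_divide_distrib power2_eq_square)
    finally show ?thesis using zero_less_power[OF r(1), of 2] unfolding r(2)
      by (simp add: pos_le_divide_eq)
  qed
  define v where "v = vec n x"
  have v: "v \<in> carrier_vec n" by (simp add: v_def)
  have vv: "v \<bullet> v = 1" using x nrm[OF v] by (simp add: v_def D_def)
  have vSv: "v \<bullet> (S *\<^sub>v v) = \<mu>" using form[OF v] by (simp add: v_def \<mu>_def F_def)
  \<comment> \<open>By minimality S - \<mu> I is positive semidefinite, and its form vanishes at the
    minimiser \<open>v\<close>. So \<open>v\<close> lies in the kernel, that is, S v = \<mu> v. This
    replaces Lagrange multipliers.\<close>
  define B where "B = S + (-\<mu>) \<cdot>\<^sub>m 1\<^sub>m n"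
  have B: "B \<in> carrier_mat n n" using S by (simp add: B_def)
  have Bu: "B *\<^sub>v u = S *\<^sub>v u + (-\<mu>) \<cdot>\<^sub>v u" if u: "u \<in> carrier_vec n" for u
  proof -
    have "((-\<mu>) \<cdot>\<^sub>m 1\<^sub>m n) *\<^sub>v u = (-\<mu>) \<cdot>\<^sub>v u"
    proof (intro eq_vecI)
      fix i assume "i < dim_vec ((-\<mu>) \<cdot>\<^sub>v u)"
      hence i: "i < n" using u by simp
      have "(((-\<mu>) \<cdot>\<^sub>m 1\<^sub>m n) *\<^sub>v u) $ i = (\<Sum>j = 0..<n. - (\<mu> * (if j = i then 1 else 0) * u $ j))"
        using i u by (simp add: scalar_prod_def)
      also have "\<dots> = (\<Sum>j = 0..<n. if j = i then -\<mu> * u $ i else 0)"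
        by (intro sum.cong) auto
      finally have "(((-\<mu>) \<cdot>\<^sub>m 1\<^sub>m n) *\<^sub>v u) $ i = \<dots>" .
      thus "(((-\<mu>) \<cdot>\<^sub>m 1\<^sub>m n) *\<^sub>v u) $ i = ((-\<mu>) \<cdot>\<^sub>v u) $ i"
        using i u by simp
    qed (use u in auto)
    thus ?thesis using S u unfolding B_def by (subst add_mult_distrib_mat_vec[of _ n n]) auto
  qed
  have Bform: "u \<bullet> (B *\<^sub>v u) = u \<bullet> (S *\<^sub>v u) - \<mu> * (u \<bullet> u)" if u: "u \<in> carrier_vec n" for u
    using u S by (simp add: Bu scalar_prod_add_distrib[of _ n])
  have "B *\<^sub>v v = 0\<^sub>v n"
  proof (rule psd_form_kernel[OF B])
    show "B $$ (i, j) = B $$ (j, i)" if "i < n" "j < n" for i j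
      using that S sym by (simp add: B_def)
  qed (use v Bform ray vv vSv in auto)
  hence "S *\<^sub>v v = \<mu> \<cdot>\<^sub>v v"
    using Bu[OF v] S v by (intro eq_vecI) (auto simp: vec_eq_iff)
  moreover have "v \<noteq> 0\<^sub>v n" using vv v by auto
  ultimately have "eigenvalue S \<mu>"
    using v S unfolding eigenvalue_def eigenvector_def by auto
  \<comment> \<open>\<open>lambda_min\<close> is a \<open>Min\<close>, which is a lower bound of its
    set only if the set is finite.\<close>
  moreover have "finite {k. eigenvalue S k}"
    using card_finite_spectrum(1)[OF S] by (simp add: spectrum_def)
  ultimately have "lambda_min S \<le> \<mu>" unfolding lambda_min_def by (intro Min_le) auto
  hence "lambda_min S * (w \<bullet> w) \<le> \<mu> * (w \<bullet> w)"
    by (intro mult_right_mono) (auto simp: real_scalar_prod_ge_0)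
  also have "\<dots> \<le> w \<bullet> (S *\<^sub>v w)" by (rule ray[OF w])
  finally show ?thesis .
qed

text \<open>For u = S^-1 v the Rayleigh bound gives L |u|^2 <= v . u, and Cauchy-Schwarz gives (v .
  u)^2 <= |v|^2 |u|^2. Eliminating |u|^2 bounds v . u without diagonalising
  \<open>S\<close>.\<close>

lemma inverse_form_le:
  assumes n: "0 < n" and S: "(S :: real mat) \<in> carrier_mat n n"
    and sym: "\<And>i j. i < n \<Longrightarrow> j < n \<Longrightarrow> S $$ (i, j) = S $$ (j, i)"
    and L: "0 < L" "L \<le> lambda_min S"
    and v: "v \<in> carrier_vec n"
  shows "the (mat_inverse S) \<in> carrier_mat n n"
    and "v \<bullet> (the (mat_inverse S) *\<^sub>v v) \<le> (v \<bullet> v) / L"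
proof -
  have ray: "L * (w \<bullet> w) \<le> w \<bullet> (S *\<^sub>v w)" if "w \<in> carrier_vec n" for w
    using rayleigh_lambda_min[OF n S sym that] L mult_right_mono[OF L(2) real_scalar_prod_ge_0[of w]]
    by linarith
  have "det S \<noteq> 0"
  proof
    assume "det S = 0"
    then obtain w where w: "w \<in> carrier_vec n" "w \<noteq> 0\<^sub>v n" "S *\<^sub>v w = 0\<^sub>v n"
      using det_0_iff_vec_prod_zero_field[OF S] by auto
    hence "L * (w \<bullet> w) \<le> 0" using ray[OF w(1)] by simp
    hence "w \<bullet> w = 0" using L real_scalar_prod_ge_0[of w] by (simp add: mult_le_0_iff)
    thus False using w real_scalar_prod_eq_0[OF w(1)] by simp
  qed
  hence "S \<in> Units (ring_mat TYPE(real) n ())" by (rule det_non_zero_imp_unit[OF S])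
  then obtain B where SB: "mat_inverse S = Some B"
    using mat_inverse(1)[OF S, of "()"] by (cases "mat_inverse S") auto
  from mat_inverse(2)[OF S SB] have B: "S * B = 1\<^sub>m n" "B \<in> carrier_mat n n" by auto
  show "the (mat_inverse S) \<in> carrier_mat n n" using SB B by simp
  define u where "u = B *\<^sub>v v"
  have u: "u \<in> carrier_vec n" using B v by (simp add: u_def)
  have Su: "S *\<^sub>v u = v"
    using assoc_mult_mat_vec[OF S B(2) v] B(1) v by (simp add: u_def)
  have le: "L * (u \<bullet> u) \<le> v \<bullet> u"
    using ray[OF u] comm_scalar_prod[OF u v] by (simp add: Su)
  have "(v \<bullet> u)\<^sup>2 \<le> (v \<bullet> v) * (u \<bullet> u)"
    by (rule real_scalar_prod_Cauchy_Schwarz[OF v u])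
  hence "L * (v \<bullet> u)\<^sup>2 \<le> (v \<bullet> v) * (L * (u \<bullet> u))"
    using mult_left_mono[of _ _ L] L by (metis less_imp_le mult.left_commute)
  also have "\<dots> \<le> (v \<bullet> v) * (v \<bullet> u)"
    using le by (intro mult_left_mono real_scalar_prod_ge_0)
  finally have "(v \<bullet> u) * (L * (v \<bullet> u)) \<le> (v \<bullet> u) * (v \<bullet> v)"
    by (simp add: power2_eq_square mult_ac)
  moreover have "0 \<le> v \<bullet> u"
    using le L real_scalar_prod_ge_0[of u] by (meson mult_nonneg_nonneg less_imp_le order_trans)
  \<comment> \<open>The common factor v . u is cancelled; if it vanishes, the claim is just |v|^2 >=
    0.\<close>
  ultimately have "L * (v \<bullet> u) \<le> v \<bullet> v \<or> v \<bullet> u = 0"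
    by (metis mult_le_cancel_left order_less_le)
  hence "L * (v \<bullet> u) \<le> v \<bullet> v" using real_scalar_prod_ge_0[of v] by auto
  thus "v \<bullet> (the (mat_inverse S) *\<^sub>v v) \<le> (v \<bullet> v) / L"
    using L SB by (simp add: u_def field_simps)
qed

section \<open>Testing and the lemma of Assouad\<close>

text \<open>Preimages of boxes under a coordinatewise map are boxes, and boxes determine the product
  measure. It is applied to shifts, for the entries of a row and then for the rows.\<close>

lemma distr_PiM_componentwise:
  assumes fin: "finite I" and sf: "\<And>i. sigma_finite_measure (M i)"
    and T: "\<And>i. i \<in> I \<Longrightarrow> T i \<in> measurable (M i) (M i)"
    and inv: "\<And>i. i \<in> I \<Longrightarrow> distr (M i) (M i) (T i) = M i"
  shows "(\<lambda>w. \<lambda>i\<in>I. T i (w i)) \<in> measurable (PiM I M) (PiM I M)"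
    and "distr (PiM I M) (PiM I M) (\<lambda>w. \<lambda>i\<in>I. T i (w i)) = PiM I M"
proof -
  interpret product_sigma_finite M by (intro product_sigma_finite.intro sf)
  show meas: "(\<lambda>w. \<lambda>i\<in>I. T i (w i)) \<in> measurable (PiM I M) (PiM I M)"
    using T by (intro measurable_restrict) (auto intro!: measurable_compose[OF measurable_component_singleton])
  show "distr (PiM I M) (PiM I M) (\<lambda>w. \<lambda>i\<in>I. T i (w i)) = PiM I M"
  proof (rule PiM_eqI[OF fin])
    fix A assume A: "\<And>i. i \<in> I \<Longrightarrow> A i \<in> sets (M i)"
    have TA: "T i -` A i \<inter> space (M i) \<in> sets (M i)" if "i \<in> I" for i
      using measurable_sets[OF T[OF that] A[OF that]] .
    have "emeasure (distr (PiM I M) (PiM I M) (\<lambda>w. \<lambda>i\<in>I. T i (w i))) (PiE I A) =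
        emeasure (PiM I M) ((\<lambda>w. \<lambda>i\<in>I. T i (w i)) -` PiE I A \<inter> space (PiM I M))"
      using A fin by (intro emeasure_distr meas sets_PiM_I_finite) auto
    also have "(\<lambda>w. \<lambda>i\<in>I. T i (w i)) -` PiE I A \<inter> space (PiM I M) =
        (\<Pi>\<^sub>E i\<in>I. T i -` A i \<inter> space (M i))"
      by (auto simp: space_PiM PiE_iff)
    also have "emeasure (PiM I M) \<dots> = (\<Prod>i\<in>I. emeasure (M i) (T i -` A i \<inter> space (M i)))"
      by (rule emeasure_PiM[OF fin TA])
    also have "\<dots> = (\<Prod>i\<in>I. emeasure (distr (M i) (M i) (T i)) (A i))"
      by (intro prod.cong refl) (simp add: emeasure_distr T A)
    also have "\<dots> = (\<Prod>i\<in>I. emeasure (M i) (A i))"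
      by (intro prod.cong refl) (simp add: inv)
    finally show "emeasure (distr (PiM I M) (PiM I M) (\<lambda>w. \<lambda>i\<in>I. T i (w i))) (PiE I A) =
        (\<Prod>i\<in>I. emeasure (M i) (A i))" .
  qed simp
qed

text \<open>Boxes suffice again, and on a box the integral of the product density factorises. It
  yields the joint density of independent rows.\<close>

lemma PiM_density:
  assumes fin: "finite I" and sf: "\<And>i. sigma_finite_measure (M i)"
    and f: "\<And>i. i \<in> I \<Longrightarrow> f i \<in> borel_measurable (M i)"
    and ps: "\<And>i. i \<in> I \<Longrightarrow> prob_space (density (M i) (f i))"
  shows "PiM I (\<lambda>i. density (M i) (f i)) = density (PiM I M) (\<lambda>w. \<Prod>i\<in>I. f i (w i))"
proof -
  interpret product_sigma_finite M by (intro product_sigma_finite.intro sf)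
  \<comment> \<open>The locale of product measures asks for sigma-finiteness at every index, whereas
    the densities are known to be probabilities on \<open>I\<close> only. Off \<open>I\<close> a
    Dirac measure is substituted, which the product over \<open>I\<close> does not see.\<close>
  define D where "D i = (if i \<in> I then density (M i) (f i) else return (count_space UNIV) undefined)" for i
  have "prob_space (D i)" for i
    using ps by (auto simp: D_def intro!: prob_space_return)
  then interpret D: product_sigma_finite D
    by (intro product_sigma_finite.intro prob_space_imp_sigma_finite)
  have fw: "(\<lambda>w. f i (w i)) \<in> borel_measurable (PiM I M)" if "i \<in> I" for i
    using that f by (intro measurable_compose[OF measurable_component_singleton]) auto
  have sD: "sets (PiM I D) = sets (PiM I M)"
    by (intro sets_PiM_cong) (auto simp: D_def)
  have "density (PiM I M) (\<lambda>w. \<Prod>i\<in>I. f i (w i)) = PiM I D"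
  proof (rule D.PiM_eqI[OF fin])
    fix A assume A: "\<And>i. i \<in> I \<Longrightarrow> A i \<in> sets (D i)"
    hence A': "A i \<in> sets (M i)" if "i \<in> I" for i using that by (force simp: D_def)
    have sp: "PiE I A \<in> sets (PiM I M)" using A' fin by (intro sets_PiM_I_finite) auto
    have "emeasure (density (PiM I M) (\<lambda>w. \<Prod>i\<in>I. f i (w i))) (PiE I A) =
        (\<integral>\<^sup>+w. (\<Prod>i\<in>I. f i (w i)) * indicator (PiE I A) w \<partial>PiM I M)"
      using fw by (intro emeasure_density sp borel_measurable_prod) auto
    also have "\<dots> = (\<integral>\<^sup>+w. (\<Prod>i\<in>I. f i (w i) * indicator (A i) (w i)) \<partial>PiM I M)"
    proof (intro nn_integral_cong)
      fix w assume w: "w \<in> space (PiM I M)"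
      have "indicator (PiE I A) w = (\<Prod>i\<in>I. indicator (A i) (w i) :: ennreal)"
      proof (cases "w \<in> PiE I A")
        case False
        then obtain i where "i \<in> I" "w i \<notin> A i" using w by (auto simp: space_PiM PiE_iff)
        thus ?thesis using False fin by (auto simp: prod_zero_iff intro!: bexI[of _ i])
      qed (auto simp: PiE_iff intro!: prod.neutral[symmetric])
      thus "(\<Prod>i\<in>I. f i (w i)) * indicator (PiE I A) w = (\<Prod>i\<in>I. f i (w i) * indicator (A i) (w i))"
        by (simp add: prod.distrib)
    qed
    also have "\<dots> = (\<Prod>i\<in>I. \<integral>\<^sup>+x. f i x * indicator (A i) x \<partial>M i)"
      using f A' by (intro product_nn_integral_prod[OF fin]) auto
    also have "\<dots> = (\<Prod>i\<in>I. emeasure (D i) (A i))"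
      using f A' by (intro prod.cong refl) (simp add: D_def emeasure_density)
    finally show "emeasure (density (PiM I M) (\<lambda>w. \<Prod>i\<in>I. f i (w i))) (PiE I A) =
        (\<Prod>i\<in>I. emeasure (D i) (A i))" .
  qed (simp add: sD)
  also have "PiM I D = PiM I (\<lambda>i. density (M i) (f i))"
    by (intro PiM_cong) (auto simp: D_def)
  finally show ?thesis by simp
qed

lemma measure_preserving_nn_integral:
  assumes "T \<in> measurable M M" "distr M M T = M" "f \<in> borel_measurable M"
  shows "(\<integral>\<^sup>+w. f (T w) \<partial>M) = (\<integral>\<^sup>+w. f w \<partial>M)"
  using nn_integral_distr[OF assms(1), of f] assms by simp

text \<open>Integrated, this replaces the Cauchy-Schwarz inequality between Hellinger affinity and total variation.\<close>

lemma sqrt_mult_le_min: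
  assumes "0 \<le> a" "0 \<le> (b::real)" "0 < h"
  shows "h * sqrt (a * b) \<le> min a b + h\<^sup>2 / 4 * (a + b)"
proof -
  have *: "h * sqrt (x * y) \<le> x + h\<^sup>2 / 4 * (x + y)" if "0 \<le> x" "0 \<le> y" for x y
  proof -
    \<comment> \<open>Weighted arithmetic-geometric inequality. The weight \<open>h / 2\<close>
      makes the error quadratic in \<open>h\<close>, so it costs half of the gain h^2 when
      \<open>h\<close> is the affinity.\<close>
    have "0 \<le> (sqrt x - h / 2 * sqrt y)\<^sup>2" by simp
    also have "\<dots> = x + h\<^sup>2 / 4 * y - h * sqrt (x * y)"
      using that by (simp add: power2_diff power_mult_distrib real_sqrt_mult power_divide algebra_simps)
    finally have "h * sqrt (x * y) \<le> x + h\<^sup>2 / 4 * y" by simp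
    moreover have "0 \<le> h\<^sup>2 / 4 * x" using that by simp
    ultimately show ?thesis by (simp add: algebra_simps add_divide_distrib)
  qed
  show ?thesis
    using *[OF assms(1,2)] *[OF assms(2,1)] by (auto simp: min_def mult.commute add.commute)
qed

text \<open>The geometric mean of the two shifted densities is \<open>h\<close> times a third one,
  so the affinity is exactly \<open>h\<close>, because the maps preserve mass. The integrated
  inequality then reads h^2 <= overlap + h^2/2.\<close>

lemma testing_affinity:
  assumes p: "p \<in> borel_measurable M" "\<And>w. w \<in> space M \<Longrightarrow> 0 \<le> p w"
    and mass: "(\<integral>\<^sup>+w. ennreal (p w) \<partial>M) = 1"
    and T1: "T1 \<in> measurable M M" "distr M M T1 = M"
    and T2: "T2 \<in> measurable M M" "distr M M T2 = M"
    and T: "T \<in> measurable M M" "distr M M T = M"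
    and h: "0 < h"
    and aff: "\<And>w. w \<in> space M \<Longrightarrow> p (T1 w) * p (T2 w) = (h * p (T w))\<^sup>2"
  shows "ennreal (h\<^sup>2 / 2) \<le> (\<integral>\<^sup>+w. min (ennreal (p (T1 w))) (ennreal (p (T2 w))) \<partial>M)"
proof -
  have nn: "0 \<le> p (T w)" "0 \<le> p (T1 w)" "0 \<le> p (T2 w)" if "w \<in> space M" for w
    using that p(2) measurable_space[OF T(1)] measurable_space[OF T1(1)] measurable_space[OF T2(1)] by auto
  have pm: "(\<lambda>w. p (S w)) \<in> borel_measurable M" if "S \<in> measurable M M" for S
    using that p(1) by (rule measurable_compose)
  have one: "(\<integral>\<^sup>+w. ennreal (p (S w)) \<partial>M) = 1" if "S \<in> measurable M M" "distr M M S = M" for S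
    using measure_preserving_nn_integral[OF that, of "\<lambda>w. ennreal (p w)"] p(1) mass by simp
  have "ennreal (h\<^sup>2) = (\<integral>\<^sup>+w. ennreal (h\<^sup>2) * ennreal (p (T w)) \<partial>M)"
    using one[OF T] pm[OF T(1)] by (simp add: nn_integral_cmult)
  also have "\<dots> \<le> (\<integral>\<^sup>+w. min (ennreal (p (T1 w))) (ennreal (p (T2 w))) +
      ennreal (h\<^sup>2 / 4) * (ennreal (p (T1 w)) + ennreal (p (T2 w))) \<partial>M)"
  proof (intro nn_integral_mono)
    fix w assume w: "w \<in> space M"
    have "h\<^sup>2 * p (T w) = h * sqrt (p (T1 w) * p (T2 w))"
      using aff[OF w] nn[OF w] h by (simp add: power2_eq_square)
    also have "\<dots> \<le> min (p (T1 w)) (p (T2 w)) + h\<^sup>2 / 4 * (p (T1 w) + p (T2 w))"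
      by (rule sqrt_mult_le_min[OF nn(2,3)[OF w] h])
    finally have "ennreal (h\<^sup>2 * p (T w)) \<le> ennreal (min (p (T1 w)) (p (T2 w)) + h\<^sup>2 / 4 * (p (T1 w) + p (T2 w)))"
      by (rule ennreal_leI)
    also have "\<dots> = ennreal (min (p (T1 w)) (p (T2 w))) + ennreal (h\<^sup>2 / 4) * ennreal (p (T1 w) + p (T2 w))"
      using nn[OF w] by (subst ennreal_plus, simp, simp, subst ennreal_mult, simp_all)
    finally have "ennreal (h\<^sup>2 * p (T w)) \<le> \<dots>" .
    moreover have "ennreal (p (T1 w) + p (T2 w)) = ennreal (p (T1 w)) + ennreal (p (T2 w))"
      using nn[OF w] by (intro ennreal_plus)
    moreover have "ennreal (min (p (T1 w)) (p (T2 w))) = min (ennreal (p (T1 w))) (ennreal (p (T2 w)))"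
      by (rule min_of_mono[symmetric]) (simp add: mono_def ennreal_leI)
    moreover have "ennreal (h\<^sup>2 * p (T w)) = ennreal (h\<^sup>2) * ennreal (p (T w))"
      using nn[OF w] by (intro ennreal_mult) auto
    ultimately show "ennreal (h\<^sup>2) * ennreal (p (T w)) \<le> min (ennreal (p (T1 w))) (ennreal (p (T2 w))) +
      ennreal (h\<^sup>2 / 4) * (ennreal (p (T1 w)) + ennreal (p (T2 w)))"
      by simp
  qed
  also have "\<dots> = (\<integral>\<^sup>+w. min (ennreal (p (T1 w))) (ennreal (p (T2 w))) \<partial>M) + ennreal (h\<^sup>2 / 2)"
  proof -
    have "(1::ennreal) + 1 = ennreal 2" by simp
    hence "ennreal (h\<^sup>2 / 4) * (1 + 1) = ennreal (h\<^sup>2 / 2)"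
      using ennreal_mult[of "h\<^sup>2 / 4" 2] by simp
    thus ?thesis using pm[OF T1(1)] pm[OF T2(1)] one[OF T1] one[OF T2]
      by (simp add: nn_integral_add nn_integral_cmult)
  qed
  finally have "ennreal (h\<^sup>2 / 2) + ennreal (h\<^sup>2 / 2) \<le>
      (\<integral>\<^sup>+w. min (ennreal (p (T1 w))) (ennreal (p (T2 w))) \<partial>M) + ennreal (h\<^sup>2 / 2)"
    by (simp flip: ennreal_plus)
  thus ?thesis by (simp add: add.commute ennreal_add_left_cancel_le)
qed

text \<open>The supremum over \<open>E\<close> dominates the average over all subsets. For fixed
  \<open>k\<close> the subsets pair off as \<open>E\<close> and \<open>insert k E\<close>, and each
  pair is a test between 0 and \<gamma> in coordinate \<open>k\<close>. The bounds
  \<open>b k\<close> may vary with the coordinate, which permits averaging energies later.\<close>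

lemma assouad:
  fixes q :: "'k set \<Rightarrow> 'a \<Rightarrow> ennreal" and S :: "'k \<Rightarrow> 'a \<Rightarrow> real"
  assumes fin: "finite K"
    and q: "\<And>E. q E \<in> borel_measurable M" and S: "\<And>k. k \<in> K \<Longrightarrow> S k \<in> borel_measurable M"
    and \<gamma>: "0 \<le> \<gamma>"
    and b: "\<And>k E. k \<in> K \<Longrightarrow> E \<subseteq> K - {k} \<Longrightarrow> b k \<le> (\<integral>\<^sup>+w. min (q E w) (q (insert k E) w) \<partial>M)"
  shows "(\<Sum>k\<in>K. ennreal (\<gamma>\<^sup>2 / 4) * b k) \<le>
    (SUP E\<in>Pow K. \<integral>\<^sup>+w. q E w * (\<Sum>k\<in>K. ennreal ((S k w - (if k \<in> E then \<gamma> else 0))\<^sup>2)) \<partial>M)"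
proof -
  define I where "I E k = (\<integral>\<^sup>+w. q E w * ennreal ((S k w - (if k \<in> E then \<gamma> else 0))\<^sup>2) \<partial>M)" for E k
  define R where "R E = (\<integral>\<^sup>+w. q E w * (\<Sum>k\<in>K. ennreal ((S k w - (if k \<in> E then \<gamma> else 0))\<^sup>2)) \<partial>M)" for E
  have RI: "R E = (\<Sum>k\<in>K. I E k)" for E
    unfolding R_def I_def sum_distrib_left using q S by (subst nn_integral_sum) auto
  have pair: "ennreal (\<gamma>\<^sup>2 / 2) * b k \<le> I E k + I (insert k E) k" if k: "k \<in> K" and E: "E \<in> Pow (K - {k})" for k E
  proof -
    have "ennreal (\<gamma>\<^sup>2 / 2) * b k \<le> ennreal (\<gamma>\<^sup>2 / 2) * (\<integral>\<^sup>+w. min (q E w) (q (insert k E) w) \<partial>M)"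
      using b[OF k] E by (intro mult_left_mono) auto
    also have "\<dots> = (\<integral>\<^sup>+w. ennreal (\<gamma>\<^sup>2 / 2) * min (q E w) (q (insert k E) w) \<partial>M)"
      using q by (simp add: nn_integral_cmult)
    also have "\<dots> \<le> (\<integral>\<^sup>+w. q E w * ennreal ((S k w)\<^sup>2) + q (insert k E) w * ennreal ((S k w - \<gamma>)\<^sup>2) \<partial>M)"
    proof (intro nn_integral_mono)
      fix w
      \<comment> \<open>No value \<open>S k w\<close> is close to both 0 and \<gamma>: the two
        squared errors add up to at least \<gamma>^2/2.\<close>
      have "0 \<le> (2 * S k w - \<gamma>)\<^sup>2" by simp
      hence "\<gamma>\<^sup>2 / 2 \<le> (S k w)\<^sup>2 + (S k w - \<gamma>)\<^sup>2"
        by (simp add: power2_eq_square algebra_simps)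
      hence "ennreal (\<gamma>\<^sup>2 / 2) \<le> ennreal ((S k w)\<^sup>2) + ennreal ((S k w - \<gamma>)\<^sup>2)"
        by (simp flip: ennreal_plus)
      hence "ennreal (\<gamma>\<^sup>2 / 2) * min (q E w) (q (insert k E) w) \<le>
          (ennreal ((S k w)\<^sup>2) + ennreal ((S k w - \<gamma>)\<^sup>2)) * min (q E w) (q (insert k E) w)"
        by (intro mult_right_mono) auto
      also have "\<dots> \<le> q E w * ennreal ((S k w)\<^sup>2) + q (insert k E) w * ennreal ((S k w - \<gamma>)\<^sup>2)"
        by (simp add: distrib_right) (intro add_mono; subst mult.commute; intro mult_right_mono; simp)
      finally show "ennreal (\<gamma>\<^sup>2 / 2) * min (q E w) (q (insert k E) w) \<le> \<dots>" .
    qed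
    also have "\<dots> = I E k + I (insert k E) k"
      using E q S[OF k] by (subst nn_integral_add) (auto simp: I_def)
    finally show ?thesis .
  qed
  have split: "(\<Sum>E\<in>Pow K. I E k) = (\<Sum>E\<in>Pow (K - {k}). I E k + I (insert k E) k)" if k: "k \<in> K" for k
  proof -
    have "Pow K = Pow (K - {k}) \<union> insert k ` Pow (K - {k})"
      using k by (metis Pow_insert insert_Diff)
    moreover have "Pow (K - {k}) \<inter> insert k ` Pow (K - {k}) = {}" by auto
    moreover have "inj_on (insert k) (Pow (K - {k}))"
      by (auto simp: inj_on_def)
    ultimately show ?thesis
      using fin by (simp add: sum.union_disjoint sum.reindex sum.distrib)
  qed
  \<comment> \<open>Both sides carry the factor 2^|K| to avoid division in \<open>ennreal\<close>.
    Only half of the subsets omit \<open>k\<close>, which turns \<gamma>^2/4 into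
    \<gamma>^2/2.\<close>
  have "2 ^ card K * (\<Sum>k\<in>K. ennreal (\<gamma>\<^sup>2 / 4) * b k) = (\<Sum>k\<in>K. 2 ^ card K * (ennreal (\<gamma>\<^sup>2 / 4) * b k))"
    by (simp add: sum_distrib_left)
  also have "\<dots> = (\<Sum>k\<in>K. \<Sum>E\<in>Pow (K - {k}). ennreal (\<gamma>\<^sup>2 / 2) * b k)"
  proof (intro sum.cong refl)
    fix k assume k: "k \<in> K"
    then obtain n where n: "card K = Suc n" using fin by (metis card_Suc_Diff1)
    have "2 * ennreal (\<gamma>\<^sup>2 / 4) = ennreal (\<gamma>\<^sup>2 / 2)"
      using ennreal_mult[of 2 "\<gamma>\<^sup>2 / 4"] by simp
    thus "2 ^ card K * (ennreal (\<gamma>\<^sup>2 / 4) * b k) = (\<Sum>E\<in>Pow (K - {k}). ennreal (\<gamma>\<^sup>2 / 2) * b k)"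
      using k fin n by (simp add: card_Pow mult_ac) (metis mult.assoc mult.commute)
  qed
  also have "\<dots> \<le> (\<Sum>k\<in>K. \<Sum>E\<in>Pow (K - {k}). I E k + I (insert k E) k)"
    by (intro sum_mono pair)
  also have "\<dots> = (\<Sum>k\<in>K. \<Sum>E\<in>Pow K. I E k)"
    by (simp add: split)
  also have "\<dots> = (\<Sum>E\<in>Pow K. R E)"
    unfolding RI by (rule sum.swap)
  also have "\<dots> \<le> (\<Sum>E\<in>Pow K. SUP E\<in>Pow K. R E)"
    by (intro sum_mono SUP_upper)
  also have "\<dots> = 2 ^ card K * (SUP E\<in>Pow K. R E)"
    using fin by (simp add: card_Pow)
  finally have "2 ^ card K * (\<Sum>k\<in>K. ennreal (\<gamma>\<^sup>2 / 4) * b k) \<le> 2 ^ card K * (SUP E\<in>Pow K. R E)" .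
  thus ?thesis
    unfolding R_def by (subst (asm) ennreal_mult_le_mult_iff) (auto simp: power_eq_top_ennreal)
qed

section \<open>Gaussian arrays and the minimax risk\<close>

lemma integrable_mult_of_squares:
  fixes f g :: "'a \<Rightarrow> real"
  assumes [measurable]: "f \<in> borel_measurable M" "g \<in> borel_measurable M"
    and "integrable M (\<lambda>x. (f x)\<^sup>2)" "integrable M (\<lambda>x. (g x)\<^sup>2)"
  shows "integrable M (\<lambda>x. f x * g x)"
proof (rule Bochner_Integration.integrable_bound)
  show "integrable M (\<lambda>x. (f x)\<^sup>2 + (g x)\<^sup>2)" using assms by simp
  have "\<bar>a * b\<bar> \<le> a\<^sup>2 + b\<^sup>2" for a b :: real
    using sum_squares_bound[of "\<bar>a\<bar>" "\<bar>b\<bar>"] mult_nonneg_nonneg[of "\<bar>a\<bar>" "\<bar>b\<bar>"]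
    unfolding abs_mult by (simp only: power2_abs) linarith
  thus "AE x in M. norm (f x * g x) \<le> norm ((f x)\<^sup>2 + (g x)\<^sup>2)" by simp
qed simp

lemma bessel_inequality:
  fixes u :: "'k \<Rightarrow> 'a \<Rightarrow> real"
  assumes K: "finite K" and u: "\<And>k. k \<in> K \<Longrightarrow> u k \<in> borel_measurable M"
    "\<And>k. k \<in> K \<Longrightarrow> integrable M (\<lambda>x. (u k x)\<^sup>2)"
    and ortho: "\<And>k k'. k \<in> K \<Longrightarrow> k' \<in> K \<Longrightarrow> (\<integral>x. u k x * u k' x \<partial>M) = (if k = k' then 1 else 0)"
    and h: "h \<in> borel_measurable M" "integrable M (\<lambda>x. (h x)\<^sup>2)"
  shows "(\<Sum>k\<in>K. (\<integral>x. h x * u k x \<partial>M)\<^sup>2) \<le> (\<integral>x. (h x)\<^sup>2 \<partial>M)"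
proof -
  define c where "c k = (\<integral>x. h x * u k x \<partial>M)" for k
  have hu: "integrable M (\<lambda>x. h x * u k x)" if "k \<in> K" for k
    using that u h by (intro integrable_mult_of_squares) auto
  have uu: "integrable M (\<lambda>x. u k x * u k' x)" if "k \<in> K" "k' \<in> K" for k k'
    using that u by (intro integrable_mult_of_squares) auto
  have "0 \<le> (\<integral>x. (h x - (\<Sum>k\<in>K. c k * u k x))\<^sup>2 \<partial>M)" by simp
  also have "\<dots> = (\<integral>x. (h x)\<^sup>2 - 2 * (\<Sum>k\<in>K. c k * (h x * u k x)) +
      (\<Sum>k\<in>K. \<Sum>k'\<in>K. c k * c k' * (u k x * u k' x)) \<partial>M)"
    by (intro Bochner_Integration.integral_cong refl)
       (simp add: power2_eq_square algebra_simps sum_distrib_left sum_distrib_right sum_product)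
  also have "\<dots> = (\<integral>x. (h x)\<^sup>2 \<partial>M) - 2 * (\<Sum>k\<in>K. c k * (\<integral>x. h x * u k x \<partial>M)) +
      (\<Sum>k\<in>K. \<Sum>k'\<in>K. c k * c k' * (\<integral>x. u k x * u k' x \<partial>M))"
    using h(2) hu uu
    by (simp add: Bochner_Integration.integral_add Bochner_Integration.integral_diff
        Bochner_Integration.integral_sum Bochner_Integration.integrable_sum)
  also have "(\<Sum>k\<in>K. \<Sum>k'\<in>K. c k * c k' * (\<integral>x. u k x * u k' x \<partial>M)) = (\<Sum>k\<in>K. (c k)\<^sup>2)"
  proof -
    have "(\<Sum>k\<in>K. \<Sum>k'\<in>K. c k * c k' * (\<integral>x. u k x * u k' x \<partial>M)) =
        (\<Sum>k\<in>K. \<Sum>k'\<in>K. if k = k' then (c k)\<^sup>2 else 0)"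
      by (intro sum.cong refl) (simp add: ortho power2_eq_square)
    thus ?thesis using K by simp
  qed
  also have "(\<Sum>k\<in>K. c k * (\<integral>x. h x * u k x \<partial>M)) = (\<Sum>k\<in>K. (c k)\<^sup>2)"
    by (simp add: c_def power2_eq_square)
  finally show ?thesis by (simp add: c_def)
qed

section \<open>Noise arrays: Lebesgue measure, shifts and the Gaussian exponent\<close>

definition array_measure :: "nat \<Rightarrow> nat \<Rightarrow> (nat \<Rightarrow> nat \<Rightarrow> real) measure" where
  "array_measure M N = PiM {1..M} (\<lambda>_. PiM {1..N} (\<lambda>_. lborel))"

definition array_shift :: "nat \<Rightarrow> nat \<Rightarrow> (nat \<Rightarrow> nat \<Rightarrow> real) \<Rightarrow> (nat \<Rightarrow> nat \<Rightarrow> real) \<Rightarrow> nat \<Rightarrow> nat \<Rightarrow> real" where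
  "array_shift M N a w = (\<lambda>l\<in>{1..M}. \<lambda>i\<in>{1..N}. w l i + a l i)"

text \<open>The exponent of the joint Gaussian density. The row index \<open>l\<close> comes first
  because rows are independent: the form is block diagonal with one block per row. Blocks count from
  0 and entries from 1, hence \<open>Suc\<close>.\<close>

definition array_form :: "nat \<Rightarrow> nat \<Rightarrow> (nat \<Rightarrow> nat \<Rightarrow> nat \<Rightarrow> real) \<Rightarrow> (nat \<Rightarrow> nat \<Rightarrow> real) \<Rightarrow> real" where
  "array_form M N b w = (\<Sum>l\<in>{1..M}. \<Sum>i<N. \<Sum>j<N. b l i j * w l (Suc i) * w l (Suc j))"

lemma sigma_finite_PiM_lborel:
  "finite I \<Longrightarrow> sigma_finite_measure (PiM I (\<lambda>_::nat. lborel :: real measure))"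
proof -
  interpret product_sigma_finite "\<lambda>_::nat. lborel :: real measure"
    by (intro product_sigma_finite.intro sigma_finite_lborel)
  show "finite I \<Longrightarrow> sigma_finite_measure (PiM I (\<lambda>_::nat. lborel :: real measure))"
    by (rule sigma_finite)
qed

lemma measurable_row:
  assumes "l \<in> {1..M}"
  shows "(\<lambda>w. w l) \<in> measurable (array_measure M N) (PiM {1..N} (\<lambda>_. lborel))"
  unfolding array_measure_def by (rule measurable_component_singleton[OF assms])

lemma measurable_entry:
  assumes "l \<in> {1..M}" "i \<in> {1..N}"
  shows "(\<lambda>w. w l i) \<in> borel_measurable (array_measure M N)"
  using measurable_compose[OF measurable_row[OF assms(1)] measurable_component_singleton[OF assms(2)]]
  by simp

text \<open>Translation invariance of Lebesgue measure, used for the entries of a row and then for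
  the rows. It lets the signal be moved from the data into the density.\<close>

lemma array_shift_preserving:
  shows "array_shift M N a \<in> measurable (array_measure M N) (array_measure M N)"
    and "distr (array_measure M N) (array_measure M N) (array_shift M N a) = array_measure M N"
proof -
  have lb: "distr lborel lborel (\<lambda>x. x + c) = lborel" for c :: real
  proof -
    have "distr lborel lborel (\<lambda>x. x + c) = distr lborel borel ((+) c)"
      by (intro distr_cong) (auto simp: add.commute)
    thus ?thesis by (simp add: lborel_distr_plus)
  qed
  have row: "(\<lambda>y. \<lambda>i\<in>{1..N}. y i + a l i) \<in> measurable (PiM {1..N} (\<lambda>_. lborel)) (PiM {1..N} (\<lambda>_. lborel))"
    "distr (PiM {1..N} (\<lambda>_. lborel)) (PiM {1..N} (\<lambda>_. lborel)) (\<lambda>y. \<lambda>i\<in>{1..N}. y i + a l i) =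
      PiM {1..N} (\<lambda>_. lborel)" for l
    by (rule distr_PiM_componentwise[where T = "\<lambda>i x. x + a l i"]; simp add: sigma_finite_lborel lb)+
  have eq: "array_shift M N a = (\<lambda>w. \<lambda>l\<in>{1..M}. (\<lambda>y. \<lambda>i\<in>{1..N}. y i + a l i) (w l))"
    by (intro ext) (simp add: array_shift_def)
  show "array_shift M N a \<in> measurable (array_measure M N) (array_measure M N)"
    "distr (array_measure M N) (array_measure M N) (array_shift M N a) = array_measure M N"
    unfolding eq array_measure_def
    by (rule distr_PiM_componentwise[where T = "\<lambda>l y. \<lambda>i\<in>{1..N}. y i + a l i"];
        (intro sigma_finite_PiM_lborel row)?; simp)+
qed

text \<open>The parallelogram law Q(x) + Q(y) = 2 Q((x+y)/2) + Q(x-y)/2 with x = w + a1 and y = w +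
  a2. The last term is free of \<open>w\<close>, so the product of two shifted Gaussian densities is
  the squared density at the midpoint times a constant.\<close>

lemma array_form_parallelogram:
  "array_form M N b (array_shift M N a1 w) + array_form M N b (array_shift M N a2 w) =
   2 * array_form M N b (array_shift M N (\<lambda>l i. (a1 l i + a2 l i) / 2) w) +
   array_form M N b (\<lambda>l i. a1 l i - a2 l i) / 2"
proof -
  have *: "c * (x + s) * (y + t) + c * (x + s') * (y + t') =
      2 * (c * (x + (s + s') / 2) * (y + (t + t') / 2)) + c * (s - s') * (t - t') / 2"
    for c x y s t s' t' :: real
    by (simp add: field_simps)
  show ?thesis
    unfolding array_form_def sum_distrib_left sum_divide_distrib sum.distrib[symmetric]
    by (intro sum.cong refl) (simp add: array_shift_def *)
qed

lemma array_form_measurable: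
  "array_form M N b \<in> borel_measurable (array_measure M N)"
  unfolding array_form_def
  by (intro borel_measurable_sum borel_measurable_times measurable_entry) auto

text \<open>The affinity of two normal laws with common covariance is exp(-F/8), with F the squared
  Mahalanobis distance. Weakening its square to 1 - F/4 makes the bound linear in F, hence summable
  over coordinates; where it is negative, \<open>ennreal\<close> cuts it off at 0.\<close>

lemma array_two_point_bound:
  fixes c :: real
  assumes c: "0 < c"
    and mass: "(\<integral>\<^sup>+w. ennreal (c * exp (- array_form M N b w / 2)) \<partial>array_measure M N) = 1"
    and p: "p = (\<lambda>w. c * exp (- array_form M N b w / 2))"
  shows "ennreal ((1 - array_form M N b (\<lambda>l i. a1 l i - a2 l i) / 4) / 2) \<le>
    (\<integral>\<^sup>+w. min (ennreal (p (array_shift M N a1 w))) (ennreal (p (array_shift M N a2 w))) \<partial>array_measure M N)"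
proof -
  define F where "F = array_form M N b (\<lambda>l i. a1 l i - a2 l i)"
  define h where "h = exp (- F / 8)"
  define a where "a l i = (a1 l i + a2 l i) / 2" for l i :: nat
  have "h\<^sup>2 = exp (- F / 4)" by (simp add: h_def power2_eq_square flip: exp_add)
  hence "(1 - F / 4) / 2 \<le> h\<^sup>2 / 2" using exp_ge_add_one_self[of "- F / 4"] by simp
  hence "ennreal ((1 - F / 4) / 2) \<le> ennreal (h\<^sup>2 / 2)" by (rule ennreal_leI)
  also have "\<dots> \<le> (\<integral>\<^sup>+w. min (ennreal (p (array_shift M N a1 w))) (ennreal (p (array_shift M N a2 w))) \<partial>array_measure M N)"
  proof (rule testing_affinity[where p = p and h = h and T = "array_shift M N a" and
        ?T1.0 = "array_shift M N a1" and ?T2.0 = "array_shift M N a2"])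
    fix w
    have "p (array_shift M N a1 w) * p (array_shift M N a2 w) =
        c\<^sup>2 * exp (- (array_form M N b (array_shift M N a1 w) + array_form M N b (array_shift M N a2 w)) / 2)"
      by (simp add: p power2_eq_square add_divide_distrib diff_divide_distrib flip: exp_add)
    also have "\<dots> = c\<^sup>2 * exp (- array_form M N b (array_shift M N a w) - F / 4)"
      unfolding array_form_parallelogram a_def[symmetric] F_def[symmetric] by (simp add: add_divide_distrib)
    also have "\<dots> = (h * p (array_shift M N a w))\<^sup>2"
      by (simp add: h_def p power_mult_distrib power2_eq_square flip: exp_add)
    finally show "p (array_shift M N a1 w) * p (array_shift M N a2 w) = (h * p (array_shift M N a w))\<^sup>2" .
  qed (use c mass in \<open>auto simp: p h_def intro!: array_shift_preserving measurable_compose[OF array_form_measurable]\<close>)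
  finally show ?thesis by (simp add: F_def)
qed

lemma mvn_density_eq:
  assumes "the (mat_inverse S) \<in> carrier_mat N N"
  shows "mvn_density N S y =
    exp (- (\<Sum>i<N. \<Sum>j<N. the (mat_inverse S) $$ (i, j) * y (Suc i) * y (Suc j)) / 2) / sqrt ((2 * pi) ^ N * det S)"
  using assms
  by (simp add: mvn_density_def Let_def scalar_prod_def lessThan_atLeast0 sum_distrib_left mult_ac)

text \<open>Independence of the rows turns the joint law into a product of normal densities. The
  covariances survive in the coefficients \<open>b\<close>, and the last clause carries the
  eigenvalue bound of the rows over to the whole array.\<close>

lemma gaussian_array_density:
  assumes P: "prob_space P" and MN: "1 \<le> M" "1 \<le> N"
    and gauss: "\<And>l. l \<in> {1..M} \<Longrightarrow> gaussian_vector P N (\<lambda>i. \<xi> i l) (cov_matrix P N (\<lambda>i. \<xi> i l))"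
    and indep: "prob_space.indep_vars P (\<lambda>_. PiM {1..N} (\<lambda>_. borel)) (\<lambda>l \<omega>. \<lambda>i\<in>{1..N}. \<xi> i l \<omega>) {1..M}"
    and L: "0 < L" "\<And>l. l \<in> {1..M} \<Longrightarrow> L \<le> lambda_min (cov_matrix P N (\<lambda>i. \<xi> i l))"
  obtains c b where "0 < (c::real)"
    "(\<lambda>\<omega>. \<lambda>l\<in>{1..M}. \<lambda>i\<in>{1..N}. \<xi> i l \<omega>) \<in> measurable P (array_measure M N)"
    "distr P (array_measure M N) (\<lambda>\<omega>. \<lambda>l\<in>{1..M}. \<lambda>i\<in>{1..N}. \<xi> i l \<omega>) =
       density (array_measure M N) (\<lambda>w. ennreal (c * exp (- array_form M N b w / 2)))"
    "\<And>d. array_form M N b d \<le> (\<Sum>l\<in>{1..M}. \<Sum>i\<in>{1..N}. (d l i)\<^sup>2) / L"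
proof -
  interpret prob_space P by fact
  let ?R = "PiM {1..N} (\<lambda>_::nat. lborel :: real measure)"
  define S where "S l = cov_matrix P N (\<lambda>i. \<xi> i l)" for l
  define X where "X l \<omega> = (\<lambda>i\<in>{1..N}. \<xi> i l \<omega>)" for l \<omega>
  define b where "b l i j = the (mat_inverse (S l)) $$ (i, j)" for l i j
  define k where "k l = 1 / sqrt ((2 * pi) ^ N * det (S l))" for l
  define q where "q l y = (\<Sum>i<N. \<Sum>j<N. b l i j * y (Suc i) * y (Suc j))" for l and y :: "nat \<Rightarrow> real"
  have SN: "S l \<in> carrier_mat N N" for l by (simp add: S_def cov_matrix_def)
  have sym: "S l $$ (i, j) = S l $$ (j, i)" if "i < N" "j < N" for i j l
    using that by (simp add: S_def cov_matrix_def mult.commute)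
  note inv = inverse_form_le[OF _ SN sym L(1)]
  have inv1: "the (mat_inverse (S l)) \<in> carrier_mat N N" if "l \<in> {1..M}" for l
    using inv(1)[of l "0\<^sub>v N"] L(2)[OF that] MN by (simp add: S_def)
  have q_le: "q l y \<le> (\<Sum>i\<in>{1..N}. (y i)\<^sup>2) / L" if "l \<in> {1..M}" for l y
  proof -
    let ?v = "vec N (\<lambda>i. y (Suc i))"
    have "q l y = ?v \<bullet> (the (mat_inverse (S l)) *\<^sub>v ?v)"
      using inv1[OF that]
      by (simp add: q_def b_def scalar_prod_def lessThan_atLeast0 sum_distrib_left mult_ac)
    also have "\<dots> \<le> (?v \<bullet> ?v) / L"
      using L(2)[OF that] MN by (intro inv(2)) (auto simp: S_def)
    also have "?v \<bullet> ?v = (\<Sum>i<N. (y (Suc i))\<^sup>2)"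
      by (simp add: scalar_prod_def lessThan_atLeast0 power2_eq_square)
    also have "\<dots> = (\<Sum>i\<in>{1..N}. (y i)\<^sup>2)"
      by (rule sum.reindex_bij_witness[of _ "\<lambda>i. i - 1" Suc]) auto
    finally show ?thesis .
  qed
  have mvn: "mvn_density N (S l) y = k l * exp (- q l y / 2)" if "l \<in> {1..M}" for l y
    using mvn_density_eq[OF inv1[OF that]] by (simp add: q_def b_def k_def)
  have dist: "distributed P ?R (X l) (\<lambda>y. ennreal (mvn_density N (S l) y))" if "l \<in> {1..M}" for l
    using gauss[OF that] by (simp add: gaussian_vector_def S_def X_def[abs_def])
  have Xm: "X l \<in> measurable P ?R" if "l \<in> {1..M}" for l
    using dist[OF that] by (rule distributed_measurable)
  have law: "distr P ?R (X l) = density ?R (\<lambda>y. ennreal (mvn_density N (S l) y))" if "l \<in> {1..M}" for l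
    using dist[OF that] by (rule distributed_distr_eq_density)
  have law_prob: "prob_space (density ?R (\<lambda>y. ennreal (mvn_density N (S l) y)))" if "l \<in> {1..M}" for l
    using prob_space_distr[OF Xm[OF that]] law[OF that] by simp
  have dens_m: "(\<lambda>y. ennreal (mvn_density N (S l) y)) \<in> borel_measurable ?R" if "l \<in> {1..M}" for l
    using dist[OF that] by (simp add: distributed_def)
  \<comment> \<open>Instead of computing the sign of the determinant: a constant k <= 0 would make
    the density vanish as an \<open>ennreal\<close>, against total mass one.\<close>
  have k: "0 < k l" if "l \<in> {1..M}" for l
  proof (rule ccontr)
    assume "\<not> 0 < k l"
    hence "ennreal (mvn_density N (S l) y) = 0" for y
      using mvn[OF that] by (simp add: ennreal_eq_0_iff mult_nonpos_nonneg)
    hence "density ?R (\<lambda>y. ennreal (mvn_density N (S l) y)) = density ?R (\<lambda>_. 0)" by simp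
    with law_prob[OF that] have "prob_space (density ?R (\<lambda>_. 0))" by simp
    from prob_space.emeasure_space_1[OF this] show False by (simp add: emeasure_density)
  qed
  define c where "c = (\<Prod>l\<in>{1..M}. k l)"
  \<comment> \<open>Independence is stated over \<open>borel\<close>, the densities over
    \<open>lborel\<close>. Both have the same measurable sets, so the laws can be
    identified.\<close>
  have sets_R: "sets ?R = sets (PiM {1..N} (\<lambda>_. borel))"
    by (intro sets_PiM_cong) auto
  have sets_A: "sets (array_measure M N) = sets (PiM {1..M} (\<lambda>_. PiM {1..N} (\<lambda>_. borel)))"
    unfolding array_measure_def by (intro sets_PiM_cong sets_R) auto
  have Xb: "X l \<in> measurable P (PiM {1..N} (\<lambda>_. borel))" if "l \<in> {1..M}" for l
    using Xm[OF that] measurable_cong_sets[OF refl sets_R, of P] by auto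
  have "distr P (PiM {1..M} (\<lambda>_. PiM {1..N} (\<lambda>_. borel))) (\<lambda>\<omega>. \<lambda>l\<in>{1..M}. X l \<omega>) =
      PiM {1..M} (\<lambda>l. distr P (PiM {1..N} (\<lambda>_. borel)) (X l))"
    using indep_vars_iff_distr_eq_PiM'[of "{1..M}" X "\<lambda>_. PiM {1..N} (\<lambda>_. borel)"] indep Xb MN
    by (simp add: X_def[abs_def])
  also have "\<dots> = PiM {1..M} (\<lambda>l. density ?R (\<lambda>y. ennreal (mvn_density N (S l) y)))"
  proof (intro PiM_cong refl)
    fix l assume l: "l \<in> {1..M}"
    have "distr P (PiM {1..N} (\<lambda>_. borel)) (X l) = distr P ?R (X l)"
      by (rule distr_cong[OF refl sets_R[symmetric] refl])
    thus "distr P (PiM {1..N} (\<lambda>_. borel)) (X l) = density ?R (\<lambda>y. ennreal (mvn_density N (S l) y))"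
      by (simp only: law[OF l])
  qed
  also have "\<dots> = density (array_measure M N) (\<lambda>w. \<Prod>l\<in>{1..M}. ennreal (mvn_density N (S l) (w l)))"
    unfolding array_measure_def
    by (intro PiM_density sigma_finite_PiM_lborel dens_m law_prob) auto
  also have "(\<lambda>w. \<Prod>l\<in>{1..M}. ennreal (mvn_density N (S l) (w l))) =
      (\<lambda>w. ennreal (c * exp (- array_form M N b w / 2)))"
  proof
    fix w
    have "(\<Prod>l\<in>{1..M}. ennreal (mvn_density N (S l) (w l))) = ennreal (\<Prod>l\<in>{1..M}. mvn_density N (S l) (w l))"
      using k mvn by (intro prod_ennreal) (auto intro!: mult_nonneg_nonneg less_imp_le)
    also have "(\<Prod>l\<in>{1..M}. mvn_density N (S l) (w l)) = c * exp (\<Sum>l\<in>{1..M}. - q l (w l) / 2)"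
      using mvn by (simp add: c_def prod.distrib exp_sum)
    also have "(\<Sum>l\<in>{1..M}. - q l (w l) / 2) = - array_form M N b w / 2"
      by (simp add: array_form_def q_def sum_negf sum_divide_distrib)
    finally show "(\<Prod>l\<in>{1..M}. ennreal (mvn_density N (S l) (w l))) = ennreal (c * exp (- array_form M N b w / 2))" .
  qed
  finally have D: "distr P (PiM {1..M} (\<lambda>_. PiM {1..N} (\<lambda>_. borel))) (\<lambda>\<omega>. \<lambda>l\<in>{1..M}. X l \<omega>) =
      density (array_measure M N) (\<lambda>w. ennreal (c * exp (- array_form M N b w / 2)))" .
  show ?thesis
  proof (rule that[of c b])
    show "0 < c" unfolding c_def using k by (intro prod_pos) auto
    show "(\<lambda>\<omega>. \<lambda>l\<in>{1..M}. \<lambda>i\<in>{1..N}. \<xi> i l \<omega>) \<in> measurable P (array_measure M N)"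
      unfolding array_measure_def X_def[symmetric] by (intro measurable_restrict Xm)
    have "distr P (array_measure M N) (\<lambda>\<omega>. \<lambda>l\<in>{1..M}. X l \<omega>) =
        distr P (PiM {1..M} (\<lambda>_. PiM {1..N} (\<lambda>_. borel))) (\<lambda>\<omega>. \<lambda>l\<in>{1..M}. X l \<omega>)"
      by (rule distr_cong[OF refl sets_A refl])
    thus "distr P (array_measure M N) (\<lambda>\<omega>. \<lambda>l\<in>{1..M}. \<lambda>i\<in>{1..N}. \<xi> i l \<omega>) =
       density (array_measure M N) (\<lambda>w. ennreal (c * exp (- array_form M N b w / 2)))"
      using D by (simp add: X_def)
    fix d
    have "array_form M N b d = (\<Sum>l\<in>{1..M}. q l (d l))" by (simp add: array_form_def q_def)
    also have "\<dots> \<le> (\<Sum>l\<in>{1..M}. (\<Sum>i\<in>{1..N}. (d l i)\<^sup>2) / L)" by (intro sum_mono q_le)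
    finally show "array_form M N b d \<le> (\<Sum>l\<in>{1..M}. \<Sum>i\<in>{1..N}. (d l i)\<^sup>2) / L"
      by (simp add: sum_divide_distrib)
  qed
qed

section \<open>Observations and loss after moving the signal into the density\<close>

abbreviation square_measure :: "(real \<times> real) measure" where
  "square_measure \<equiv> restrict_space lborel unit_square"

text \<open>What the estimator sees once the signal sits in the density: the scaled array, reindexed
  from \<open>w l i\<close> to the pair \<open>(i, l)\<close>.\<close>

definition array_data :: "real \<Rightarrow> nat \<Rightarrow> nat \<Rightarrow> (nat \<Rightarrow> nat \<Rightarrow> real) \<Rightarrow> nat \<times> nat \<Rightarrow> real" where
  "array_data \<sigma> M N w = (\<lambda>(i, l)\<in>{1..N} \<times> {1..M}. \<sigma> * w l i)"

lemma measurable_array_data: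
  "array_data \<sigma> M N \<in> measurable (array_measure M N) (PiM ({1..N} \<times> {1..M}) (\<lambda>_. borel))"
proof -
  have "array_data \<sigma> M N = (\<lambda>w. \<lambda>z\<in>{1..N} \<times> {1..M}. \<sigma> * w (snd z) (fst z))"
    by (simp add: array_data_def[abs_def] split_def)
  thus ?thesis
    by (simp only:) (intro measurable_restrict borel_measurable_times borel_measurable_const measurable_entry; auto)
qed

text \<open>The variable w is replaced by w + a, where \<open>a\<close> is minus the signal divided
  by \<sigma>. Afterwards the estimator sees the same array for every \<open>f\<close>, and
  \<open>f\<close> enters only through the density. This is the shape of the densities
  \<open>q E\<close> in \<open>assouad\<close>.\<close>

lemma nn_integral_observation:
  fixes F :: "(nat \<times> nat \<Rightarrow> real) \<Rightarrow> ennreal" and p :: "(nat \<Rightarrow> nat \<Rightarrow> real) \<Rightarrow> real"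
  assumes \<sigma>: "\<sigma> \<noteq> 0"
    and \<xi>: "(\<lambda>\<omega>. \<lambda>l\<in>{1..M}. \<lambda>i\<in>{1..N}. \<xi> i l \<omega>) \<in> measurable P (array_measure M N)"
    and law: "distr P (array_measure M N) (\<lambda>\<omega>. \<lambda>l\<in>{1..M}. \<lambda>i\<in>{1..N}. \<xi> i l \<omega>) =
       density (array_measure M N) (\<lambda>w. ennreal (p w))"
    and p: "p \<in> borel_measurable (array_measure M N)"
    and F: "F \<in> borel_measurable (PiM ({1..N} \<times> {1..M}) (\<lambda>_. borel))"
    and a: "\<And>l i. a l i = - convolve f g (real i / real N) (real l / real M) / \<sigma>"
  shows "(\<integral>\<^sup>+\<omega>. F (observation g f \<sigma> M N \<xi> \<omega>) \<partial>P) =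
      (\<integral>\<^sup>+w. ennreal (p (array_shift M N a w)) * F (array_data \<sigma> M N w) \<partial>array_measure M N)"
proof -
  let ?A = "array_measure M N"
  let ?noise = "\<lambda>\<omega>. \<lambda>l\<in>{1..M}. \<lambda>i\<in>{1..N}. \<xi> i l \<omega>"
  let ?minus = "\<lambda>l i. - a l i"
  have Fflat: "(\<lambda>w. F (array_data \<sigma> M N w)) \<in> borel_measurable ?A"
    by (rule measurable_compose[OF measurable_array_data F])
  have obs: "observation g f \<sigma> M N \<xi> \<omega> = array_data \<sigma> M N (array_shift M N ?minus (?noise \<omega>))" for \<omega>
    using \<sigma> by (intro ext) (auto simp: observation_def array_data_def array_shift_def a restrict_def field_simps)
  have G: "(\<lambda>w. F (array_data \<sigma> M N (array_shift M N ?minus w))) \<in> borel_measurable ?A"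
    by (rule measurable_compose[OF array_shift_preserving(1) Fflat])
  \<comment> \<open>The two shifts are mutually inverse only on the space of the product measure,
    whose elements are \<open>undefined\<close> off the index sets.\<close>
  have shift_shift: "array_shift M N a (array_shift M N ?minus w) = w" if "w \<in> space ?A" for w
    using that by (intro ext) (auto simp: array_shift_def array_measure_def space_PiM PiE_iff extensional_def restrict_def)
  have "(\<integral>\<^sup>+\<omega>. F (observation g f \<sigma> M N \<xi> \<omega>) \<partial>P) =
      (\<integral>\<^sup>+w. F (array_data \<sigma> M N (array_shift M N ?minus w)) \<partial>distr P ?A ?noise)"
    unfolding obs by (rule nn_integral_distr[symmetric, OF \<xi>]) (use G in simp)
  also have "\<dots> = (\<integral>\<^sup>+w. ennreal (p w) * F (array_data \<sigma> M N (array_shift M N ?minus w)) \<partial>?A)"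
    unfolding law using p by (intro nn_integral_density G) auto
  also have "\<dots> = (\<integral>\<^sup>+w. ennreal (p (array_shift M N a (array_shift M N ?minus w))) *
      F (array_data \<sigma> M N (array_shift M N ?minus w)) \<partial>?A)"
    by (intro nn_integral_cong) (simp add: shift_shift)
  also have "\<dots> = (\<integral>\<^sup>+w. ennreal (p (array_shift M N a w)) * F (array_data \<sigma> M N w) \<partial>?A)"
    by (rule measure_preserving_nn_integral[OF array_shift_preserving, where f = "\<lambda>w. ennreal (p (array_shift M N a w)) * F (array_data \<sigma> M N w)"])
       (intro borel_measurable_times_ennreal Fflat measurable_compose[OF _ measurable_ennreal]
          measurable_compose[OF array_shift_preserving(1) p])
  finally show "(\<integral>\<^sup>+\<omega>. F (observation g f \<sigma> M N \<xi> \<omega>) \<partial>P) =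
      (\<integral>\<^sup>+w. ennreal (p (array_shift M N a w)) * F (array_data \<sigma> M N w) \<partial>array_measure M N)" .
qed

text \<open>\<open>ennreal\<close> cuts negative summands off at 0, which can only enlarge the
  right-hand side. The two-point bounds may be negative.\<close>

lemma ennreal_sum_le: "ennreal (\<Sum>k\<in>K. x k) \<le> (\<Sum>k\<in>K. ennreal (x k))"
proof -
  have "ennreal (\<Sum>k\<in>K. x k) \<le> ennreal (\<Sum>k\<in>K. max 0 (x k))"
    by (intro ennreal_leI sum_mono) simp
  also have "\<dots> = (\<Sum>k\<in>K. ennreal (max 0 (x k)))" by (intro sum_ennreal[symmetric]) simp
  also have "\<dots> = (\<Sum>k\<in>K. ennreal (x k))"
    by (intro sum.cong refl) (simp add: max_def ennreal_neg)
  finally show ?thesis .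
qed

text \<open>Bessel's inequality for the estimation error, so that an arbitrary estimate is judged by
  its coefficients. Infinite loss is trivial; finite loss makes the error square integrable,
  although \<open>h\<close> is merely measurable.\<close>

lemma bessel_loss:
  fixes u :: "'k \<Rightarrow> 'a \<Rightarrow> real"
  assumes K: "finite K" and u: "\<And>k. k \<in> K \<Longrightarrow> u k \<in> borel_measurable M"
    "\<And>k. k \<in> K \<Longrightarrow> integrable M (\<lambda>x. (u k x)\<^sup>2)"
    and ortho: "\<And>k k'. k \<in> K \<Longrightarrow> k' \<in> K \<Longrightarrow> (\<integral>x. u k x * u k' x \<partial>M) = (if k = k' then 1 else 0)"
    and h: "h \<in> borel_measurable M"
  shows "(\<Sum>k\<in>K. ennreal (((\<integral>x. h x * u k x \<partial>M) - c k)\<^sup>2)) \<le>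
    (\<integral>\<^sup>+x. ennreal ((h x - (\<Sum>k\<in>K. c k * u k x))\<^sup>2) \<partial>M)"
proof (cases "(\<integral>\<^sup>+x. ennreal ((h x - (\<Sum>k\<in>K. c k * u k x))\<^sup>2) \<partial>M) = \<infinity>")
  case False
  define f where "f x = (\<Sum>k\<in>K. c k * u k x)" for x
  define d where "d x = h x - f x" for x
  have f: "f \<in> borel_measurable M" unfolding f_def using u by auto
  have d: "d \<in> borel_measurable M" unfolding d_def using h f by simp
  have d2: "integrable M (\<lambda>x. (d x)\<^sup>2)"
  proof (rule integrableI_nonneg)
    show "(\<lambda>x. (d x)\<^sup>2) \<in> borel_measurable M" using d by simp
    show "(\<integral>\<^sup>+x. ennreal ((d x)\<^sup>2) \<partial>M) < \<infinity>"
      using False by (simp add: d_def f_def top.not_eq_extremum)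
  qed simp
  have du: "integrable M (\<lambda>x. d x * u k x)" if "k \<in> K" for k
    using that u d d2 by (intro integrable_mult_of_squares) auto
  have uu: "integrable M (\<lambda>x. u k x * u k' x)" if "k \<in> K" "k' \<in> K" for k k'
    using that u by (intro integrable_mult_of_squares) auto
  have coeff: "(\<integral>x. d x * u k x \<partial>M) = (\<integral>x. h x * u k x \<partial>M) - c k" if k: "k \<in> K" for k
  proof -
    have fu: "integrable M (\<lambda>x. \<Sum>k'\<in>K. c k' * (u k' x * u k x))"
      using uu k by auto
    have "(\<integral>x. (\<Sum>k'\<in>K. c k' * (u k' x * u k x)) \<partial>M) = (\<Sum>k'\<in>K. c k' * (\<integral>x. u k' x * u k x \<partial>M))"
      using uu k by (simp add: Bochner_Integration.integral_sum)
    also have "\<dots> = (\<Sum>k'\<in>K. if k' = k then c k else 0)"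
      by (intro sum.cong refl) (simp add: ortho k)
    also have "\<dots> = c k" using K k by simp
    finally have fk: "(\<integral>x. (\<Sum>k'\<in>K. c k' * (u k' x * u k x)) \<partial>M) = c k" .
    have "(\<integral>x. h x * u k x \<partial>M) = (\<integral>x. d x * u k x + (\<Sum>k'\<in>K. c k' * (u k' x * u k x)) \<partial>M)"
      by (intro Bochner_Integration.integral_cong refl)
         (simp add: d_def f_def algebra_simps sum_distrib_left sum_distrib_right)
    also have "\<dots> = (\<integral>x. d x * u k x \<partial>M) + c k"
      using du[OF k] fu by (simp add: fk)
    finally show ?thesis by simp
  qed
  have "(\<Sum>k\<in>K. ((\<integral>x. h x * u k x \<partial>M) - c k)\<^sup>2) = (\<Sum>k\<in>K. (\<integral>x. d x * u k x \<partial>M)\<^sup>2)"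
    by (intro sum.cong refl) (simp add: coeff)
  also have "\<dots> \<le> (\<integral>x. (d x)\<^sup>2 \<partial>M)"
    by (rule bessel_inequality[OF K u ortho d d2])
  finally have "ennreal (\<Sum>k\<in>K. ((\<integral>x. h x * u k x \<partial>M) - c k)\<^sup>2) \<le> ennreal (\<integral>x. (d x)\<^sup>2 \<partial>M)"
    by (rule ennreal_leI)
  also have "\<dots> = (\<integral>\<^sup>+x. ennreal ((d x)\<^sup>2) \<partial>M)"
    by (intro nn_integral_eq_integral[symmetric] d2) auto
  finally show ?thesis by (simp add: d_def f_def sum_ennreal)
qed simp

text \<open>
  Only the sum over the index set \<open>K\<close> of the energies of the
  blurred functions at the design points enters, so no relation between the resolution level and
  the sample size is needed.
\<close>

lemma minimax_risk_assouad:
  fixes \<xi> :: "nat \<Rightarrow> nat \<Rightarrow> 'w \<Rightarrow> real" and u :: "'k \<Rightarrow> real \<times> real \<Rightarrow> real"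
  assumes P: "prob_space P" and MN: "1 \<le> M" "1 \<le> N" and \<sigma>: "0 < \<sigma>"
    and gauss: "\<And>l. l \<in> {1..M} \<Longrightarrow> gaussian_vector P N (\<lambda>i. \<xi> i l) (cov_matrix P N (\<lambda>i. \<xi> i l))"
    and indep: "prob_space.indep_vars P (\<lambda>_. PiM {1..N} (\<lambda>_. borel)) (\<lambda>l \<omega>. \<lambda>i\<in>{1..N}. \<xi> i l \<omega>) {1..M}"
    and L: "0 < L" "\<And>l. l \<in> {1..M} \<Longrightarrow> L \<le> lambda_min (cov_matrix P N (\<lambda>i. \<xi> i l))"
    and K: "finite K" and \<gamma>: "0 \<le> \<gamma>"
    and u: "\<And>k. k \<in> K \<Longrightarrow> u k \<in> borel_measurable borel"
      "\<And>k. k \<in> K \<Longrightarrow> integrable (square_measure) (\<lambda>z. (u k z)\<^sup>2)"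
    and ortho: "\<And>k k'. k \<in> K \<Longrightarrow> k' \<in> K \<Longrightarrow>
        (\<integral>z. u k z * u k' z \<partial>square_measure) = (if k = k' then 1 else 0)"
    and \<Theta>: "\<And>E. E \<subseteq> K \<Longrightarrow> (\<lambda>z. \<Sum>k\<in>E. \<gamma> * u k z) \<in> \<Theta>"
    and conv: "\<And>E i l. E \<subseteq> K \<Longrightarrow> i \<in> {1..N} \<Longrightarrow> l \<in> {1..M} \<Longrightarrow>
        convolve (\<lambda>z. \<Sum>k\<in>E. \<gamma> * u k z) g (real i / real N) (real l / real M) =
        (\<Sum>k\<in>E. \<gamma> * v k i l)"
  shows "ennreal (\<Sum>k\<in>K. \<gamma>\<^sup>2 / 8 * (1 - \<gamma>\<^sup>2 / (4 * \<sigma>\<^sup>2 * L) * (\<Sum>l\<in>{1..M}. \<Sum>i\<in>{1..N}. (v k i l)\<^sup>2)))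
    \<le> minimax_risk P \<xi> g \<sigma> M N \<Theta>" (is "ennreal ?lower \<le> _")
  unfolding minimax_risk_def
proof (rule INF_greatest)
  let ?A = "array_measure M N"
  fix T assume T: "T \<in> estimators M N"
  let ?loss = "\<lambda>f. \<integral>\<^sup>+\<omega>. (\<integral>\<^sup>+z\<in>unit_square. ennreal ((T (observation g f \<sigma> M N \<xi> \<omega>) z - f z)\<^sup>2) \<partial>lborel) \<partial>P"
  obtain c b where c: "0 < (c::real)" and
    \<xi>: "(\<lambda>\<omega>. \<lambda>l\<in>{1..M}. \<lambda>i\<in>{1..N}. \<xi> i l \<omega>) \<in> measurable P ?A" and
    law: "distr P ?A (\<lambda>\<omega>. \<lambda>l\<in>{1..M}. \<lambda>i\<in>{1..N}. \<xi> i l \<omega>) =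
       density ?A (\<lambda>w. ennreal (c * exp (- array_form M N b w / 2)))" and
    form: "\<And>d. array_form M N b d \<le> (\<Sum>l\<in>{1..M}. \<Sum>i\<in>{1..N}. (d l i)\<^sup>2) / L"
    using gaussian_array_density[OF P MN gauss indep L] by blast
  define p where "p = (\<lambda>w. c * exp (- array_form M N b w / 2))"
  have pm: "p \<in> borel_measurable ?A" unfolding p_def using array_form_measurable[of M N b] by simp
  have law_p: "distr P ?A (\<lambda>\<omega>. \<lambda>l\<in>{1..M}. \<lambda>i\<in>{1..N}. \<xi> i l \<omega>) = density ?A (\<lambda>w. ennreal (p w))"
    using law by (simp add: p_def)
  have mass: "(\<integral>\<^sup>+w. ennreal (c * exp (- array_form M N b w / 2)) \<partial>?A) = 1"
  proof -
    have "prob_space (density ?A (\<lambda>w. ennreal (p w)))"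
      using prob_space.prob_space_distr[OF P \<xi>] law_p by simp
    from prob_space.emeasure_space_1[OF this] show ?thesis
      using pm by (simp add: emeasure_density p_def cong: nn_integral_cong)
  qed
  define f where "f E z = (\<Sum>k\<in>E. \<gamma> * u k z)" for E z
  define a where "a E l i = - convolve (f E) g (real i / real N) (real l / real M) / \<sigma>" for E and l i :: nat
  \<comment> \<open>The k-th coefficient of the estimate, regarded as an estimator of the unknown
    value 0 or \<gamma>.\<close>
  define s where "s k w = (\<integral>z. T (array_data \<sigma> M N w) z * u k z \<partial>square_measure)" for k w
  define loss where "loss E y = (\<integral>\<^sup>+z\<in>unit_square. ennreal ((T y z - f E z)\<^sup>2) \<partial>lborel)" for E y
  have Tm: "(\<lambda>(y, z). T y z) \<in> borel_measurable (PiM ({1..N} \<times> {1..M}) (\<lambda>_. borel) \<Otimes>\<^sub>M lborel)"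
    using T by (simp add: estimators_def)
  have sq: "unit_square \<in> sets lborel" by (simp add: borel_Times)
  have f_m: "f E \<in> borel_measurable borel" if "E \<subseteq> K" for E
    unfolding f_def using that u by (intro borel_measurable_sum) auto
  have loss_m: "loss E \<in> borel_measurable (PiM ({1..N} \<times> {1..M}) (\<lambda>_. borel))" if "E \<subseteq> K" for E
  proof -
    have [measurable]: "(\<lambda>(y, z). T y z) \<in> borel_measurable (PiM ({1..N} \<times> {1..M}) (\<lambda>_. borel) \<Otimes>\<^sub>M lborel)"
      by (rule Tm)
    have [measurable]: "f E \<in> borel_measurable borel" by (rule f_m[OF that])
    have [measurable]: "unit_square \<in> sets borel" using sq by simp
    show ?thesis unfolding loss_def by measurable
  qed
  have s_m: "s k \<in> borel_measurable ?A" if "k \<in> K" for k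
  proof -
    have [measurable]: "(\<lambda>(y, z). T y z) \<in> borel_measurable (PiM ({1..N} \<times> {1..M}) (\<lambda>_. borel) \<Otimes>\<^sub>M lborel)"
      by (rule Tm)
    have [measurable]: "u k \<in> borel_measurable borel" by (rule u(1)[OF that])
    have [measurable]: "unit_square \<in> sets borel" using sq by simp
    have "(\<lambda>y. \<integral>z. indicator unit_square z *\<^sub>R (T y z * u k z) \<partial>lborel) \<in>
        borel_measurable (PiM ({1..N} \<times> {1..M}) (\<lambda>_. borel))"
      by measurable
    from measurable_compose[OF measurable_array_data this] show ?thesis
      unfolding s_def using sq by (simp add: integral_restrict_space)
  qed
  have T_sec: "T y \<in> borel_measurable square_measure" if "y \<in> space (PiM ({1..N} \<times> {1..M}) (\<lambda>_. borel :: real measure))" for y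
    using measurable_Pair2[OF Tm that] by (auto intro: measurable_restrict_space1)
  have u_Q: "u k \<in> borel_measurable square_measure" if "k \<in> K" for k
    using u(1)[OF that] by (auto intro: measurable_restrict_space1)
  have loss_ge: "(\<Sum>k\<in>K. ennreal ((s k w - (if k \<in> E then \<gamma> else 0))\<^sup>2)) \<le> loss E (array_data \<sigma> M N w)"
    if E: "E \<subseteq> K" and w: "w \<in> space ?A" for E w
  proof -
    have fE: "f E z = (\<Sum>k\<in>K. (if k \<in> E then \<gamma> else 0) * u k z)" for z
    proof -
      have "f E z = (\<Sum>k\<in>E. (if k \<in> E then \<gamma> else 0) * u k z)" by (simp add: f_def)
      also have "\<dots> = (\<Sum>k\<in>K. (if k \<in> E then \<gamma> else 0) * u k z)"
        using K E by (intro sum.mono_neutral_left) auto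
      finally show ?thesis .
    qed
    have "loss E (array_data \<sigma> M N w) = (\<integral>\<^sup>+z. ennreal ((T (array_data \<sigma> M N w) z - f E z)\<^sup>2) \<partial>square_measure)"
      using sq by (simp add: loss_def nn_integral_restrict_space)
    moreover have "T (array_data \<sigma> M N w) \<in> borel_measurable square_measure"
      by (intro T_sec measurable_space[OF measurable_array_data w])
    ultimately show ?thesis
      using bessel_loss[OF K u_Q u(2) ortho, where h = "T (array_data \<sigma> M N w)" and c = "\<lambda>k. if k \<in> E then \<gamma> else 0"]
      by (simp add: s_def fE)
  qed
  \<comment> \<open>The two-point bound (1 - F/4)/2 with F replaced by its upper bound,
    \<gamma>^2/(\<sigma>^2 L) times the energy of the blurred \<open>u k\<close>.\<close>
  define x where "x k = (1 - \<gamma>\<^sup>2 / (4 * \<sigma>\<^sup>2 * L) * (\<Sum>l\<in>{1..M}. \<Sum>i\<in>{1..N}. (v k i l)\<^sup>2)) / 2" for k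
  have pair: "ennreal (x k) \<le> (\<integral>\<^sup>+w. min (ennreal (p (array_shift M N (a E) w)))
      (ennreal (p (array_shift M N (a (insert k E)) w))) \<partial>?A)"
    if k: "k \<in> K" and E: "E \<subseteq> K - {k}" for k E
  proof -
    \<comment> \<open>By linearity of the blur, switching on \<open>k\<close> changes the signal by
      \<gamma> times \<open>v k\<close>, whatever \<open>E\<close> is.\<close>
    have diff: "(a E l i - a (insert k E) l i)\<^sup>2 = \<gamma>\<^sup>2 / \<sigma>\<^sup>2 * (v k i l)\<^sup>2" if "l \<in> {1..M}" "i \<in> {1..N}" for l i
    proof -
      have "finite E" "k \<notin> E" using E K finite_subset by auto
      moreover have "convolve (f E) g (real i / real N) (real l / real M) = (\<Sum>k\<in>E. \<gamma> * v k i l)"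
        using conv[of E i l] E that by (auto simp: f_def[abs_def])
      moreover have "convolve (f (insert k E)) g (real i / real N) (real l / real M) = (\<Sum>k\<in>insert k E. \<gamma> * v k i l)"
        using conv[of "insert k E" i l] E k that by (auto simp: f_def[abs_def])
      ultimately have "a E l i - a (insert k E) l i = \<gamma> * v k i l / \<sigma>"
        by (simp add: a_def divide_inverse algebra_simps)
      thus ?thesis by (simp add: power_mult_distrib power_divide)
    qed
    have "array_form M N b (\<lambda>l i. a E l i - a (insert k E) l i) \<le>
        (\<Sum>l\<in>{1..M}. \<Sum>i\<in>{1..N}. (a E l i - a (insert k E) l i)\<^sup>2) / L"
      by (rule form)
    also have "(\<Sum>l\<in>{1..M}. \<Sum>i\<in>{1..N}. (a E l i - a (insert k E) l i)\<^sup>2) =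
        (\<Sum>l\<in>{1..M}. \<Sum>i\<in>{1..N}. \<gamma>\<^sup>2 / \<sigma>\<^sup>2 * (v k i l)\<^sup>2)"
      by (intro sum.cong refl diff)
    also have "(\<Sum>l\<in>{1..M}. \<Sum>i\<in>{1..N}. \<gamma>\<^sup>2 / \<sigma>\<^sup>2 * (v k i l)\<^sup>2) / L =
        \<gamma>\<^sup>2 / (\<sigma>\<^sup>2 * L) * (\<Sum>l\<in>{1..M}. \<Sum>i\<in>{1..N}. (v k i l)\<^sup>2)"
      by (simp add: sum_distrib_left sum_divide_distrib)
    finally have "x k \<le> (1 - array_form M N b (\<lambda>l i. a E l i - a (insert k E) l i) / 4) / 2"
      by (simp add: x_def mult.commute[of L])
    hence "ennreal (x k) \<le> ennreal ((1 - array_form M N b (\<lambda>l i. a E l i - a (insert k E) l i) / 4) / 2)"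
      by (rule ennreal_leI)
    also have "\<dots> \<le> (\<integral>\<^sup>+w. min (ennreal (p (array_shift M N (a E) w)))
      (ennreal (p (array_shift M N (a (insert k E)) w))) \<partial>?A)"
      by (rule array_two_point_bound[OF c mass p_def])
    finally show ?thesis .
  qed
  have "ennreal ?lower =
      ennreal (\<Sum>k\<in>K. \<gamma>\<^sup>2 / 4 * x k)"
    by (simp add: x_def)
  also have "\<dots> \<le> (\<Sum>k\<in>K. ennreal (\<gamma>\<^sup>2 / 4 * x k))" by (rule ennreal_sum_le)
  also have "\<dots> = (\<Sum>k\<in>K. ennreal (\<gamma>\<^sup>2 / 4) * ennreal (x k))"
    by (intro sum.cong refl ennreal_mult') simp
  also have "\<dots> \<le> (SUP E\<in>Pow K. \<integral>\<^sup>+w. ennreal (p (array_shift M N (a E) w)) *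
      (\<Sum>k\<in>K. ennreal ((s k w - (if k \<in> E then \<gamma> else 0))\<^sup>2)) \<partial>?A)"
    using measurable_compose[OF array_shift_preserving(1) pm]
    by (intro assouad[OF K _ s_m \<gamma> pair] measurable_compose[OF _ measurable_ennreal])
  also have "\<dots> \<le> (SUP E\<in>Pow K. \<integral>\<^sup>+w. ennreal (p (array_shift M N (a E) w)) * loss E (array_data \<sigma> M N w) \<partial>?A)"
    by (intro SUP_subset_mono order_refl nn_integral_mono mult_left_mono loss_ge) auto
  also have "\<dots> = (SUP E\<in>Pow K. \<integral>\<^sup>+\<omega>. loss E (observation g (f E) \<sigma> M N \<xi> \<omega>) \<partial>P)"
    using \<sigma> by (intro SUP_cong refl nn_integral_observation[symmetric, OF _ \<xi> law_p pm loss_m]) (auto simp: a_def)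
  also have "\<dots> \<le> (SUP f\<in>\<Theta>. ?loss f)"
  proof (rule SUP_least)
    fix E assume "E \<in> Pow K"
    hence "f E \<in> \<Theta>" using \<Theta>[of E] by (simp add: f_def[abs_def])
    from SUP_upper[OF this, of ?loss]
    show "(\<integral>\<^sup>+\<omega>. loss E (observation g (f E) \<sigma> M N \<xi> \<omega>) \<partial>P) \<le>
        (SUP f\<in>\<Theta>. ?loss f)"
      by (simp add: loss_def)
  qed
  finally show "ennreal ?lower \<le>
      (SUP f\<in>\<Theta>. ?loss f)" .
qed

section \<open>Fourier coefficients on the unit interval\<close>

abbreviation unit_measure :: "real measure" where
  "unit_measure \<equiv> restrict_space lborel {0..1}"

abbreviation char_fn :: "int \<Rightarrow> real \<Rightarrow> complex" where
  "char_fn n t \<equiv> cis (2 * pi * of_int n * t)"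

lemma integrable_unit_continuous:
  fixes f :: "real \<Rightarrow> 'b::{banach, second_countable_topology}"
  assumes "continuous_on {0..1} f"
  shows "integrable unit_measure f"
  using borel_integrable_atLeastAtMost'[OF assms]
  by (simp add: set_integrable_def integrable_restrict_space)

lemma integral_unit_eq:
  fixes f :: "real \<Rightarrow> 'b::{banach, second_countable_topology}"
  shows "(LINT t:{0..1}|lborel. f t) = (\<integral>t. f t \<partial>unit_measure)"
  by (simp add: set_lebesgue_integral_def integral_restrict_space)

lemma integrable_unit_iff:
  fixes f :: "real \<Rightarrow> 'b::{banach, second_countable_topology}"
  shows "integrable unit_measure f \<longleftrightarrow> set_integrable lborel {0..1} f"
  by (simp add: set_integrable_def integrable_restrict_space)

lemma integral_unit_const: "(\<integral>t. c \<partial>unit_measure) = (c :: 'b::{banach, second_countable_topology})"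
  by (simp add: space_restrict_space measure_restrict_space)

lemma continuous_char_fn [continuous_intros]: "continuous_on S (char_fn n)"
  by (intro continuous_intros)

lemma char_fn_add: "char_fn n t * char_fn m t = char_fn (n + m) t"
  by (simp add: cis_mult algebra_simps)

lemma integral_char_fn: "(\<integral>t. char_fn n t \<partial>unit_measure) = (if n = 0 then 1 else 0)"
proof (cases "n = 0")
  case True thus ?thesis using integral_unit_const[of "1::complex"] by simp
next
  case False
  define c where "c = 2 * of_real pi * of_int n * \<i>"
  have c: "c \<noteq> 0" using False by (simp add: c_def)
  define F where "F t = exp (c * of_real t) / c" for t :: real
  have char: "char_fn n t = exp (c * of_real t)" for t
    by (simp add: c_def cis_conv_exp algebra_simps)
  have "(char_fn n has_integral (F 1 - F 0)) {0..1}"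
  proof (rule fundamental_theorem_of_calculus)
    fix t :: real
    have "((\<lambda>z. exp (c * z) / c) has_field_derivative exp (c * of_real t)) (at (of_real t))"
      using c by (auto intro!: derivative_eq_intros)
    thus "(F has_vector_derivative char_fn n t) (at t within {0..1})"
      unfolding F_def char by (rule has_vector_derivative_real_field)
  qed simp
  moreover have "F 1 = F 0"
  proof -
    have "cis (2 * pi * of_int n) = 1" by (rule cis_multiple_2pi) simp
    thus ?thesis using char[of 1] by (simp add: F_def)
  qed
  ultimately have "integral {0..1} (char_fn n) = 0" by (simp add: integral_unique)
  moreover have "set_integrable lborel {0..1} (char_fn n)"
    by (intro borel_integrable_atLeastAtMost' continuous_intros)
  ultimately show ?thesis
    using False by (simp add: set_borel_integral_eq_integral flip: integral_unit_eq)
qed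

text \<open>
  Together with the Stone-Weierstrass theorem on the circle this gives uniqueness of Fourier coefficients
  without any convergence theory.
\<close>

lemma fourier_vanish_mult_polynomial:
  fixes D :: "real \<Rightarrow> complex" and P :: "complex \<Rightarrow> real"
  assumes P: "real_polynomial_function P"
    and D: "continuous_on {0..1} D" "\<And>n. (\<integral>t. D t * char_fn n t \<partial>unit_measure) = 0"
  shows "continuous_on {0..1} (\<lambda>t. D t * complex_of_real (P (char_fn 1 t)))"
    and "(\<integral>t. D t * complex_of_real (P (char_fn 1 t)) * char_fn n t \<partial>unit_measure) = 0"
proof -
  \<comment> \<open>Continuous functions without Fourier coefficients, a class closed under sums,
    scalars and characters. The induction on the polynomial ranges over all its members, because a
    product is multiplied in one factor at a time.\<close>
  define Z where "Z D \<longleftrightarrow> continuous_on {0..1} D \<and> (\<forall>n. (\<integral>t. D t * char_fn n t \<partial>unit_measure) = 0)"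
    for D :: "real \<Rightarrow> complex"
  have Z_add: "Z (\<lambda>t. A t + B t)" if "Z A" "Z B" for A B
  proof -
    have "integrable unit_measure (\<lambda>t. A t * char_fn n t)" "integrable unit_measure (\<lambda>t. B t * char_fn n t)" for n
      using that by (auto simp: Z_def intro!: integrable_unit_continuous continuous_intros)
    thus ?thesis using that by (auto simp: Z_def distrib_right intro!: continuous_intros)
  qed
  have Z_cmult: "Z (\<lambda>t. c * A t)" if "Z A" for A c
    using that by (auto simp: Z_def mult.assoc intro!: continuous_intros)
  have Z_char: "Z (\<lambda>t. A t * char_fn m t)" if "Z A" for A m
  proof -
    have "A t * char_fn m t * char_fn n t = A t * char_fn (m + n) t" for n t
      by (subst char_fn_add[symmetric]) (rule mult.assoc)
    thus ?thesis using that unfolding Z_def by (simp only:) (auto intro!: continuous_intros)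
  qed
  have "Z (\<lambda>t. A t * complex_of_real (P (char_fn 1 t)))" if "Z A" for A
    using P that
  proof (induction arbitrary: A)
    case (linear f)
    interpret bounded_linear f by fact
    \<comment> \<open>A real-linear map sends cis(\<theta>) to f(1) cos(\<theta>) + f(i)
      sin(\<theta>), a combination of the characters of frequency 1 and -1.\<close>
    have eq: "A t * complex_of_real (f (char_fn 1 t)) =
        (of_real (f 1) / 2 + of_real (f \<i>) / (2 * \<i>)) * (A t * char_fn 1 t) +
        (of_real (f 1) / 2 - of_real (f \<i>) / (2 * \<i>)) * (A t * char_fn (-1) t)" for t
    proof -
      have "f (cis (2 * pi * t)) = f (cos (2 * pi * t) *\<^sub>R 1 + sin (2 * pi * t) *\<^sub>R \<i>)"
        by (rule arg_cong[of _ _ f]) (simp add: complex_eq_iff)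
      also have "\<dots> = cos (2 * pi * t) * f 1 + sin (2 * pi * t) * f \<i>"
        by (simp add: add scaleR)
      finally show ?thesis
        by (simp add: complex_eq_iff Re_divide Im_divide field_simps)
    qed
    show ?case unfolding eq
      by (rule Z_add[OF Z_cmult[OF Z_char[OF \<open>Z A\<close>]] Z_cmult[OF Z_char[OF \<open>Z A\<close>]]])
  next
    case (const c)
    thus ?case using Z_cmult[of A "of_real c"] by (simp add: mult.commute)
  next
    case (add f g)
    show ?case
      using Z_add[OF add.IH(1)[OF add.prems] add.IH(2)[OF add.prems]] by (simp only: distrib_left of_real_add)
  next
    case (mult f g)
    have "Z (\<lambda>t. (A t * complex_of_real (f (char_fn 1 t))) * complex_of_real (g (char_fn 1 t)))"
      by (rule mult.IH(2)[OF mult.IH(1)[OF mult.prems]])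
    thus ?case by (simp only: mult.assoc of_real_mult)
  qed
  moreover have "Z D" using D by (simp add: Z_def)
  ultimately have "Z (\<lambda>t. D t * complex_of_real (P (char_fn 1 t)))" by blast
  thus "continuous_on {0..1} (\<lambda>t. D t * complex_of_real (P (char_fn 1 t)))"
    and "(\<integral>t. D t * complex_of_real (P (char_fn 1 t)) * char_fn n t \<partial>unit_measure) = 0"
    unfolding Z_def by auto
qed

text \<open>The graph of the transported function is the continuous image of [0,1], hence compact,
  and a function into a compact set with closed graph is continuous. No local inverse of the
  parametrisation has to be constructed.\<close>

lemma continuous_periodic_on_circle:
  fixes f :: "real \<Rightarrow> real"
  assumes f: "continuous_on {0..1} f" and per: "f 1 = f 0"
  obtains F where "continuous_on (sphere 0 1) F" "\<And>t. t \<in> {0..1} \<Longrightarrow> F (char_fn 1 t) = f t"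
proof -
  have ex: "\<exists>t\<in>{0..1}. char_fn 1 t = z" if "z \<in> sphere 0 1" for z
  proof -
    have "cmod z = 1" using that by simp
    hence "z = cis (Arg2pi z)" using complex_norm_eq_1_exp by (auto simp: cis_conv_exp)
    moreover have "Arg2pi z / (2 * pi) \<in> {0..1}"
      using Arg2pi_ge_0[of z] Arg2pi_lt_2pi[of z] by (simp add: divide_simps)
    ultimately show ?thesis by (intro bexI[of _ "Arg2pi z / (2 * pi)"]) auto
  qed
  have inj: "f s = f t" if "s \<in> {0..1}" "t \<in> {0..1}" "char_fn 1 s = char_fn 1 t" for s t
  proof -
    have "exp (\<i> * of_real (2 * pi * s)) = exp (\<i> * of_real (2 * pi * t))"
      using that(3) by (simp add: cis_conv_exp)
    then obtain n :: int where "\<i> * of_real (2 * pi * s) =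
        \<i> * of_real (2 * pi * t) + of_real (of_int (2 * n) * pi) * \<i>"
      unfolding exp_eq by blast
    from arg_cong[where f = Im, OF this] have "2 * pi * s = 2 * pi * t + 2 * pi * of_int n"
      by simp
    hence "2 * pi * s = 2 * pi * (t + of_int n)" by (simp add: algebra_simps)
    hence st: "s = t + of_int n" by simp
    \<comment> \<open>Only the two endpoints are identified on the circle, and there
      \<open>per\<close> applies.\<close>
    hence "n \<in> {-1, 0, 1}" using that(1,2) by auto
    thus ?thesis using st that(1,2) per by auto
  qed
  define F where "F z = f (SOME t. t \<in> {0..1} \<and> char_fn 1 t = z)" for z
  have F: "F (char_fn 1 t) = f t" if t: "t \<in> {0..1}" for t
  proof -
    have "\<exists>s. s \<in> {0..1} \<and> char_fn 1 s = char_fn 1 t" using t by auto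
    from someI_ex[OF this] show ?thesis unfolding F_def by (intro inj[OF _ t]) (rule conjunct1 conjunct2, assumption)+
  qed
  have "continuous_on (sphere 0 1) F"
  proof (rule continuous_from_closed_graph)
    show "compact (f ` {0..1})" by (intro compact_continuous_image f) auto
    show "F \<in> sphere 0 1 \<rightarrow> f ` {0..1}" using ex F by force
    have "(\<lambda>z. (z, F z)) ` sphere 0 1 = (\<lambda>t. (char_fn 1 t, f t)) ` {0..1}"
    proof (rule subset_antisym; rule subsetI)
      fix x assume "x \<in> (\<lambda>z. (z, F z)) ` sphere 0 1"
      then obtain z where z: "z \<in> sphere 0 1" "x = (z, F z)" by auto
      from ex[OF z(1)] obtain t where "t \<in> {0..1}" "char_fn 1 t = z" by auto
      thus "x \<in> (\<lambda>t. (char_fn 1 t, f t)) ` {0..1}" using z F by auto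
    next
      fix x assume "x \<in> (\<lambda>t. (char_fn 1 t, f t)) ` {0..1}"
      then obtain t where t: "t \<in> {0..1}" "x = (char_fn 1 t, f t)" by auto
      show "x \<in> (\<lambda>z. (z, F z)) ` sphere 0 1"
        by (rule image_eqI[of _ _ "char_fn 1 t"]) (use t F in auto)
    qed
    moreover have "compact ((\<lambda>t. (char_fn 1 t, f t)) ` {0..1})"
      by (intro compact_continuous_image continuous_intros f) auto
    ultimately show "closed ((\<lambda>z. (z, F z)) ` sphere 0 1)" by (simp add: compact_imp_closed)
  qed
  thus ?thesis using F that by blast
qed

lemma continuous_nonneg_integral_0:
  fixes f :: "real \<Rightarrow> real"
  assumes f: "continuous_on {0..1} f" "\<And>t. 0 \<le> f t" and int: "(\<integral>t. f t \<partial>unit_measure) = 0"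
    and t: "t \<in> {0..1}"
  shows "f t = 0"
proof -
  have "set_integrable lborel {0..1} f" using borel_integrable_atLeastAtMost'[OF f(1)] .
  hence "integral {0..1} f = 0"
    using int by (simp add: set_borel_integral_eq_integral flip: integral_unit_eq)
  moreover have "f integrable_on {0..1}" by (rule integrable_continuous_real[OF f(1)])
  ultimately have "(f has_integral 0) (cbox 0 1)" by (simp add: has_integral_iff)
  thus ?thesis using has_integral_0_cbox_imp_0[of 0 1 f t] f t by auto
qed

text \<open>\<open>D\<close> is orthogonal to every polynomial Q in the characters. So the integral
  of (Re D)^2 equals that of Re D (Re D - Q), which is at most e V if Q is within e of Re D.
  Continuity turns the vanishing integral into a pointwise statement.\<close>

lemma fourier_uniqueness:
  fixes D :: "real \<Rightarrow> complex"
  assumes D: "continuous_on {0..1} D" "D 1 = D 0"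
    and coeffs: "\<And>n. (\<integral>t. D t * char_fn n t \<partial>unit_measure) = 0"
    and t: "t \<in> {0..1}"
  shows "Re (D t) = 0"
proof -
  let ?I = "\<lambda>f::real \<Rightarrow> real. \<integral>t. f t \<partial>unit_measure"
  have cont: "continuous_on {0..1} (\<lambda>t. Re (D t))" using D(1) by (intro continuous_intros)
  obtain F where F: "continuous_on (sphere 0 1) F" "\<And>t. t \<in> {0..1} \<Longrightarrow> F (char_fn 1 t) = Re (D t)"
    using continuous_periodic_on_circle[OF cont] D(2) by auto
  define V where "V = ?I (\<lambda>t. \<bar>Re (D t)\<bar>)"
  have bound: "?I (\<lambda>t. (Re (D t))\<^sup>2) \<le> e * V" if "0 < e" for e
  proof -
    obtain P where P: "real_polynomial_function P" "\<And>z. z \<in> sphere 0 1 \<Longrightarrow> \<bar>F z - P z\<bar> < e"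
      using Stone_Weierstrass_real_polynomial_function[OF _ F(1) \<open>0 < e\<close>] by auto
    define Q where "Q t = P (char_fn 1 t)" for t
    have close: "\<bar>Re (D t) - Q t\<bar> < e" if "t \<in> {0..1}" for t
      using P(2)[of "char_fn 1 t"] F(2)[OF that] by (simp add: Q_def)
    have "polynomial_function P" using P(1) by (simp only: real_polynomial_function_eq)
    hence contP: "continuous_on UNIV P" by (rule continuous_on_polymonial_function)
    have contQ: "continuous_on {0..1} (\<lambda>t. Q t)"
      unfolding Q_def by (rule continuous_on_compose2[OF contP]) (intro continuous_intros, rule subset_UNIV)
    have "(\<integral>t. D t * complex_of_real (Q t) \<partial>unit_measure) = 0"
      using fourier_vanish_mult_polynomial(2)[OF P(1) D(1) coeffs, of 0] by (simp add: Q_def)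
    moreover have "integrable unit_measure (\<lambda>t. D t * complex_of_real (Q t))"
      by (intro integrable_unit_continuous continuous_intros D(1) contQ)
    ultimately have 0: "?I (\<lambda>t. Re (D t) * Q t) = 0"
      using integral_Re[of unit_measure "\<lambda>t. D t * complex_of_real (Q t)"] by simp
    have "?I (\<lambda>t. (Re (D t))\<^sup>2) = ?I (\<lambda>t. Re (D t) * Q t) + ?I (\<lambda>t. Re (D t) * (Re (D t) - Q t))"
      by (subst Bochner_Integration.integral_add[symmetric])
         (auto intro!: integrable_unit_continuous continuous_intros D(1) contQ Bochner_Integration.integral_cong
            simp: power2_eq_square algebra_simps)
    also have "\<dots> \<le> ?I (\<lambda>t. e * \<bar>Re (D t)\<bar>)"
      unfolding 0 add_0_left
    proof (rule integral_mono)
      fix t assume "t \<in> space unit_measure"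
      hence "t \<in> {0..1}" by (simp add: space_restrict_space)
      have "Re (D t) * (Re (D t) - Q t) \<le> \<bar>Re (D t)\<bar> * \<bar>Re (D t) - Q t\<bar>"
        by (metis abs_ge_self abs_mult)
      also have "\<dots> \<le> \<bar>Re (D t)\<bar> * e"
        using close[OF \<open>t \<in> {0..1}\<close>] by (intro mult_left_mono) auto
      finally show "Re (D t) * (Re (D t) - Q t) \<le> e * \<bar>Re (D t)\<bar>" by (simp add: mult.commute)
    qed (auto intro!: integrable_unit_continuous continuous_intros D(1) contQ)
    finally show ?thesis by (simp add: V_def)
  qed
  have "?I (\<lambda>t. (Re (D t))\<^sup>2) \<le> 0"
  proof (rule field_le_epsilon)
    fix e :: real assume e: "0 < e"
    have V: "V \<ge> 0" unfolding V_def by simp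
    have "?I (\<lambda>t. (Re (D t))\<^sup>2) \<le> e / (V + 1) * V" using e V by (intro bound) auto
    also have "\<dots> \<le> e" using e V by (simp add: divide_simps)
    finally show "?I (\<lambda>t. (Re (D t))\<^sup>2) \<le> 0 + e" by simp
  qed
  hence "?I (\<lambda>t. (Re (D t))\<^sup>2) = 0" by (intro antisym) auto
  hence "(Re (D t))\<^sup>2 = 0"
    using t by (intro continuous_nonneg_integral_0[where f = "\<lambda>t. (Re (D t))\<^sup>2"] continuous_intros cont) auto
  thus ?thesis by simp
qed

text \<open>\<open>f\<close> and its finite Fourier sum are continuous with the same coefficients,
  so they agree at every point. The real part appears because uniqueness is available for real
  parts.\<close>

lemma band_limited_eq_trig_polynomial:
  fixes f :: "real \<Rightarrow> real"
  assumes f: "continuous_on {0..1} f" "f 1 = f 0" and B: "finite B"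
    and band: "\<And>n. n \<notin> B \<Longrightarrow> (\<integral>t. complex_of_real (f t) * char_fn (- n) t \<partial>unit_measure) = 0"
    and t: "t \<in> {0..1}"
  shows "f t = Re (\<Sum>n\<in>B. (\<integral>s. complex_of_real (f s) * char_fn (- n) s \<partial>unit_measure) * char_fn n t)"
proof -
  define c where "c n = (\<integral>s. complex_of_real (f s) * char_fn (- n) s \<partial>unit_measure)" for n
  define D where "D t = complex_of_real (f t) - (\<Sum>n\<in>B. c n * char_fn n t)" for t
  have "Re (D t) = 0"
  proof (rule fourier_uniqueness[OF _ _ _ t])
    show "continuous_on {0..1} D" unfolding D_def by (intro continuous_intros f(1))
    have "cis (2 * pi * of_int n) = 1" for n by (rule cis_multiple_2pi) simp
    thus "D 1 = D 0" by (simp add: D_def f(2))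
    fix m
    have "(\<integral>t. D t * char_fn m t \<partial>unit_measure) =
        (\<integral>t. complex_of_real (f t) * char_fn m t - (\<Sum>n\<in>B. c n * char_fn (n + m) t) \<partial>unit_measure)"
      by (intro Bochner_Integration.integral_cong refl)
         (simp add: D_def algebra_simps sum_distrib_left sum_distrib_right cis_mult)
    also have "\<dots> = (\<integral>t. complex_of_real (f t) * char_fn m t \<partial>unit_measure) -
        (\<integral>t. (\<Sum>n\<in>B. c n * char_fn (n + m) t) \<partial>unit_measure)"
      by (intro Bochner_Integration.integral_diff integrable_unit_continuous continuous_intros f(1))
    also have "(\<integral>t. (\<Sum>n\<in>B. c n * char_fn (n + m) t) \<partial>unit_measure) =
        (\<Sum>n\<in>B. c n * (\<integral>t. char_fn (n + m) t \<partial>unit_measure))"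
      by (subst Bochner_Integration.integral_sum)
         (auto intro!: integrable_unit_continuous continuous_intros)
    also have "\<dots> = (\<Sum>n\<in>B. if n = - m then c (- m) else 0)"
      by (intro sum.cong refl) (simp add: integral_char_fn del: of_int_add)
    \<comment> \<open>If \<open>- m\<close> is outside \<open>B\<close>, the sum is empty of nonzero
      terms and the coefficient vanishes by \<open>band\<close>.\<close>
    also have "\<dots> = c (- m)" using B band[of "- m"] by (simp add: c_def)
    finally show "(\<integral>t. D t * char_fn m t \<partial>unit_measure) = 0" by (simp add: c_def)
  qed
  thus ?thesis by (simp add: D_def c_def)
qed

lemma parseval_trig_polynomial:
  assumes B: "finite B"
  shows "(\<integral>t. (cmod (\<Sum>n\<in>B. a n * char_fn (- n) t))\<^sup>2 \<partial>unit_measure) = (\<Sum>n\<in>B. (cmod (a n))\<^sup>2)"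
proof -
  have "complex_of_real (\<integral>t. (cmod (\<Sum>n\<in>B. a n * char_fn (- n) t))\<^sup>2 \<partial>unit_measure) =
      (\<integral>t. complex_of_real ((cmod (\<Sum>n\<in>B. a n * char_fn (- n) t))\<^sup>2) \<partial>unit_measure)"
    by (rule integral_complex_of_real[symmetric])
  also have "\<dots> = (\<integral>t. (\<Sum>n\<in>B. \<Sum>m\<in>B. a n * cnj (a m) * char_fn (m - n) t) \<partial>unit_measure)"
    by (intro Bochner_Integration.integral_cong refl)
       (simp add: complex_norm_square sum_product cis_cnj cis_mult algebra_simps del: of_real_power)
  also have "\<dots> = (\<Sum>n\<in>B. \<Sum>m\<in>B. a n * cnj (a m) * (\<integral>t. char_fn (m - n) t \<partial>unit_measure))"
    by (simp add: Bochner_Integration.integral_sum integrable_unit_continuous continuous_intros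
        del: of_int_diff)
  also have "\<dots> = (\<Sum>n\<in>B. \<Sum>m\<in>B. if m = n then a n * cnj (a n) else 0)"
    by (intro sum.cong refl) (simp add: integral_char_fn del: of_int_diff)
  also have "\<dots> = (\<Sum>n\<in>B. a n * cnj (a n))" using B by simp
  also have "\<dots> = complex_of_real (\<Sum>n\<in>B. (cmod (a n))\<^sup>2)"
    by (simp add: complex_norm_square del: of_real_power)
  finally show ?thesis by (simp only: of_real_eq_iff)
qed

section \<open>Periodized wavelets\<close>

text \<open>Common ground of the two wavelet types: Meyer wavelets decay by assumption, Daubechies
  wavelets by compact support. The exponent 2 gives absolute convergence of periodizations and
  integrability on the line.\<close>

definition quadratic_decay :: "(real \<Rightarrow> real) \<Rightarrow> bool" where
  "quadratic_decay h \<longleftrightarrow> continuous_on UNIV h \<and> (\<exists>C. \<forall>t. \<bar>h t\<bar> \<le> C / (1 + \<bar>t\<bar>)\<^sup>2)"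

lemma quadratic_decayE:
  assumes "quadratic_decay h"
  obtains C where "0 \<le> C" "continuous_on UNIV h" "\<And>t. \<bar>h t\<bar> \<le> C / (1 + \<bar>t\<bar>)\<^sup>2"
proof -
  obtain C where C: "continuous_on UNIV h" "\<And>t. \<bar>h t\<bar> \<le> C / (1 + \<bar>t\<bar>)\<^sup>2"
    using assms by (auto simp: quadratic_decay_def)
  have "0 \<le> C" using order_trans[OF abs_ge_zero C(2)[of 0]] by simp
  thus ?thesis using C that by blast
qed

lemma summable_int_inverse_square: "(\<lambda>n::int. 1 / (1 + \<bar>real_of_int n\<bar>)\<^sup>2) summable_on UNIV"
proof -
  have "summable (\<lambda>n::nat. 1 / (real (Suc n))\<^sup>2)"
    using inverse_power_summable[of 2, where ?'a = real]
    by (subst summable_Suc_iff) (simp add: inverse_eq_divide)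
  hence N: "(\<lambda>n::nat. 1 / (1 + real n)\<^sup>2) summable_on UNIV"
    by (intro norm_summable_imp_summable_on) (simp add: add.commute)
  have "(\<lambda>n::int. 1 / (1 + \<bar>real_of_int n\<bar>)\<^sup>2) summable_on range int"
    by (subst summable_on_reindex) (use N in \<open>auto simp: o_def\<close>)
  moreover have "(\<lambda>n::int. 1 / (1 + \<bar>real_of_int n\<bar>)\<^sup>2) summable_on range (\<lambda>n. - int n)"
    by (subst summable_on_reindex) (use N in \<open>auto simp: o_def inj_def\<close>)
  ultimately have "(\<lambda>n::int. 1 / (1 + \<bar>real_of_int n\<bar>)\<^sup>2) summable_on (range int \<union> range (\<lambda>n. - int n))"
    by (rule summable_on_union)
  also have "range int \<union> range (\<lambda>n. - int n) = UNIV"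
    by (auto simp: image_iff) (metis int_cases2)
  finally show ?thesis .
qed

text \<open>A bounded shift costs a constant factor, because 1 + |n| <= (1 + T)(1 + |t +
  n|).\<close>

lemma inverse_square_shift:
  fixes t n T C :: real
  assumes "\<bar>t\<bar> \<le> T" "0 \<le> C"
  shows "C / (1 + \<bar>t + n\<bar>)\<^sup>2 \<le> C * (1 + T)\<^sup>2 * (1 / (1 + \<bar>n\<bar>)\<^sup>2)"
proof -
  have T: "0 \<le> T" using assms by linarith
  have "1 + \<bar>n\<bar> \<le> 1 + \<bar>t + n\<bar> + T" using assms(1) by linarith
  also have "\<dots> \<le> (1 + T) * (1 + \<bar>t + n\<bar>)" using T by (simp add: algebra_simps)
  finally have "(1 + \<bar>n\<bar>)\<^sup>2 \<le> ((1 + T) * (1 + \<bar>t + n\<bar>))\<^sup>2" by (intro power_mono) auto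
  hence "C * (1 + \<bar>n\<bar>)\<^sup>2 \<le> C * (1 + T)\<^sup>2 * (1 + \<bar>t + n\<bar>)\<^sup>2"
    using assms(2) by (simp add: power_mult_distrib mult.assoc mult_left_mono)
  moreover have "0 < (1 + \<bar>n\<bar>)\<^sup>2" "0 < (1 + \<bar>t + n\<bar>)\<^sup>2" by (auto intro!: zero_less_power)
  ultimately show ?thesis by (simp add: field_simps)
qed

text \<open>The constant grows with \<open>j\<close> and \<open>k\<close>. This is enough for
  convergence and continuity of each periodization; the bound uniform over locations is
  \<open>sum_periodize_dyadic_squared_le\<close>.\<close>

lemma quadratic_decay_dyadic:
  assumes "quadratic_decay h" shows "quadratic_decay (dyadic h j k)"
proof -
  obtain C where C: "0 \<le> C" "continuous_on UNIV h" "\<And>t. \<bar>h t\<bar> \<le> C / (1 + \<bar>t\<bar>)\<^sup>2"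
    using quadratic_decayE[OF assms] by blast
  define a where "a = 2 powr (real j / 2)"
  have a: "0 \<le> a" by (simp add: a_def)
  have "\<bar>dyadic h j k t\<bar> \<le> a * C * (1 + \<bar>real_of_int k\<bar>)\<^sup>2 / (1 + \<bar>t\<bar>)\<^sup>2" for t
  proof -
    have "\<bar>dyadic h j k t\<bar> = a * \<bar>h (2 ^ j * t - of_int k)\<bar>"
      by (simp add: dyadic_def a_def abs_mult)
    also have "\<dots> \<le> a * (C / (1 + \<bar>- of_int k + 2 ^ j * t\<bar>)\<^sup>2)"
      using C(3)[of "2 ^ j * t - of_int k"] a by (intro mult_left_mono) auto
    also have "\<dots> \<le> a * (C * (1 + \<bar>real_of_int k\<bar>)\<^sup>2 * (1 / (1 + \<bar>2 ^ j * t\<bar>)\<^sup>2))"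
      using C(1) a by (intro mult_left_mono inverse_square_shift) auto
    also have "\<dots> \<le> a * (C * (1 + \<bar>real_of_int k\<bar>)\<^sup>2 * (1 / (1 + \<bar>t\<bar>)\<^sup>2))"
    proof -
      have "1 * \<bar>t\<bar> \<le> 2 ^ j * \<bar>t\<bar>" by (intro mult_right_mono) auto
      hence "(1 + \<bar>t\<bar>)\<^sup>2 \<le> (1 + \<bar>2 ^ j * t\<bar>)\<^sup>2" by (intro power_mono) (auto simp: abs_mult)
      thus ?thesis using C(1) a by (intro mult_left_mono divide_left_mono mult_pos_pos) auto
    qed
    finally show ?thesis by simp
  qed
  moreover have "continuous_on UNIV (dyadic h j k)"
    unfolding dyadic_def[abs_def]
    by (intro continuous_intros continuous_on_compose2[OF C(2)]) auto
  ultimately show ?thesis unfolding quadratic_decay_def by blast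
qed

lemma periodize_term_bound:
  assumes "0 \<le> C" "\<And>t. \<bar>h t\<bar> \<le> C / (1 + \<bar>t\<bar>)\<^sup>2" "\<bar>t\<bar> \<le> T"
  shows "\<bar>h (t + of_int n)\<bar> \<le> C * (1 + T)\<^sup>2 * (1 / (1 + \<bar>real_of_int n\<bar>)\<^sup>2)"
  using order_trans[OF assms(2) inverse_square_shift[OF assms(3,1)]] .

lemma periodize_abs_summable:
  assumes "quadratic_decay h"
  shows "(\<lambda>n::int. \<bar>h (t + of_int n)\<bar>) summable_on UNIV"
proof -
  obtain C where C: "0 \<le> C" "continuous_on UNIV h" "\<And>t. \<bar>h t\<bar> \<le> C / (1 + \<bar>t\<bar>)\<^sup>2"
    using quadratic_decayE[OF assms] by blast
  have "(\<lambda>n::int. C * (1 + \<bar>t\<bar>)\<^sup>2 * (1 / (1 + \<bar>real_of_int n\<bar>)\<^sup>2)) summable_on UNIV"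
    by (intro summable_on_cmult_right summable_int_inverse_square)
  thus ?thesis
    by (rule summable_on_comparison_test) (use periodize_term_bound[OF C(1,3)] in auto)
qed

lemma continuous_periodize:
  assumes "quadratic_decay h"
  shows "continuous_on UNIV (periodize h)"
proof -
  obtain C where C: "0 \<le> C" "continuous_on UNIV h" "\<And>t. \<bar>h t\<bar> \<le> C / (1 + \<bar>t\<bar>)\<^sup>2"
    using quadratic_decayE[OF assms] by blast
  have on: "continuous_on {-T<..<T} (periodize h)" for T
  proof -
    have "uniform_limit {-T<..<T} (\<lambda>X t. \<Sum>n\<in>X. h (t + of_int n)) (\<lambda>t. \<Sum>\<^sub>\<infinity>n::int. h (t + of_int n)) (finite_subsets_at_top UNIV)"
    proof (rule Weierstrass_m_test_general)
      show "(\<lambda>n::int. C * (1 + T)\<^sup>2 * (1 / (1 + \<bar>real_of_int n\<bar>)\<^sup>2)) summable_on UNIV"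
        by (intro summable_on_cmult_right summable_int_inverse_square)
      show "norm (h (t + of_int n)) \<le> C * (1 + T)\<^sup>2 * (1 / (1 + \<bar>real_of_int n\<bar>)\<^sup>2)"
        if "t \<in> {-T<..<T}" for n t
        using periodize_term_bound[OF C(1,3), of t T n] that by auto
    qed
    hence "continuous_on {-T<..<T} (\<lambda>t. \<Sum>\<^sub>\<infinity>n::int. h (t + of_int n))"
      by (rule uniform_limit_theorem[rotated])
         (auto intro!: always_eventually continuous_intros continuous_on_compose2[OF C(2)])
    thus ?thesis by (simp add: periodize_def[abs_def])
  qed
  have "isCont (periodize h) t" for t
    using on[of "\<bar>t\<bar> + 1"] by (rule continuous_on_interior) (auto simp: abs_if)
  thus ?thesis by (simp add: continuous_at_imp_continuous_on)
qed

lemma periodize_periodic: "periodize h (t + 1) = periodize h t"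
  unfolding periodize_def
  by (rule infsum_reindex_bij_witness[of _ "\<lambda>n. n - 1" "\<lambda>n. n + 1"]) (auto simp: algebra_simps)

text \<open>At a fixed \<open>x\<close> the k-th function samples \<open>h\<close> at y + 2^j n - k
  with y = 2^j x. For k < 2^j these indices form disjoint residue classes modulo 2^j, so all samples
  together come from one translate of the integers, and the absolute values sum to at most 2^(j/2)
  S.\<close>

lemma sum_periodize_dyadic_squared_le:
  assumes "quadratic_decay h"
  obtains B where "0 \<le> B" "\<And>j x. (\<Sum>k<2^j. (periodize (dyadic h j (int k)) x)\<^sup>2) \<le> B * 2 ^ j"
proof -
  obtain C where C: "0 \<le> C" "continuous_on UNIV h" "\<And>t. \<bar>h t\<bar> \<le> C / (1 + \<bar>t\<bar>)\<^sup>2"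
    using quadratic_decayE[OF assms] by blast
  \<comment> \<open>A majorant for shifts in [0,1]; a sum over any translate of the integers reduces
    to such a shift by taking the fractional part.\<close>
  define S where "S = (\<Sum>\<^sub>\<infinity>n::int. C * (1 + 1)\<^sup>2 * (1 / (1 + \<bar>real_of_int n\<bar>)\<^sup>2))"
  have Ssum: "(\<lambda>n::int. C * (1 + 1)\<^sup>2 * (1 / (1 + \<bar>real_of_int n\<bar>)\<^sup>2)) summable_on UNIV"
    by (intro summable_on_cmult_right summable_int_inverse_square)
  have S: "0 \<le> S" unfolding S_def using C(1) by (intro infsum_nonneg) auto
  have full: "(\<Sum>\<^sub>\<infinity>m::int. \<bar>h (y + of_int m)\<bar>) \<le> S" for y
  proof -
    have "(\<Sum>\<^sub>\<infinity>m::int. \<bar>h (y + of_int m)\<bar>) = (\<Sum>\<^sub>\<infinity>m::int. \<bar>h (frac y + of_int m)\<bar>)"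
      by (rule infsum_reindex_bij_witness[of _ "\<lambda>m. m - \<lfloor>y\<rfloor>" "\<lambda>m. m + \<lfloor>y\<rfloor>"]) (auto simp: frac_def)
    also have "\<dots> \<le> S"
      unfolding S_def
      using frac_ge_0[of y] frac_lt_1[of y]
      by (intro infsum_mono periodize_abs_summable assms Ssum periodize_term_bound C) auto
    finally show ?thesis .
  qed
  have "(\<Sum>k<2^j. (periodize (dyadic h j (int k)) x)\<^sup>2) \<le> S\<^sup>2 * 2 ^ j" for j x
  proof -
    define a where "a = 2 powr (real j / 2)"
    have a: "0 \<le> a" "a\<^sup>2 = 2 ^ j"
      by (simp_all add: a_def powr_realpow flip: powr_numeral powr_powr) (simp add: powr_powr powr_realpow)
    define y where "y = 2 ^ j * x"
    define A where "A k = range (\<lambda>n::int. 2 ^ j * n - int k)" for k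
    define F where "F m = \<bar>h (y + of_int m)\<bar>" for m :: int
    have Fsum: "F summable_on UNIV" unfolding F_def by (intro periodize_abs_summable assms)
    have inj: "inj (\<lambda>n::int. 2 ^ j * n - int k)" for k by (auto simp: inj_def)
    have le: "\<bar>periodize (dyadic h j (int k)) x\<bar> \<le> a * (\<Sum>\<^sub>\<infinity>m\<in>A k. F m)" for k
    proof -
      have "\<bar>periodize (dyadic h j (int k)) x\<bar> \<le> (\<Sum>\<^sub>\<infinity>n::int. \<bar>dyadic h j (int k) (x + of_int n)\<bar>)"
        unfolding periodize_def
        using norm_infsum_bound[of "\<lambda>n::int. dyadic h j (int k) (x + of_int n)" UNIV]
          periodize_abs_summable[OF quadratic_decay_dyadic[OF assms]] by simp
      also have "\<dots> = (\<Sum>\<^sub>\<infinity>n::int. a * (F \<circ> (\<lambda>n::int. 2 ^ j * n - int k)) n)"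
        by (intro infsum_cong) (simp add: dyadic_def a_def F_def y_def abs_mult algebra_simps)
      also have "\<dots> = a * (\<Sum>\<^sub>\<infinity>m\<in>A k. F m)"
        unfolding A_def by (subst infsum_cmult_right') (simp add: infsum_reindex[OF inj])
      finally show ?thesis .
    qed
    have sub: "F summable_on A k" for k by (rule summable_on_subset_banach[OF Fsum]) auto
    have disj: "A k \<inter> A k' = {}" if "k < 2 ^ j" "k' < 2 ^ j" "k \<noteq> k'" for k k' :: nat
    proof (rule ccontr)
      assume "A k \<inter> A k' \<noteq> {}"
      then obtain n n' :: int where "2 ^ j * n - int k = 2 ^ j * n' - int k'" by (auto simp: A_def)
      hence eq: "int k - int k' = 2 ^ j * (n - n')" by (simp add: algebra_simps)
      moreover have "\<bar>int k - int k'\<bar> < 2 ^ j"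
      proof -
        have "int k < int (2 ^ j)" "int k' < int (2 ^ j)" using that by (simp_all only: of_nat_less_iff)
        thus ?thesis unfolding of_nat_power of_nat_numeral by linarith
      qed
      ultimately have "int k - int k' = 0"
        using dvd_imp_le_int[of "int k - int k'" "2 ^ j"] by fastforce
      thus False using that by simp
    qed
    have "((\<lambda>m. F m) has_sum (\<Sum>k\<in>{..<2^j}. \<Sum>\<^sub>\<infinity>m\<in>A k. F m)) (\<Union>k\<in>{..<2^j}. A k)"
      by (intro sum_has_sum has_sum_infsum sub disj) auto
    hence "(\<Sum>k<2^j. \<Sum>\<^sub>\<infinity>m\<in>A k. F m) = infsum F (\<Union>k\<in>{..<2^j}. A k)"
      by (simp add: infsumI)
    also have "\<dots> \<le> infsum F UNIV"
      by (intro infsum_mono2 Fsum summable_on_subset_banach[OF Fsum]) (auto simp: F_def)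
    also have "\<dots> \<le> S" using full[of y] by (simp add: F_def[abs_def])
    finally have tot: "(\<Sum>k<2^j. \<Sum>\<^sub>\<infinity>m\<in>A k. F m) \<le> S" .
    have nn: "0 \<le> (\<Sum>\<^sub>\<infinity>m\<in>A k. F m)" for k by (intro infsum_nonneg) (auto simp: F_def)
    have "(\<Sum>k<2^j. (periodize (dyadic h j (int k)) x)\<^sup>2) \<le> (\<Sum>k<2^j. a * (\<Sum>\<^sub>\<infinity>m\<in>A k. F m))\<^sup>2"
    proof -
      have "(\<Sum>k<2^j. (periodize (dyadic h j (int k)) x)\<^sup>2) \<le> (\<Sum>k<2^j. (a * (\<Sum>\<^sub>\<infinity>m\<in>A k. F m))\<^sup>2)"
        using le by (intro sum_mono) (metis abs_ge_zero power2_abs power_mono)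
      also have "\<dots> \<le> (\<Sum>k<2^j. a * (\<Sum>\<^sub>\<infinity>m\<in>A k. F m))\<^sup>2"
      proof -
        \<comment> \<open>The l2 norm is at most the l1 norm, so the bound on the absolute values
          suffices.\<close>
        have "(\<Sum>k\<in>I. (z k)\<^sup>2) \<le> (\<Sum>k\<in>I. z k)\<^sup>2" if "finite I" "\<And>k. 0 \<le> z k" for I :: "nat set" and z :: "nat \<Rightarrow> real"
          using that(1)
        proof induction
          case (insert i I)
          have "0 \<le> 2 * z i * (\<Sum>k\<in>I. z k)" using that(2) by (simp add: sum_nonneg)
          thus ?case using insert by (simp add: power2_sum)
        qed simp
        thus ?thesis using nn a by simp
      qed
      finally show ?thesis .
    qed
    also have "\<dots> = 2 ^ j * (\<Sum>k<2^j. \<Sum>\<^sub>\<infinity>m\<in>A k. F m)\<^sup>2"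
      using a(2) by (simp add: power_mult_distrib flip: sum_distrib_left)
    also have "\<dots> \<le> 2 ^ j * S\<^sup>2"
      using tot nn by (intro mult_left_mono power_mono sum_nonneg) auto
    finally show ?thesis by (simp add: mult.commute)
  qed
  thus ?thesis using that[of "S\<^sup>2"] by simp
qed

lemma meyer_type_quadratic_decay:
  assumes "meyer_type \<phi> \<psi>" shows "quadratic_decay \<phi>" "quadratic_decay \<psi>"
  using assms by (auto simp: meyer_type_def quadratic_decay_def)

text \<open>Either a derivative exists, or \<open>h\<close> itself is Hoelder with a positive
  exponent.\<close>

lemma regular_function_continuous:
  assumes "regular_function r h" shows "continuous_on UNIV h"
proof -
  define n where "n = nat (\<lceil>r\<rceil> - 1)"
  obtain D L where r: "0 < r" and D: "D 0 = h"
    "\<And>i x. i < n \<Longrightarrow> (D i has_real_derivative D (Suc i) x) (at x)"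
    "\<And>x y. \<bar>D n x - D n y\<bar> \<le> L * \<bar>x - y\<bar> powr (r - real n)"
    using assms unfolding regular_function_def Let_def n_def[symmetric] by blast
  show ?thesis
  proof (cases "n = 0")
    case False
    hence "(h has_real_derivative D (Suc 0) x) (at x)" for x using D(1) D(2)[of 0 x] by simp
    thus ?thesis by (meson DERIV_isCont continuous_at_imp_continuous_on)
  next
    case True
    have "isCont h x" for x
    proof -
      have "((\<lambda>y. L * \<bar>y - x\<bar> powr r) \<longlongrightarrow> 0) (at x)"
      proof -
        have "((\<lambda>y. L * \<bar>y - x\<bar> powr r) \<longlongrightarrow> L * 0 powr r) (at x)"
          using r by (intro tendsto_intros tendsto_powr') (auto intro!: tendsto_eq_intros)
        thus ?thesis by simp
      qed
      moreover have "norm (h y - h x) \<le> L * \<bar>y - x\<bar> powr r" for y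
        using D(1) D(3)[of y x] True by simp
      ultimately have "((\<lambda>y. h y - h x) \<longlongrightarrow> 0) (at x)"
        by (intro Lim_null_comparison[of "\<lambda>y. h y - h x"]) auto
      thus ?thesis by (simp add: isCont_def LIM_zero_iff)
    qed
    thus ?thesis by (simp add: continuous_at_imp_continuous_on)
  qed
qed

text \<open>On an interval containing the support, h (1 + |t|)^2 is continuous, hence
  bounded.\<close>

lemma daubechies_type_quadratic_decay:
  assumes "daubechies_type r \<phi> \<eta>" shows "quadratic_decay \<phi>" "quadratic_decay \<eta>"
proof -
  have "quadratic_decay h" if h: "h \<in> {\<phi>, \<eta>}" for h
  proof -
    have cont: "continuous_on UNIV h"
      using assms h regular_function_continuous by (auto simp: daubechies_type_def)
    obtain R where R: "\<And>x. R < \<bar>x\<bar> \<Longrightarrow> h x = 0"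
      using assms h by (auto simp: daubechies_type_def)
    define f where "f t = h t * (1 + \<bar>t\<bar>)\<^sup>2" for t
    have "continuous_on {-\<bar>R\<bar>..\<bar>R\<bar>} f"
      unfolding f_def by (intro continuous_intros continuous_on_subset[OF cont]) auto
    hence "bounded (f ` {-\<bar>R\<bar>..\<bar>R\<bar>})"
      by (intro compact_imp_bounded compact_continuous_image) auto
    then obtain C where "\<forall>y\<in>f ` {-\<bar>R\<bar>..\<bar>R\<bar>}. \<bar>y\<bar> \<le> C"
      unfolding bounded_iff real_norm_def by blast
    hence C: "\<bar>f t\<bar> \<le> C" if "t \<in> {-\<bar>R\<bar>..\<bar>R\<bar>}" for t using that by blast
    have C0: "0 \<le> C" using order_trans[OF abs_ge_zero C[of 0]] by simp
    have "\<bar>h t\<bar> \<le> C / (1 + \<bar>t\<bar>)\<^sup>2" for t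
    proof (cases "t \<in> {-\<bar>R\<bar>..\<bar>R\<bar>}")
      case True
      have "\<bar>h t\<bar> * (1 + \<bar>t\<bar>)\<^sup>2 \<le> C" using C[OF True] by (simp add: f_def abs_mult)
      thus ?thesis by (simp add: pos_le_divide_eq)
    next
      case False
      hence "h t = 0" using R[of t] by auto
      thus ?thesis using C0 by simp
    qed
    thus ?thesis using cont unfolding quadratic_decay_def by blast
  qed
  thus "quadratic_decay \<phi>" "quadratic_decay \<eta>" by auto
qed

section \<open>Fourier coefficients of periodizations, and reflection of periodic integrals\<close>

lemma quadratic_decay_integrable:
  assumes "quadratic_decay h" shows "integrable lborel h"
proof -
  obtain C where C: "0 \<le> C" "continuous_on UNIV h" "\<And>t. \<bar>h t\<bar> \<le> C / (1 + \<bar>t\<bar>)\<^sup>2"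
    using quadratic_decayE[OF assms] by blast
  have "integrable lborel (\<lambda>x::real. inverse (1 + x\<^sup>2))"
    using integrable_inverse_1_plus_square by (simp add: set_integrable_def einterval_def)
  hence "integrable lborel (\<lambda>x::real. C * inverse (1 + x\<^sup>2))" by simp
  thus ?thesis
  proof (rule Bochner_Integration.integrable_bound)
    show "h \<in> borel_measurable lborel" using borel_measurable_continuous_onI[OF C(2)] by simp
    have "\<bar>h t\<bar> \<le> C * inverse (1 + t\<^sup>2)" for t
    proof -
      have "1 + t\<^sup>2 \<le> (1 + \<bar>t\<bar>)\<^sup>2" by (simp add: power2_sum)
      hence "C / (1 + \<bar>t\<bar>)\<^sup>2 \<le> C / (1 + t\<^sup>2)"
        using C(1) by (intro divide_left_mono mult_pos_pos zero_less_power) (auto simp: add_pos_nonneg)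
      thus ?thesis using C(3)[of t] by (simp add: divide_inverse)
    qed
    thus "AE t in lborel. norm (h t) \<le> norm (C * inverse (1 + t\<^sup>2))"
      using C(1) by (simp add: abs_mult)
  qed
qed

text \<open>Symmetric windows are cofinal among the finite sets of integers. They turn an
  unconditional sum into the limit of a sequence, as dominated convergence requires.\<close>

lemma filterlim_symmetric_int_interval:
  "filterlim (\<lambda>k::nat. {- int k..int k}) (finite_subsets_at_top UNIV) sequentially"
  unfolding filterlim_finite_subsets_at_top
proof (intro allI impI)
  fix X :: "int set" assume "finite X \<and> X \<subseteq> UNIV"
  then obtain b where b: "abs ` X \<subseteq> {..b}" using finite_int_iff_bounded_le by auto
  have "X \<subseteq> {- int k..int k}" if "nat b \<le> k" for k
  proof
    fix x assume "x \<in> X"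
    hence "\<bar>x\<bar> \<le> b" using b by auto
    thus "x \<in> {- int k..int k}" using that by auto
  qed
  thus "\<forall>\<^sub>F k in sequentially. finite {- int k..int k} \<and> X \<subseteq> {- int k..int k} \<and> {- int k..int k} \<subseteq> UNIV"
    by (auto simp: eventually_sequentially)
qed

lemma char_fn_add_int: "char_fn n (t + of_int m) = char_fn n t"
proof -
  have "char_fn n (t + of_int m) = char_fn n t * cis (2 * pi * of_int (n * m))"
    by (simp add: cis_mult algebra_simps)
  moreover have "cis (2 * pi * of_int (n * m)) = 1" by (rule cis_multiple_2pi) simp
  ultimately show ?thesis by simp
qed

text \<open>The unfolding step of Poisson summation: the line is cut into intervals [m, m+1), each
  is moved to [0,1), and the 1-periodic character stays the same. For the windows \<open>W k\<close>
  both sides are limits of the same sequence, by dominated convergence.\<close>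

lemma fourier_periodize:
  assumes h: "quadratic_decay h"
  shows "(\<integral>t. complex_of_real (periodize h t) * char_fn (- n) t \<partial>unit_measure) = line_fourier h (2 * pi * of_int n)"
proof -
  obtain C where C: "0 \<le> C" "continuous_on UNIV h" "\<And>t. \<bar>h t\<bar> \<le> C / (1 + \<bar>t\<bar>)\<^sup>2"
    using quadratic_decayE[OF h] by blast
  have hm[measurable]: "h \<in> borel_measurable borel" by (rule borel_measurable_continuous_onI[OF C(2)])
  have pm[measurable]: "periodize h \<in> borel_measurable borel"
    by (rule borel_measurable_continuous_onI[OF continuous_periodize[OF h]])
  have cm[measurable]: "char_fn (- n) \<in> borel_measurable borel"
    by (intro borel_measurable_continuous_onI continuous_intros)
  define g where "g t = complex_of_real (h t) * char_fn (- n) t" for t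
  have gm[measurable]: "g \<in> borel_measurable borel" unfolding g_def by measurable
  have hi: "integrable lborel h" by (rule quadratic_decay_integrable[OF h])
  have gi: "integrable lborel g"
    by (rule Bochner_Integration.integrable_bound[OF hi]) (auto simp: g_def norm_mult)
  let ?G = "\<lambda>m t. indicator {0..<1} t *\<^sub>R (complex_of_real (h (t + of_int m)) * char_fn (- n) t)"
  define W where "W k = {- int k..int k}" for k :: nat
  define A where "A m = {real_of_int m..<real_of_int m + 1}" for m :: int
  have indA: "indicator (A m) u = (if m = \<lfloor>u\<rfloor> then 1 else 0 :: real)" for m u
    by (auto simp: A_def indicator_def floor_eq_iff) linarith+
  have lim1: "(\<lambda>k. \<integral>u. (\<Sum>m\<in>W k. indicator (A m) u *\<^sub>R g u) \<partial>lborel) \<longlonglongrightarrow> (\<integral>u. g u \<partial>lborel)"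
  proof (rule integral_dominated_convergence[where w = "\<lambda>u. norm (g u)"])
    show "(\<lambda>u. \<Sum>m\<in>W k. indicator (A m) u *\<^sub>R g u) \<in> borel_measurable lborel" for k
      by (auto simp: A_def)
    have eq: "(\<Sum>m\<in>W k. indicator (A m) u *\<^sub>R g u) = (if \<lfloor>u\<rfloor> \<in> W k then g u else 0)" for k u
      by (simp add: indA W_def if_distrib[of "\<lambda>c. c *\<^sub>R g u"] cong: if_cong)
    show "AE u in lborel. norm (\<Sum>m\<in>W k. indicator (A m) u *\<^sub>R g u) \<le> norm (g u)" for k
      by (simp add: eq)
    have "(\<lambda>k. if \<lfloor>u\<rfloor> \<in> W k then g u else 0) \<longlonglongrightarrow> g u" for u
    proof (rule tendsto_eventually, rule eventually_sequentiallyI[of "nat \<bar>\<lfloor>u\<rfloor>\<bar>"])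
      fix k assume "nat \<bar>\<lfloor>u\<rfloor>\<bar> \<le> k"
      hence "\<bar>\<lfloor>u\<rfloor>\<bar> \<le> int k" by (simp only: nat_le_iff)
      hence "\<lfloor>u\<rfloor> \<in> W k" unfolding W_def atLeastAtMost_iff by linarith
      thus "(if \<lfloor>u\<rfloor> \<in> W k then g u else 0) = g u" by simp
    qed
    thus "AE u in lborel. (\<lambda>k. \<Sum>m\<in>W k. indicator (A m) u *\<^sub>R g u) \<longlonglongrightarrow> g u"
      by (simp add: eq)
  qed (use gi in auto)
  have shift: "(\<integral>u. indicator (A m) u *\<^sub>R g u \<partial>lborel) = (\<integral>t. ?G m t \<partial>lborel)" for m
  proof -
    have "(\<integral>u. indicator (A m) u *\<^sub>R g u \<partial>lborel) = (\<integral>t. indicator (A m) (of_int m + 1 * t) *\<^sub>R g (of_int m + 1 * t) \<partial>lborel)"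
      by (subst lborel_integral_real_affine[of 1 _ "of_int m"]) auto
    also have "\<dots> = (\<integral>t. ?G m t \<partial>lborel)"
    proof (intro Bochner_Integration.integral_cong refl)
      fix t
      have "indicator (A m) (of_int m + 1 * t) = (indicator {0..<1} t :: real)"
        by (auto simp: A_def indicator_def)
      moreover have "g (of_int m + 1 * t) = complex_of_real (h (t + of_int m)) * char_fn (- n) t"
        using char_fn_add_int[of "- n" t m] by (simp only: g_def mult_1 add.commute)
      ultimately show "indicator (A m) (of_int m + 1 * t) *\<^sub>R g (of_int m + 1 * t) =
          ?G m t" by simp
    qed
    finally show ?thesis .
  qed
  have Ai: "integrable lborel (\<lambda>u. indicator (A m) u *\<^sub>R g u)" for m
    by (rule integrable_mult_indicator[OF _ gi]) (simp add: A_def)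
  \<comment> \<open>Dominates every partial sum of the periodization on [0,1).\<close>
  define D where "D = C * (1 + 1)\<^sup>2 * (\<Sum>\<^sub>\<infinity>m::int. 1 / (1 + \<bar>real_of_int m\<bar>)\<^sup>2)"
  define w where "w t = D * indicator {0..<1::real} t" for t :: real
  have wi: "integrable lborel w" unfolding w_def by (intro integrable_mult_right integrable_real_indicator) auto
  have lim2: "(\<lambda>k. \<integral>t. (\<Sum>m\<in>W k. ?G m t) \<partial>lborel)
      \<longlonglongrightarrow> (\<integral>t. indicator {0..<1} t *\<^sub>R (complex_of_real (periodize h t) * char_fn (- n) t) \<partial>lborel)"
  proof (rule integral_dominated_convergence[where w = w])
    have eq: "(\<Sum>m\<in>X. ?G m t) =
        indicator {0..<1} t *\<^sub>R (complex_of_real (\<Sum>m\<in>X. h (t + of_int m)) * char_fn (- n) t)" for X :: "int set" and t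
      by (simp add: sum_distrib_right scaleR_sum_right)
    show "AE t in lborel. norm (\<Sum>m\<in>W k. ?G m t) \<le> w t" for k
    proof (rule AE_I2)
      fix t :: real
      show "norm (\<Sum>m\<in>W k. ?G m t) \<le> w t"
      proof (cases "t \<in> {0..<1}")
        case True
        have "\<bar>\<Sum>m\<in>W k. h (t + of_int m)\<bar> \<le> (\<Sum>m\<in>W k. \<bar>h (t + of_int m)\<bar>)" by (rule sum_abs)
        also have "\<dots> \<le> (\<Sum>m\<in>W k. C * (1 + 1)\<^sup>2 * (1 / (1 + \<bar>real_of_int m\<bar>)\<^sup>2))"
          using True by (intro sum_mono periodize_term_bound C) auto
        also have "\<dots> = C * (1 + 1)\<^sup>2 * (\<Sum>m\<in>W k. 1 / (1 + \<bar>real_of_int m\<bar>)\<^sup>2)" by (simp add: sum_distrib_left)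
        also have "\<dots> \<le> D"
          unfolding D_def using C(1)
          by (intro mult_left_mono finite_sum_le_infsum summable_int_inverse_square) (auto simp: W_def)
        finally show ?thesis using True unfolding eq by (simp add: norm_mult w_def del: of_real_sum)
      qed (simp add: w_def)
    qed
    show "AE t in lborel. (\<lambda>k. \<Sum>m\<in>W k. ?G m t)
        \<longlonglongrightarrow> indicator {0..<1} t *\<^sub>R (complex_of_real (periodize h t) * char_fn (- n) t)"
    proof (rule AE_I2)
      fix t :: real
      have "(\<lambda>m::int. h (t + of_int m)) summable_on UNIV"
        by (rule abs_summable_summable) (simp only: real_norm_def periodize_abs_summable[OF h])
      hence "((\<lambda>m::int. h (t + of_int m)) has_sum periodize h t) UNIV"
        unfolding periodize_def by (rule has_sum_infsum)
      hence "(\<lambda>k. \<Sum>m\<in>W k. h (t + of_int m)) \<longlonglongrightarrow> periodize h t"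
        unfolding has_sum_def W_def by (rule filterlim_compose[OF _ filterlim_symmetric_int_interval])
      thus "(\<lambda>k. \<Sum>m\<in>W k. ?G m t)
        \<longlonglongrightarrow> indicator {0..<1} t *\<^sub>R (complex_of_real (periodize h t) * char_fn (- n) t)"
        unfolding eq by (intro tendsto_intros)
    qed
  qed (use wi in measurable)
  have "(\<integral>u. (\<Sum>m\<in>W k. indicator (A m) u *\<^sub>R g u) \<partial>lborel) =
      (\<integral>t. (\<Sum>m\<in>W k. ?G m t) \<partial>lborel)" for k
  proof -
    have "integrable lborel (\<lambda>t. ?G m t)" for m
    proof (rule integrable_mult_indicator)
      have "integrable lborel (\<lambda>t. h (t + of_int m))"
        using lborel_integrable_real_affine[OF hi, of 1 "of_int m"] by (simp add: add.commute)
      thus "integrable lborel (\<lambda>t. complex_of_real (h (t + of_int m)) * char_fn (- n) t)"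
      proof (rule Bochner_Integration.integrable_bound)
        show "(\<lambda>t. complex_of_real (h (t + of_int m)) * char_fn (- n) t) \<in> borel_measurable lborel"
          by measurable
      qed (simp add: norm_mult)
    qed simp
    thus ?thesis using Ai by (simp only: Bochner_Integration.integral_sum shift)
  qed
  with lim1 lim2 have "(\<integral>u. g u \<partial>lborel) = (\<integral>t. indicator {0..<1} t *\<^sub>R (complex_of_real (periodize h t) * char_fn (- n) t) \<partial>lborel)"
    by (simp only:) (rule LIMSEQ_unique)
  \<comment> \<open>The half-open intervals tile the line without overlap; closing [0,1) adds only
    the null set {1}.\<close>
  also have "\<dots> = (\<integral>t. indicator {0..1} t *\<^sub>R (complex_of_real (periodize h t) * char_fn (- n) t) \<partial>lborel)"
  proof (rule integral_cong_AE)
    have "AE t in lborel. t \<noteq> (1::real)" by (rule AE_lborel_singleton)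
    thus "AE t in lborel. indicator {0..<1} t *\<^sub>R (complex_of_real (periodize h t) * char_fn (- n) t) =
        indicator {0..1} t *\<^sub>R (complex_of_real (periodize h t) * char_fn (- n) t)"
      by eventually_elim (auto simp: indicator_def)
  qed measurable
  also have "\<dots> = (\<integral>t. complex_of_real (periodize h t) * char_fn (- n) t \<partial>unit_measure)"
    by (simp only: integral_unit_eq[symmetric] set_lebesgue_integral_def)
  finally show ?thesis by (simp add: g_def line_fourier_def)
qed

text \<open>Substituting s = 2^j t - k rescales the frequency to w/2^j and otherwise contributes
  constant factors. Thus the frequency band is dilated by 2^j, whatever the location.\<close>

lemma line_fourier_dyadic_eq_0:
  assumes "line_fourier h (w / 2 ^ j) = 0" shows "line_fourier (dyadic h j k) w = 0"
proof -
  define f where "f s = complex_of_real (h s) * cis (- (w / 2 ^ j * s))" for s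
  have "(\<integral>t. f (- of_int k + 2 ^ j * t) \<partial>lborel) = 0"
    using assms lborel_integral_real_affine[of "2 ^ j" f "- of_int k"]
    by (simp add: line_fourier_def f_def)
  moreover have "complex_of_real (dyadic h j k t) * cis (- (w * t)) =
      of_real (2 powr (real j / 2)) * cis (- (w / 2 ^ j * of_int k)) * f (- of_int k + 2 ^ j * t)" for t
  proof -
    have "cis (- (w / 2 ^ j * of_int k)) * cis (- (w / 2 ^ j * (- of_int k + 2 ^ j * t))) = cis (- (w * t))"
      by (simp add: cis_mult algebra_simps)
    thus ?thesis by (simp add: dyadic_def f_def mult_ac)
  qed
  ultimately show ?thesis by (simp only: line_fourier_def integral_mult_right_zero mult_zero_right)
qed

text \<open>For s <= t the argument t - s runs through [0,t]; for s > t one period is added and it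
  runs through [t,1). Two affine substitutions cover the period once.\<close>

lemma integral_reflect_periodic:
  fixes w :: "real \<Rightarrow> 'b::{banach, second_countable_topology}"
  assumes w: "set_integrable lborel {0..1} w" and per: "\<And>u. w (u + 1) = w u" and t: "t \<in> {0..1}"
  shows "set_integrable lborel {0..1} (\<lambda>s. w (t - s))"
    and "(LINT s:{0..1}|lborel. w (t - s)) = (LINT u:{0..1}|lborel. w u)"
proof -
  define W where "W u = indicator {0..1} u *\<^sub>R w u" for u :: real
  have W: "integrable lborel W" using w by (simp add: W_def[abs_def] set_integrable_def)
  define f1 where "f1 u = indicator {0..t} u *\<^sub>R W u" for u
  \<comment> \<open>Excluding 1 matters for the pointwise identity: at s = t both pieces would
    otherwise contribute, at the arguments 0 and 1.\<close>
  define f2 where "f2 u = indicator {t..<1} u *\<^sub>R W u" for u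
  have f12: "integrable lborel f1" "integrable lborel f2"
    unfolding f1_def f2_def by (intro integrable_mult_indicator W; simp)+
  have i1: "integrable lborel (\<lambda>s. f1 (t + (-1) * s))" and i2: "integrable lborel (\<lambda>s. f2 ((1 + t) + (-1) * s))"
    by (intro lborel_integrable_real_affine f12; simp)+
  have eq: "indicator {0..1} s *\<^sub>R w (t - s) = f1 (t + (-1) * s) + f2 ((1 + t) + (-1) * s)" for s
  proof -
    have "w (1 + t - s) = w (t - s)" using per[of "t - s"] by (simp add: algebra_simps)
    thus ?thesis using t by (auto simp: f1_def f2_def W_def indicator_def)
  qed
  show "set_integrable lborel {0..1} (\<lambda>s. w (t - s))"
    unfolding set_integrable_def eq by (intro Bochner_Integration.integrable_add i1 i2)
  have "(LINT s:{0..1}|lborel. w (t - s)) = (\<integral>s. f1 (t + (-1) * s) \<partial>lborel) + (\<integral>s. f2 ((1 + t) + (-1) * s) \<partial>lborel)"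
    unfolding set_lebesgue_integral_def eq by (rule Bochner_Integration.integral_add[OF i1 i2])
  also have "\<dots> = (\<integral>u. f1 u \<partial>lborel) + (\<integral>u. f2 u \<partial>lborel)"
    using lborel_integral_real_affine[of "-1" f1 t] lborel_integral_real_affine[of "-1" f2 "1 + t"] by simp
  also have "\<dots> = (\<integral>u. f1 u + f2 u \<partial>lborel)"
    by (rule Bochner_Integration.integral_add[OF f12, symmetric])
  also have "\<dots> = (\<integral>u. W u \<partial>lborel)"
  proof (rule integral_cong_AE)
    have "AE u in lborel. u \<noteq> t" "AE u in lborel. u \<noteq> (1::real)" by (rule AE_lborel_singleton)+
    thus "AE u in lborel. f1 u + f2 u = W u"
      by eventually_elim (use t in \<open>auto simp: f1_def f2_def W_def indicator_def\<close>)
  qed (use f12 W in auto)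
  finally show "(LINT s:{0..1}|lborel. w (t - s)) = (LINT u:{0..1}|lborel. w u)"
    by (simp add: W_def set_lebesgue_integral_def)
qed

section \<open>Energy of the blurred wavelets\<close>

text \<open>Expanding \<open>f\<close> replaces the merely integrable \<open>G\<close> by its
  Fourier projection onto \<open>B\<close>. The result is an inner product of \<open>f\<close> with
  a continuous function that depends on \<open>B\<close>, \<open>G\<close> and \<open>t\<close>
  only, so Bessel's inequality can be applied to a whole family of \<open>f\<close>.\<close>

lemma convolution_band_limited:
  fixes f G :: "real \<Rightarrow> real"
  assumes f: "continuous_on {0..1} f" "f 1 = f 0" and B: "finite B"
    and band: "\<And>n. n \<notin> B \<Longrightarrow> (\<integral>t. complex_of_real (f t) * char_fn (- n) t \<partial>unit_measure) = 0"
    and G: "set_integrable lborel {0..1} G" and per: "\<And>u. G (u + 1) = G u" and t: "t \<in> {0..1}"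
  shows "(\<integral>s. f s * G (t - s) \<partial>unit_measure) =
    (\<integral>s. f s * Re (\<Sum>n\<in>B. (\<integral>u. complex_of_real (G u) * char_fn (- n) u \<partial>unit_measure) * char_fn n t * char_fn (- n) s) \<partial>unit_measure)"
proof -
  define c where "c n = (\<integral>s. complex_of_real (f s) * char_fn (- n) s \<partial>unit_measure)" for n
  define d where "d n = (\<integral>u. complex_of_real (G u) * char_fn (- n) u \<partial>unit_measure)" for n
  have fi: "integrable unit_measure (\<lambda>s. complex_of_real (f s) * char_fn (- n) s)" for n
    by (intro integrable_unit_continuous continuous_intros f(1))
  have wi: "set_integrable lborel {0..1} (\<lambda>u. complex_of_real (G u) * char_fn (- n) u)" for n
  proof -
    have "integrable unit_measure G" using G by (simp add: integrable_unit_iff)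
    moreover have "char_fn (- n) \<in> borel_measurable unit_measure"
      by (intro measurable_restrict_space1)
         (simp, intro borel_measurable_continuous_onI continuous_intros)
    ultimately have "integrable unit_measure (\<lambda>u. complex_of_real (G u) * char_fn (- n) u)"
      by (intro Bochner_Integration.integrable_bound[where f = G and g = "\<lambda>u. complex_of_real (G u) * char_fn (- n) u"])
         (auto simp: norm_mult)
    thus ?thesis by (simp only: integrable_unit_iff)
  qed
  have wper: "complex_of_real (G (u + 1)) * char_fn (- n) (u + 1) = complex_of_real (G u) * char_fn (- n) u" for n u
    using char_fn_add_int[of "- n" u 1] per by (simp only: of_int_1)
  note reflect = integral_reflect_periodic[OF wi wper t]
  have split: "char_fn n s = char_fn n t * char_fn (- n) (t - s)" for n s
    by (simp add: cis_mult algebra_simps)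
  have GE: "complex_of_real (G (t - s)) * char_fn n s =
      char_fn n t * (complex_of_real (G (t - s)) * char_fn (- n) (t - s))" for n s
    unfolding split[of n s] by (simp only: mult_ac)
  have Gi: "integrable unit_measure (\<lambda>s. complex_of_real (G (t - s)) * char_fn n s)" for n
    unfolding GE using reflect(1)[of n] by (intro integrable_mult_right) (simp only: integrable_unit_iff)
  have Gint: "(\<integral>s. complex_of_real (G (t - s)) * char_fn n s \<partial>unit_measure) = char_fn n t * d n" for n
  proof -
    have "(\<integral>s. complex_of_real (G (t - s)) * char_fn n s \<partial>unit_measure) =
        char_fn n t * (\<integral>s. complex_of_real (G (t - s)) * char_fn (- n) (t - s) \<partial>unit_measure)"
      unfolding GE by (rule integral_mult_right_zero)
    also have "(\<integral>s. complex_of_real (G (t - s)) * char_fn (- n) (t - s) \<partial>unit_measure) = d n"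
      using reflect(2)[of n] by (simp only: d_def integral_unit_eq)
    finally show ?thesis .
  qed
  have "(\<integral>s. f s * G (t - s) \<partial>unit_measure) =
      (\<integral>s. Re (\<Sum>n\<in>B. c n * (complex_of_real (G (t - s)) * char_fn n s)) \<partial>unit_measure)"
  proof (intro Bochner_Integration.integral_cong refl)
    fix s assume "s \<in> space unit_measure"
    hence s: "s \<in> {0..1}" by (simp add: space_restrict_space)
    have "f s = Re (\<Sum>n\<in>B. c n * char_fn n s)"
      unfolding c_def by (rule band_limited_eq_trig_polynomial[OF f B band s])
    hence "f s * G (t - s) = Re (\<Sum>n\<in>B. c n * char_fn n s) * G (t - s)" by (rule arg_cong)
    also have "\<dots> = Re ((\<Sum>n\<in>B. c n * char_fn n s) * complex_of_real (G (t - s)))"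
      by (simp only: times_complex.sel Re_complex_of_real Im_complex_of_real mult_zero_right diff_0_right)
    also have "(\<Sum>n\<in>B. c n * char_fn n s) * complex_of_real (G (t - s)) =
        (\<Sum>n\<in>B. c n * (complex_of_real (G (t - s)) * char_fn n s))"
    proof -
      have *: "x * y * z = x * (z * y)" for x y z :: complex by simp
      show ?thesis unfolding sum_distrib_right by (intro sum.cong refl *)
    qed
    finally show "f s * G (t - s) = Re (\<Sum>n\<in>B. c n * (complex_of_real (G (t - s)) * char_fn n s))" .
  qed
  also have "\<dots> = Re (\<integral>s. (\<Sum>n\<in>B. c n * (complex_of_real (G (t - s)) * char_fn n s)) \<partial>unit_measure)"
    using Gi by (intro integral_Re Bochner_Integration.integrable_sum integrable_mult_right)
  also have "(\<integral>s. (\<Sum>n\<in>B. c n * (complex_of_real (G (t - s)) * char_fn n s)) \<partial>unit_measure) =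
      (\<Sum>n\<in>B. c n * (char_fn n t * d n))"
    using Gi by (subst Bochner_Integration.integral_sum)
      (auto intro!: integrable_mult_right simp only: integral_mult_right_zero Gint)
  also have "\<dots> = (\<integral>s. (\<Sum>n\<in>B. d n * char_fn n t * (complex_of_real (f s) * char_fn (- n) s)) \<partial>unit_measure)"
  proof -
    have "(\<integral>s. (\<Sum>n\<in>B. d n * char_fn n t * (complex_of_real (f s) * char_fn (- n) s)) \<partial>unit_measure) =
        (\<Sum>n\<in>B. \<integral>s. d n * char_fn n t * (complex_of_real (f s) * char_fn (- n) s) \<partial>unit_measure)"
      by (rule Bochner_Integration.integral_sum) (intro integrable_mult_right fi)
    also have "\<dots> = (\<Sum>n\<in>B. d n * char_fn n t * c n)"
      by (simp only: integral_mult_right_zero c_def)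
    also have "\<dots> = (\<Sum>n\<in>B. c n * (char_fn n t * d n))"
    proof -
      have *: "x * y * z = z * (y * x)" for x y z :: complex by simp
      show ?thesis by (intro sum.cong refl *)
    qed
    finally show ?thesis by (rule sym)
  qed
  also have "Re \<dots> = (\<integral>s. Re (\<Sum>n\<in>B. d n * char_fn n t * (complex_of_real (f s) * char_fn (- n) s)) \<partial>unit_measure)"
    using fi by (intro integral_Re[symmetric] Bochner_Integration.integrable_sum integrable_mult_right)
  also have "\<dots> = (\<integral>s. f s * Re (\<Sum>n\<in>B. d n * char_fn n t * char_fn (- n) s) \<partial>unit_measure)"
  proof (intro Bochner_Integration.integral_cong refl)
    fix s
    have "(\<Sum>n\<in>B. d n * char_fn n t * (complex_of_real (f s) * char_fn (- n) s)) =
        complex_of_real (f s) * (\<Sum>n\<in>B. d n * char_fn n t * char_fn (- n) s)"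
      unfolding sum_distrib_left by (intro sum.cong refl) (simp only: mult_ac)
    thus "Re (\<Sum>n\<in>B. d n * char_fn n t * (complex_of_real (f s) * char_fn (- n) s)) =
        f s * Re (\<Sum>n\<in>B. d n * char_fn n t * char_fn (- n) s)"
      by (simp only: times_complex.sel Re_complex_of_real Im_complex_of_real mult_zero_left diff_0_right)
  qed
  finally show ?thesis by (simp only: d_def)
qed

text \<open>All summands are squared inner products with the same function Re H. Bessel bounds their
  sum by the squared norm of H, and Parseval evaluates that norm; \<open>t\<close> drops out because
  characters have modulus 1.\<close>

lemma sum_convolution_squared_le:
  fixes f :: "'k \<Rightarrow> real \<Rightarrow> real"
  assumes K: "finite K"
    and f: "\<And>k. k \<in> K \<Longrightarrow> continuous_on {0..1} (f k)" "\<And>k. k \<in> K \<Longrightarrow> f k 1 = f k 0" and B: "finite B"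
    and band: "\<And>k n. k \<in> K \<Longrightarrow> n \<notin> B \<Longrightarrow> (\<integral>t. complex_of_real (f k t) * char_fn (- n) t \<partial>unit_measure) = 0"
    and ortho: "\<And>k k'. k \<in> K \<Longrightarrow> k' \<in> K \<Longrightarrow> (\<integral>x. f k x * f k' x \<partial>unit_measure) = (if k = k' then 1 else 0)"
    and G: "set_integrable lborel {0..1} G" and per: "\<And>u. G (u + 1) = G u" and t: "t \<in> {0..1}"
  shows "(\<Sum>k\<in>K. (\<integral>s. f k s * G (t - s) \<partial>unit_measure)\<^sup>2) \<le>
    (\<Sum>n\<in>B. (cmod (\<integral>u. complex_of_real (G u) * char_fn (- n) u \<partial>unit_measure))\<^sup>2)"
proof -
  define d where "d n = (\<integral>u. complex_of_real (G u) * char_fn (- n) u \<partial>unit_measure)" for n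
  define H where "H s = (\<Sum>n\<in>B. d n * char_fn n t * char_fn (- n) s)" for s
  have H: "continuous_on {0..1} H" unfolding H_def by (intro continuous_intros)
  have "(\<Sum>k\<in>K. (\<integral>s. f k s * G (t - s) \<partial>unit_measure)\<^sup>2) = (\<Sum>k\<in>K. (\<integral>s. Re (H s) * f k s \<partial>unit_measure)\<^sup>2)"
    unfolding H_def d_def
    by (intro sum.cong refl arg_cong[where f = "\<lambda>x. x\<^sup>2"])
       (subst convolution_band_limited[OF f B band G per t]; simp add: mult.commute)
  also have "\<dots> \<le> (\<integral>s. (Re (H s))\<^sup>2 \<partial>unit_measure)"
  proof (rule bessel_inequality[OF K _ _ ortho])
    show "f k \<in> borel_measurable unit_measure" if "k \<in> K" for k
      using integrable_unit_continuous[OF f(1)[OF that]] by (rule borel_measurable_integrable)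
    show "(\<lambda>s. Re (H s)) \<in> borel_measurable unit_measure"
      by (intro borel_measurable_integrable integrable_unit_continuous continuous_intros H)
  qed (use f(1) H in \<open>auto intro!: integrable_unit_continuous continuous_intros\<close>)
  also have "\<dots> \<le> (\<integral>s. (cmod (H s))\<^sup>2 \<partial>unit_measure)"
    by (intro integral_mono integrable_unit_continuous continuous_intros H) (simp add: cmod_power2)
  also have "\<dots> = (\<Sum>n\<in>B. (cmod (d n * char_fn n t))\<^sup>2)"
    unfolding H_def by (rule parseval_trig_polynomial[OF B])
  also have "\<dots> = (\<Sum>n\<in>B. (cmod (d n))\<^sup>2)" by (simp add: norm_mult)
  finally show ?thesis by (simp only: d_def)
qed

text \<open>
  The wavelets of level \<open>j\<close> have their frequencies in the band \<open>a 2\<^sup>j \<le> \<bar>2\<pi>n\<bar> \<le> b 2\<^sup>j\<close>, which contains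
  \<open>O(2\<^sup>j)\<close> integers \<open>n\<close>, each with kernel coefficient of order \<open>2 powr (-\<nu> j)\<close>.
\<close>

lemma meyer_blurred_energy:
  assumes g: "admissible_kernel g" and \<nu>: "\<nu> > 0" and K2: "K2 > 0"
    and kernel: "\<And>n x. n \<noteq> 0 \<Longrightarrow> x \<in> {0..1} \<Longrightarrow>
          (cmod (kernel_coeff g n x))\<^sup>2 \<le> K2 * \<bar>2 * pi * of_int n\<bar> powr (- 2 * \<nu>)"
    and basis: "periodized_wavelet_basis \<phi> \<psi> m1" and meyer: "meyer_type \<phi> \<psi>"
  obtains C where "0 \<le> C" "\<And>j t x. m1 \<le> j \<Longrightarrow> t \<in> {0..1} \<Longrightarrow> x \<in> {0..1} \<Longrightarrow>
    (\<Sum>k<2^j. (LINT s:{0..1}|lborel. periodic_wavelet \<phi> \<psi> j k s * g (t - s, x))\<^sup>2) \<le>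
    C * 2 ^ j * (2 ^ j) powr (- 2 * \<nu>)"
proof -
  obtain a b where ab: "0 < a" "a < b" and
    band: "\<And>w. line_fourier \<psi> w \<noteq> 0 \<Longrightarrow> a \<le> \<bar>w\<bar> \<and> \<bar>w\<bar> \<le> b"
    using meyer unfolding meyer_type_def by blast
  have qd: "quadratic_decay \<psi>" by (rule meyer_type_quadratic_decay[OF meyer])
  \<comment> \<open>\<open>2 * b + 1\<close> bounds the number of frequencies in the band divided by
    2^j; the rest bounds the kernel coefficients at the lower edge of the band.\<close>
  define C where "C = (2 * b + 1) * (K2 * a powr (- 2 * \<nu>))"
  have C: "0 \<le> C" using ab K2 by (simp add: C_def)
  have main: "(\<Sum>k<2^j. (LINT s:{0..1}|lborel. periodic_wavelet \<phi> \<psi> j k s * g (t - s, x))\<^sup>2) \<le>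
    C * 2 ^ j * (2 ^ j) powr (- 2 * \<nu>)" if j: "m1 \<le> j" and t: "t \<in> {0..1}" and x: "x \<in> {0..1}" for j t x
  proof -
    define B where "B = {n::int. a * 2 ^ j \<le> \<bar>2 * pi * of_int n\<bar> \<and> \<bar>2 * pi * of_int n\<bar> \<le> b * 2 ^ j}"
    \<comment> \<open>A crude count: |n| <= |2 pi n| is enough for a bound of order 2^j.\<close>
    have Bsub: "B \<subseteq> {- \<lfloor>b * 2 ^ j\<rfloor>..\<lfloor>b * 2 ^ j\<rfloor>}"
    proof
      fix n assume n: "n \<in> B"
      have "1 * \<bar>real_of_int n\<bar> \<le> (2 * pi) * \<bar>real_of_int n\<bar>"
        using pi_gt3 by (intro mult_right_mono) auto
      also have "\<dots> \<le> b * 2 ^ j" using n by (simp add: B_def abs_mult)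
      finally have "\<bar>n\<bar> \<le> \<lfloor>b * 2 ^ j\<rfloor>" by (simp add: le_floor_iff)
      thus "n \<in> {- \<lfloor>b * 2 ^ j\<rfloor>..\<lfloor>b * 2 ^ j\<rfloor>}" by (simp add: abs_le_iff)
    qed
    have Bfin: "finite B" by (rule finite_subset[OF Bsub]) simp
    have "card B \<le> card {- \<lfloor>b * 2 ^ j\<rfloor>..\<lfloor>b * 2 ^ j\<rfloor>}" by (intro card_mono Bsub) simp
    also have "\<dots> = nat (2 * \<lfloor>b * 2 ^ j\<rfloor> + 1)" by simp
    finally have "real (card B) \<le> real (nat (2 * \<lfloor>b * 2 ^ j\<rfloor> + 1))" by (simp only: of_nat_le_iff)
    also have "\<dots> = 2 * of_int \<lfloor>b * 2 ^ j\<rfloor> + 1" using ab by simp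
    also have "\<dots> \<le> 2 * (b * 2 ^ j) + 1" by simp
    also have "\<dots> \<le> (2 * b + 1) * 2 ^ j" by (simp add: algebra_simps)
    finally have cardB: "real (card B) \<le> (2 * b + 1) * 2 ^ j" .
    have wav: "periodic_wavelet \<phi> \<psi> j k = periodize (dyadic \<psi> j (int k))" if "k < 2 ^ j" for k
      using that by (simp add: periodic_wavelet_def fun_eq_iff)
    have cont: "continuous_on UNIV (periodize (dyadic \<psi> j k))" for k
      by (intro continuous_periodize quadratic_decay_dyadic qd)
    have loc: "k \<in> locations m1 j" if "k < 2 ^ j" for k using that by (auto simp: locations_def)
    have ortho: "(\<integral>x. periodic_wavelet \<phi> \<psi> j k x * periodic_wavelet \<phi> \<psi> j k' x \<partial>unit_measure) = (if k = k' then 1 else 0)"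
      if "k < 2 ^ j" "k' < 2 ^ j" for k k'
    proof -
      have "(j, k) \<in> Sigma {m1..} (locations m1)" "(j, k') \<in> Sigma {m1..} (locations m1)"
        using j loc that by auto
      thus ?thesis
        using basis unfolding periodized_wavelet_basis_def L2_orthonormal_basis_def by fastforce
    qed
    have zero: "(\<integral>t. complex_of_real (periodize (dyadic \<psi> j k) t) * char_fn (- n) t \<partial>unit_measure) = 0"
      if "n \<notin> B" for k n
    proof -
      have "line_fourier \<psi> (2 * pi * of_int n / 2 ^ j) = 0"
      proof (rule ccontr)
        assume "line_fourier \<psi> (2 * pi * of_int n / 2 ^ j) \<noteq> 0"
        from band[OF this] have "a \<le> \<bar>2 * pi * of_int n\<bar> / 2 ^ j" "\<bar>2 * pi * of_int n\<bar> / 2 ^ j \<le> b" by simp_all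
        hence "n \<in> B" unfolding B_def by (simp only: mem_Collect_eq pos_le_divide_eq pos_divide_le_eq zero_less_power zero_less_numeral)
        thus False using that by simp
      qed
      thus ?thesis
        unfolding fourier_periodize[OF quadratic_decay_dyadic[OF qd]] by (rule line_fourier_dyadic_eq_0)
    qed
    have "(\<Sum>k<2^j. (LINT s:{0..1}|lborel. periodic_wavelet \<phi> \<psi> j k s * g (t - s, x))\<^sup>2) =
        (\<Sum>k\<in>{..<2^j}. (\<integral>s. periodic_wavelet \<phi> \<psi> j k s * g (t - s, x) \<partial>unit_measure)\<^sup>2)"
      by (simp only: integral_unit_eq)
    also have "\<dots> \<le> (\<Sum>n\<in>B. (cmod (\<integral>u. complex_of_real (g (u, x)) * char_fn (- n) u \<partial>unit_measure))\<^sup>2)"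
    proof (rule sum_convolution_squared_le[where G = "\<lambda>u. g (u, x)", OF _ _ _ Bfin _ _ _ _ t])
      show "continuous_on {0..1} (periodic_wavelet \<phi> \<psi> j k)" if "k \<in> {..<2^j}" for k
        using that wav continuous_on_subset[OF cont] by simp
      show "periodic_wavelet \<phi> \<psi> j k 1 = periodic_wavelet \<phi> \<psi> j k 0" if "k \<in> {..<2^j}" for k
        using that wav periodize_periodic[of _ 0] by simp
      show "(\<integral>t. complex_of_real (periodic_wavelet \<phi> \<psi> j k t) * char_fn (- n) t \<partial>unit_measure) = 0"
        if "k \<in> {..<2^j}" "n \<notin> B" for k n
        using that wav zero by (simp only: lessThan_iff)
      show "set_integrable lborel {0..1} (\<lambda>u. g (u, x))" "g (u + 1, x) = g (u, x)" for u
        using g x by (auto simp: admissible_kernel_def)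
    qed (use ortho in auto)
    also have "\<dots> \<le> (\<Sum>n\<in>B. K2 * (a * 2 ^ j) powr (- 2 * \<nu>))"
    proof (rule sum_mono)
      fix n assume n: "n \<in> B"
      \<comment> \<open>The band avoids 0 because a > 0; the kernel assumption says nothing about
        frequency 0.\<close>
      have n0: "n \<noteq> 0"
      proof
        assume "n = 0"
        hence "a * 2 ^ j \<le> 0" using n by (simp add: B_def)
        moreover have "0 < a * 2 ^ j" using ab by simp
        ultimately show False by linarith
      qed
      have "(\<integral>u. complex_of_real (g (u, x)) * char_fn (- n) u \<partial>unit_measure) = kernel_coeff g n x"
        by (simp add: kernel_coeff_def integral_unit_eq)
      hence "(cmod (\<integral>u. complex_of_real (g (u, x)) * char_fn (- n) u \<partial>unit_measure))\<^sup>2 \<le>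
          K2 * \<bar>2 * pi * of_int n\<bar> powr (- 2 * \<nu>)"
        using kernel[OF n0 x] by simp
      also have "\<dots> \<le> K2 * (a * 2 ^ j) powr (- 2 * \<nu>)"
        using n ab K2 \<nu> by (intro mult_left_mono powr_mono2') (auto simp: B_def)
      finally show "(cmod (\<integral>u. complex_of_real (g (u, x)) * char_fn (- n) u \<partial>unit_measure))\<^sup>2 \<le> \<dots>" .
    qed
    also have "\<dots> = real (card B) * (K2 * (a powr (- 2 * \<nu>) * (2 ^ j) powr (- 2 * \<nu>)))"
      using ab by (simp add: powr_mult)
    also have "\<dots> \<le> ((2 * b + 1) * 2 ^ j) * (K2 * (a powr (- 2 * \<nu>) * (2 ^ j) powr (- 2 * \<nu>)))"
      using K2 by (intro mult_right_mono cardB) auto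
    also have "\<dots> = C * 2 ^ j * (2 ^ j) powr (- 2 * \<nu>)" by (simp only: C_def mult_ac)
    finally show ?thesis .
  qed
  from that[OF C main] show ?thesis .
qed

section \<open>Tensor wavelets in the Besov ball\<close>

lemma periodic_wavelet_continuous:
  assumes "quadratic_decay \<phi>" "quadratic_decay \<psi>"
  shows "continuous_on UNIV (periodic_wavelet \<phi> \<psi> j k)"
proof (cases "k < 2 ^ j")
  case True
  thus ?thesis using continuous_periodize[OF quadratic_decay_dyadic[OF assms(2), of j "int k"]]
    by (simp add: periodic_wavelet_def)
next
  case False
  thus ?thesis using continuous_periodize[OF quadratic_decay_dyadic[OF assms(1), of j "int k - 2 ^ j"]]
    by (simp add: periodic_wavelet_def)
qed

lemma periodic_wavelet_periodic: "periodic_wavelet \<phi> \<psi> j k (t + 1) = periodic_wavelet \<phi> \<psi> j k t"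
  by (simp add: periodic_wavelet_def periodize_periodic)

lemma periodic_wavelet_orthonormal:
  assumes "periodized_wavelet_basis \<phi> \<psi> m" "m \<le> j" "m \<le> j'" "k \<in> locations m j" "k' \<in> locations m j'"
  shows "(\<integral>t. periodic_wavelet \<phi> \<psi> j k t * periodic_wavelet \<phi> \<psi> j' k' t \<partial>unit_measure) =
    (if j = j' \<and> k = k' then 1 else 0)"
proof -
  have "(j, k) \<in> Sigma {m..} (locations m)" "(j', k') \<in> Sigma {m..} (locations m)"
    using assms by auto
  thus ?thesis
    using assms(1) unfolding periodized_wavelet_basis_def L2_orthonormal_basis_def by fastforce
qed

lemma integrable_square_continuous:
  fixes f :: "real \<times> real \<Rightarrow> real"
  assumes "continuous_on UNIV f"
  shows "set_integrable lborel unit_square f"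
    and "integrable (square_measure) f"
proof -
  show 1: "set_integrable lborel unit_square f"
    unfolding set_integrable_def
    by (rule borel_integrable_compact) (auto intro: compact_Times continuous_on_subset[OF assms])
  have "unit_square \<in> sets (lborel :: (real \<times> real) measure)" by (simp add: borel_Times)
  thus "integrable (square_measure) f"
    using 1 by (simp add: set_integrable_def integrable_restrict_space)
qed

lemma integral_square_eq:
  fixes f :: "real \<times> real \<Rightarrow> real"
  shows "(LINT z:unit_square|lborel. f z) = (\<integral>z. f z \<partial>square_measure)"
  by (simp add: set_lebesgue_integral_def integral_restrict_space borel_Times)

lemma integral_square_tensor:
  fixes a b :: "real \<Rightarrow> real"
  assumes a: "continuous_on UNIV a" and b: "continuous_on UNIV b"
  shows "(\<integral>z. a (fst z) * b (snd z) \<partial>square_measure) =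
    (\<integral>t. a t \<partial>unit_measure) * (\<integral>x. b x \<partial>unit_measure)"
proof -
  have "continuous_on UNIV (\<lambda>z. a (fst z) * b (snd z))"
    by (intro continuous_intros continuous_on_compose2[OF a] continuous_on_compose2[OF b]) auto
  from integrable_square_continuous(1)[OF this]
  have "integrable (lborel \<Otimes>\<^sub>M lborel) (\<lambda>z. indicator unit_square z *\<^sub>R (a (fst z) * b (snd z)))"
    by (simp add: set_integrable_def lborel_prod)
  hence int: "integrable (lborel \<Otimes>\<^sub>M lborel) (\<lambda>(t, x). indicator unit_square (t, x) *\<^sub>R (a t * b x))"
    by (simp add: split_def)
  have "(\<integral>z. a (fst z) * b (snd z) \<partial>square_measure) =
      (\<integral>z. (\<lambda>(t, x). indicator unit_square (t, x) *\<^sub>R (a t * b x)) z \<partial>(lborel \<Otimes>\<^sub>M lborel))"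
    by (simp add: integral_square_eq[symmetric] set_lebesgue_integral_def lborel_prod split_def)
  also have "\<dots> = (\<integral>t. (\<integral>x. indicator unit_square (t, x) *\<^sub>R (a t * b x) \<partial>lborel) \<partial>lborel)"
    using lborel_pair.integral_fst'[OF int] by simp
  also have "\<dots> = (\<integral>t. (\<integral>x. (indicator {0..1} t * a t) * (indicator {0..1} x * b x) \<partial>lborel) \<partial>lborel)"
    by (simp add: indicator_times mult_ac)
  also have "\<dots> = (\<integral>t. indicator {0..1} t * a t \<partial>lborel) * (\<integral>x. indicator {0..1} x * b x \<partial>lborel)"
    by simp
  finally show ?thesis
    by (simp add: integral_unit_eq[symmetric] set_lebesgue_integral_def)
qed

lemma lp_norm_two_valued_le:
  assumes p: "1 \<le> p" and K: "finite K" "K \<noteq> {}" and E: "E \<subseteq> K" and L: "finite L" "K \<subseteq> L" and \<gamma>: "0 \<le> \<gamma>"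
  shows "lp_norm p L (\<lambda>k. if k \<in> E then \<gamma> else 0) \<le> \<gamma> * real (card K) powr recip p"
proof (cases "p = \<infinity>")
  case True
  have "Max ((\<lambda>k. \<bar>if k \<in> E then \<gamma> else 0\<bar>) ` L) \<le> \<gamma>"
    using K L \<gamma> by (subst Max_le_iff) auto
  \<comment> \<open>The reciprocal of \<infinity> is 0, and x powr 0 = 1 holds for nonzero x; hence
    \<open>K\<close> must be nonempty.\<close>
  moreover have "real (card K) powr recip p = 1"
    using True K by (simp add: recip_def)
  ultimately show ?thesis using True by (simp add: lp_norm_def)
next
  case False
  then obtain r where r: "p = ereal r" "1 \<le> r" using p by (cases p) auto
  have rp: "recip p = 1 / r" using r by (simp add: recip_def one_ereal_def)
  have "(\<Sum>k\<in>L. \<bar>if k \<in> E then \<gamma> else 0\<bar> powr r) = (\<Sum>k\<in>E. \<gamma> powr r)"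
    using E K L \<gamma> by (intro sum.mono_neutral_cong_right) (auto intro: finite_subset)
  also have "\<dots> \<le> (\<Sum>k\<in>K. \<gamma> powr r)"
    using E K by (intro sum_mono2) auto
  also have "\<dots> = real (card K) * \<gamma> powr r" by simp
  finally have le: "(\<Sum>k\<in>L. \<bar>if k \<in> E then \<gamma> else 0\<bar> powr r) \<le> real (card K) * \<gamma> powr r" .
  have "lp_norm p L (\<lambda>k. if k \<in> E then \<gamma> else 0) = (\<Sum>k\<in>L. \<bar>if k \<in> E then \<gamma> else 0\<bar> powr r) powr (1 / r)"
    using r False rp by (simp add: lp_norm_def)
  also have "\<dots> \<le> (real (card K) * \<gamma> powr r) powr (1 / r)"
    using le r by (intro powr_mono2 sum_nonneg) auto
  also have "\<dots> = \<gamma> * real (card K) powr recip p"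
    using r \<gamma> rp by (simp add: powr_mult powr_powr)
  finally show ?thesis .
qed

lemma lp_norm_zero:
  assumes "finite L" "L \<noteq> {}"
  shows "lp_norm p L (\<lambda>k. 0) = 0"
  using assms by (simp add: lp_norm_def image_constant_conv)

text \<open>All alternatives live on one level, so the outer sequence norm collapses to one
  term.\<close>

lemma lq_norm_le_single:
  assumes q: "1 \<le> q" and J: "j0 \<in> J" and a: "\<And>j. j \<in> J \<Longrightarrow> j \<noteq> j0 \<Longrightarrow> a j = 0" "\<bar>a j0\<bar> \<le> A" and A: "0 \<le> A"
  shows "lq_norm_le q J a A"
proof (cases "q = \<infinity>")
  case True
  have "\<bar>a j\<bar> \<le> A" if "j \<in> J" for j using a A that by (cases "j = j0") auto
  thus ?thesis using True by (simp add: lq_norm_le_def)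
next
  case False
  then obtain r where r: "q = ereal r" "1 \<le> r" using q by (cases q) auto
  have rq: "recip q = 1 / r" using r by (simp add: recip_def one_ereal_def)
  have "((\<lambda>j. \<bar>a j\<bar> powr r) has_sum (\<bar>a j0\<bar> powr r)) {j0}"
    by (rule has_sum_finiteI) auto
  hence "((\<lambda>j. \<bar>a j\<bar> powr r) has_sum (\<bar>a j0\<bar> powr r)) J"
    by (rule has_sum_cong_neutral[THEN iffD1, rotated -1]) (use J a in auto)
  hence "(\<lambda>j. \<bar>a j\<bar> powr r) summable_on J" "(\<Sum>\<^sub>\<infinity>j\<in>J. \<bar>a j\<bar> powr r) = \<bar>a j0\<bar> powr r"
    by (auto simp: has_sum_iff)
  thus ?thesis using r False a(2) rq by (simp add: lq_norm_le_def powr_powr)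
qed

locale tensor_wavelets =
  fixes \<phi> \<psi> \<phi>' \<eta> :: "real \<Rightarrow> real" and m1 m2 :: nat
  assumes basis1: "periodized_wavelet_basis \<phi> \<psi> m1" and basis2: "periodized_wavelet_basis \<phi>' \<eta> m2"
    and decay: "quadratic_decay \<phi>" "quadratic_decay \<psi>" "quadratic_decay \<phi>'" "quadratic_decay \<eta>"
begin

abbreviation Psi :: "nat \<Rightarrow> nat \<Rightarrow> real \<Rightarrow> real" where "Psi \<equiv> periodic_wavelet \<phi> \<psi>"
abbreviation Eta :: "nat \<Rightarrow> nat \<Rightarrow> real \<Rightarrow> real" where "Eta \<equiv> periodic_wavelet \<phi>' \<eta>"

definition tensor :: "nat \<Rightarrow> nat \<Rightarrow> nat \<times> nat \<Rightarrow> real \<times> real \<Rightarrow> real" where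
  "tensor j1 j2 k z = Psi j1 (fst k) (fst z) * Eta j2 (snd k) (snd z)"

lemma continuous_tensor: "continuous_on UNIV (tensor j1 j2 k)"
  unfolding tensor_def[abs_def]
  by (intro continuous_intros continuous_on_compose2[OF periodic_wavelet_continuous[OF decay(1,2)]]
      continuous_on_compose2[OF periodic_wavelet_continuous[OF decay(3,4)]]) auto

lemma tensor_orthonormal:
  assumes "m1 \<le> j1" "m1 \<le> j1'" "m2 \<le> j2" "m2 \<le> j2'"
    "k \<in> locations m1 j1 \<times> locations m2 j2" "k' \<in> locations m1 j1' \<times> locations m2 j2'"
  shows "(\<integral>z. tensor j1 j2 k z * tensor j1' j2' k' z \<partial>square_measure) =
    (if j1 = j1' \<and> j2 = j2' \<and> k = k' then 1 else 0)"
proof -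
  define a where "a t = Psi j1 (fst k) t * Psi j1' (fst k') t" for t
  define b where "b x = Eta j2 (snd k) x * Eta j2' (snd k') x" for x
  have ab: "continuous_on UNIV a" "continuous_on UNIV b"
    unfolding a_def b_def by (intro continuous_intros periodic_wavelet_continuous decay)+
  have "(\<integral>z. tensor j1 j2 k z * tensor j1' j2' k' z \<partial>square_measure) =
      (\<integral>z. a (fst z) * b (snd z) \<partial>square_measure)"
    by (intro Bochner_Integration.integral_cong refl) (simp add: tensor_def a_def b_def)
  also have "\<dots> = (\<integral>t. a t \<partial>unit_measure) * (\<integral>x. b x \<partial>unit_measure)"
    by (rule integral_square_tensor[OF ab])
  also have "\<dots> = (if j1 = j1' \<and> fst k = fst k' then 1 else 0) * (if j2 = j2' \<and> snd k = snd k' then 1 else 0)"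
    unfolding a_def b_def using assms
    by (intro arg_cong2[where f = "(*)"] periodic_wavelet_orthonormal[OF basis1] periodic_wavelet_orthonormal[OF basis2]) auto
  finally show ?thesis by (auto simp: prod_eq_iff)
qed

text \<open>By orthonormality across all levels the coefficients are \<gamma> on \<open>E\<close>
  and 0 elsewhere. Only one level contributes to the Besov norm, and its contribution is largest for
  \<open>E = K\<close>; the condition \<open>size\<close> therefore serves all subsets at
  once.\<close>

lemma tensor_sum_in_besov_ball:
  assumes j: "m1 \<le> j1" "m2 \<le> j2" and K: "K \<subseteq> {..<2^j1} \<times> {..<2^j2}" "K \<noteq> {}" and E: "E \<subseteq> K"
    and p: "1 \<le> p" and q: "1 \<le> q" and \<gamma>: "0 \<le> \<gamma>"
    and size: "2 powr (real j1 * s_star s1 p + real j2 * s_star s2 p) * (\<gamma> * real (card K) powr recip p) \<le> A"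
  shows "(\<lambda>z. \<Sum>k\<in>E. \<gamma> * tensor j1 j2 k z) \<in>
    besov_ball Psi m1 Eta m2 p q s1 s2 A \<inter> regression_functions"
proof -
  define f where "f z = (\<Sum>k\<in>E. \<gamma> * tensor j1 j2 k z)" for z
  have Kfin: "finite K" by (rule finite_subset[OF K(1)]) simp
  have Efin: "finite E" by (rule finite_subset[OF E Kfin])
  \<comment> \<open>Locations below 2^j are genuine wavelets. At the lowest level the index set also
    holds scaling functions, which the alternatives avoid since their band need not stay away from
    frequency 0.\<close>
  have loc: "{..<2^j1} \<times> {..<2^j2} \<subseteq> locations m1 j1 \<times> locations m2 j2"
    by (auto simp: locations_def)
  have f: "continuous_on UNIV f"
    unfolding f_def by (intro continuous_intros continuous_tensor)
  have "continuous_on UNIV (\<lambda>z. (f z)\<^sup>2)" by (intro continuous_intros f)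
  hence L2: "f \<in> L2_square"
    using integrable_square_continuous(1) borel_measurable_continuous_onI[OF f] by (simp add: L2_square_def)
  have reg: "f \<in> regression_functions"
    using f by (simp add: regression_functions_def f_def tensor_def periodic_wavelet_periodic)
  have coeff: "wavelet_coeff Psi Eta f j1' (fst k') j2' (snd k') =
      (if j1 = j1' \<and> j2 = j2' \<and> k' \<in> E then \<gamma> else 0)"
    if "m1 \<le> j1'" "m2 \<le> j2'" "k' \<in> locations m1 j1' \<times> locations m2 j2'" for j1' j2' k'
  proof -
    have "wavelet_coeff Psi Eta f j1' (fst k') j2' (snd k') =
        (\<integral>z. (\<Sum>k\<in>E. \<gamma> * (tensor j1 j2 k z * tensor j1' j2' k' z)) \<partial>square_measure)"
      unfolding wavelet_coeff_def integral_square_eq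
      by (intro Bochner_Integration.integral_cong refl)
         (simp add: f_def tensor_def sum_distrib_left sum_distrib_right mult_ac)
    also have "\<dots> = (\<Sum>k\<in>E. \<gamma> * (\<integral>z. tensor j1 j2 k z * tensor j1' j2' k' z \<partial>square_measure))"
      by (subst Bochner_Integration.integral_sum)
         (auto intro!: integrable_mult_right integrable_square_continuous continuous_intros continuous_tensor)
    also have "\<dots> = (\<Sum>k\<in>E. if k = k' then (if j1 = j1' \<and> j2 = j2' then \<gamma> else 0) else 0)"
      using E K loc j that by (intro sum.cong refl) (subst tensor_orthonormal; auto)
    also have "\<dots> = (if j1 = j1' \<and> j2 = j2' \<and> k' \<in> E then \<gamma> else 0)"
      using Efin by simp
    finally show ?thesis .
  qed
  have fin: "finite (locations m1 i1 \<times> locations m2 i2)" and ne: "locations m1 i1 \<times> locations m2 i2 \<noteq> {}" for i1 i2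
    by (auto simp: locations_def lessThan_empty_iff)
  have lp: "lp_norm p (locations m1 i1 \<times> locations m2 i2)
      (\<lambda>(k1, k2). wavelet_coeff Psi Eta f i1 k1 i2 k2) =
      lp_norm p (locations m1 i1 \<times> locations m2 i2) (\<lambda>k. if j1 = i1 \<and> j2 = i2 \<and> k \<in> E then \<gamma> else 0)"
    if "m1 \<le> i1" "m2 \<le> i2" for i1 i2
  proof -
    have "\<bar>case k of (k1, k2) \<Rightarrow> wavelet_coeff Psi Eta f i1 k1 i2 k2\<bar> =
        \<bar>if j1 = i1 \<and> j2 = i2 \<and> k \<in> E then \<gamma> else 0\<bar>" if "k \<in> locations m1 i1 \<times> locations m2 i2" for k
      using coeff[OF \<open>m1 \<le> i1\<close> \<open>m2 \<le> i2\<close> that] by (simp add: split_def)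
    thus ?thesis unfolding lp_norm_def by (simp cong: image_cong sum.cong)
  qed
  have "lq_norm_le q ({m1..} \<times> {m2..})
      (\<lambda>(i1, i2). 2 powr (real i1 * s_star s1 p + real i2 * s_star s2 p) *
         lp_norm p (locations m1 i1 \<times> locations m2 i2)
           (\<lambda>(k1, k2). wavelet_coeff Psi Eta f i1 k1 i2 k2)) A"
    (is "lq_norm_le q ?J ?a A")
  proof (rule lq_norm_le_single[OF q])
    show "(j1, j2) \<in> ?J" using j by simp
    show "?a i = 0" if "i \<in> ?J" "i \<noteq> (j1, j2)" for i
    proof -
      obtain i1 i2 where i: "i = (i1, i2)" by (cases i)
      hence "lp_norm p (locations m1 i1 \<times> locations m2 i2) (\<lambda>k. if j1 = i1 \<and> j2 = i2 \<and> k \<in> E then \<gamma> else 0) = 0"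
        using that lp_norm_zero[OF fin ne, of p i1 i2] by (auto cong: if_cong)
      thus ?thesis using that i lp by simp
    qed
    have "lp_norm p (locations m1 j1 \<times> locations m2 j2) (\<lambda>k. if k \<in> E then \<gamma> else 0) \<le> \<gamma> * real (card K) powr recip p"
      by (rule lp_norm_two_valued_le[OF p Kfin K(2) E fin _ \<gamma>]) (use K loc in blast)
    hence "2 powr (real j1 * s_star s1 p + real j2 * s_star s2 p) *
        lp_norm p (locations m1 j1 \<times> locations m2 j2) (\<lambda>k. if k \<in> E then \<gamma> else 0) \<le> A"
      using size by (meson mult_left_mono order_trans powr_ge_zero)
    moreover have "0 \<le> lp_norm p (locations m1 j1 \<times> locations m2 j2) (\<lambda>k. if k \<in> E then \<gamma> else 0)"
    proof (cases "p = \<infinity>")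
      case True
      obtain k where "k \<in> locations m1 j1 \<times> locations m2 j2" using ne by blast
      hence "\<bar>if k \<in> E then \<gamma> else 0\<bar> \<le> Max ((\<lambda>k. \<bar>if k \<in> E then \<gamma> else 0\<bar>) ` (locations m1 j1 \<times> locations m2 j2))"
        by (intro Max_ge finite_imageI fin imageI)
      thus ?thesis using True order_trans[OF abs_ge_zero] by (simp add: lp_norm_def)
    qed (simp add: lp_norm_def)
    ultimately show "\<bar>?a (j1, j2)\<bar> \<le> A" using lp[OF j] by (simp add: abs_mult)
    have "0 \<le> 2 powr (real j1 * s_star s1 p + real j2 * s_star s2 p) * (\<gamma> * real (card K) powr recip p)"
      using \<gamma> by simp
    thus "0 \<le> A" using size by linarith
  qed
  hence "f \<in> besov_ball Psi m1 Eta m2 p q s1 s2 A"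
    using L2 by (simp add: besov_ball_def)
  thus ?thesis using reg by (simp add: f_def[abs_def])
qed

text \<open>The blur acts in \<open>t\<close> at fixed \<open>x\<close>, so the factor in
  \<open>x\<close> leaves the integral. The kernel is integrable and the wavelet bounded, so the sum
  may be integrated termwise.\<close>

lemma convolve_tensor_sum:
  assumes g: "admissible_kernel g" and t: "t \<in> {0..1}" and x: "x \<in> {0..1}"
  shows "convolve (\<lambda>z. \<Sum>k\<in>E. \<gamma> * tensor j1 j2 k z) g t x =
    (\<Sum>k\<in>E. \<gamma> * (Eta j2 (snd k) x *
       (LINT s:{0..1}|lborel. Psi j1 (fst k) s * g (t - s, x))))"
proof -
  have gi: "integrable unit_measure (\<lambda>s. g (t - s, x))"
    using integral_reflect_periodic(1)[of "\<lambda>u. g (u, x)" t] g t x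
    by (simp add: admissible_kernel_def integrable_unit_iff)
  have int: "integrable unit_measure (\<lambda>s. Psi j1 k s * g (t - s, x))" for k
  proof -
    have c: "continuous_on {0..1} (Psi j1 k)"
      by (rule continuous_on_subset[OF periodic_wavelet_continuous[OF decay(1,2)]]) simp
    have "bounded (Psi j1 k ` {0..1})"
      by (intro compact_imp_bounded compact_continuous_image c) simp
    then obtain C where C: "\<forall>y\<in>Psi j1 k ` {0..1}. \<bar>y\<bar> \<le> C"
      unfolding bounded_iff real_norm_def by blast
    show ?thesis
    proof (rule Bochner_Integration.integrable_bound)
      show "integrable unit_measure (\<lambda>s. C * g (t - s, x))" using gi by simp
      show "(\<lambda>s. Psi j1 k s * g (t - s, x)) \<in> borel_measurable unit_measure"
        by (intro borel_measurable_times borel_measurable_integrable[OF gi]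
            borel_measurable_integrable[OF integrable_unit_continuous[OF c]])
      show "AE s in unit_measure. norm (Psi j1 k s * g (t - s, x)) \<le> norm (C * g (t - s, x))"
      proof (rule AE_I2)
        fix s assume "s \<in> space unit_measure"
        hence "\<bar>Psi j1 k s\<bar> \<le> \<bar>C\<bar>"
          using C by (force simp: space_restrict_space)
        thus "norm (Psi j1 k s * g (t - s, x)) \<le> norm (C * g (t - s, x))"
          by (simp add: abs_mult mult_right_mono)
      qed
    qed
  qed
  have "convolve (\<lambda>z. \<Sum>k\<in>E. \<gamma> * tensor j1 j2 k z) g t x =
      (\<integral>s. (\<Sum>k\<in>E. \<gamma> * (Eta j2 (snd k) x *
         (Psi j1 (fst k) s * g (t - s, x)))) \<partial>unit_measure)"
    unfolding convolve_def integral_unit_eq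
    by (intro Bochner_Integration.integral_cong refl) (simp add: tensor_def sum_distrib_left sum_distrib_right mult_ac)
  also have "\<dots> = (\<Sum>k\<in>E. \<gamma> * (Eta j2 (snd k) x *
       (\<integral>s. Psi j1 (fst k) s * g (t - s, x) \<partial>unit_measure)))"
    by (subst Bochner_Integration.integral_sum) (auto intro!: integrable_mult_right int)
  finally show ?thesis by (simp only: integral_unit_eq)
qed

end

section \<open>The lower bound\<close>

context tensor_wavelets
begin

text \<open>
  The sum over the locations is bounded at every single point \<open>(t, x)\<close>, so the design plays no role.
\<close>

lemma tensor_energy_le:
  assumes C1: "\<And>t x. t \<in> {0..1} \<Longrightarrow> x \<in> {0..1} \<Longrightarrow>
      (\<Sum>k<2^j1. (LINT s:{0..1}|lborel. Psi j1 k s * g (t - s, x))\<^sup>2) \<le> D1"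
    and C2: "\<And>x. (\<Sum>k<2^j2. (periodize (dyadic \<eta> j2 (int k)) x)\<^sup>2) \<le> D2"
    and v: "\<And>k i l. v k i l = Eta j2 (snd k) (real l / real M) *
       (LINT s:{0..1}|lborel. Psi j1 (fst k) s * g (real i / real N - s, real l / real M))"
  shows "(\<Sum>k\<in>{..<2^j1} \<times> {..<2^j2}. \<Sum>l\<in>{1..M}. \<Sum>i\<in>{1..N}. (v k i l)\<^sup>2) \<le> real M * real N * (D1 * D2)"
proof -
  have "(\<Sum>k\<in>{..<2^j1} \<times> {..<2^j2}. \<Sum>l\<in>{1..M}. \<Sum>i\<in>{1..N}. (v k i l)\<^sup>2) =
      (\<Sum>l\<in>{1..M}. \<Sum>k\<in>{..<2^j1} \<times> {..<2^j2}. \<Sum>i\<in>{1..N}. (v k i l)\<^sup>2)"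
    by (rule sum.swap)
  also have "\<dots> = (\<Sum>l\<in>{1..M}. \<Sum>i\<in>{1..N}. \<Sum>k\<in>{..<2^j1} \<times> {..<2^j2}. (v k i l)\<^sup>2)"
    by (intro sum.cong refl sum.swap)
  also have "\<dots> \<le> (\<Sum>l\<in>{1..M}. \<Sum>i\<in>{1..N}. D1 * D2)"
  proof (intro sum_mono)
    fix l i assume l: "l \<in> {1..M}" and i: "i \<in> {1..N}"
    define I where "I k = (LINT s:{0..1}|lborel. Psi j1 k s * g (real i / real N - s, real l / real M))" for k
    define h where "h k = periodize (dyadic \<eta> j2 (int k)) (real l / real M)" for k :: nat
    have "real i / real N \<in> {0..1}" "real l / real M \<in> {0..1}" using i l by (auto simp: divide_simps)
    hence I: "(\<Sum>k<2^j1. (I k)\<^sup>2) \<le> D1" unfolding I_def by (rule C1)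
    have h: "(\<Sum>k<2^j2. (h k)\<^sup>2) \<le> D2" unfolding h_def by (rule C2)
    \<comment> \<open>By the tensor structure the sum over pairs splits into a factor in
      \<open>t\<close> and a factor in \<open>x\<close>, each bounded at the given point.\<close>
    have "(\<Sum>k\<in>{..<2^j1} \<times> {..<2^j2}. (v k i l)\<^sup>2) = (\<Sum>k\<in>{..<2^j1} \<times> {..<2^j2}. (I (fst k))\<^sup>2 * (h (snd k))\<^sup>2)"
      by (intro sum.cong refl) (auto simp: v I_def h_def periodic_wavelet_def power_mult_distrib)
    also have "\<dots> = (\<Sum>k<2^j1. (I k)\<^sup>2) * (\<Sum>k<2^j2. (h k)\<^sup>2)"
      by (simp add: sum_product sum.cartesian_product split_def)
    also have "\<dots> \<le> D1 * D2"
    proof (rule mult_mono[OF I h])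
      show "0 \<le> D1" by (rule order_trans[OF sum_nonneg I]) simp
    qed (simp add: sum_nonneg)
    finally show "(\<Sum>k\<in>{..<2^j1} \<times> {..<2^j2}. (v k i l)\<^sup>2) \<le> D1 * D2" .
  qed
  also have "\<dots> = real M * real N * (D1 * D2)" by simp
  finally show ?thesis .
qed

text \<open>The hypothesis \<open>energy\<close> makes the scaled energies \<open>b * e k\<close>
  average at most 1/2 over the 2^(j1+j2) locations. Using all of them therefore keeps half of the
  factor \<gamma>^2/8, hence the 16. Keeping a single location loses the factor 2^(j1+j2) but
  weakens the size condition.\<close>

lemma minimax_risk_tensor:
  fixes \<xi> :: "nat \<Rightarrow> nat \<Rightarrow> 'w \<Rightarrow> real"
  assumes P: "prob_space P" and MN: "1 \<le> M" "1 \<le> N" and \<sigma>: "0 < \<sigma>"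
    and gauss: "\<And>l. l \<in> {1..M} \<Longrightarrow> gaussian_vector P N (\<lambda>i. \<xi> i l) (cov_matrix P N (\<lambda>i. \<xi> i l))"
    and indep: "prob_space.indep_vars P (\<lambda>_. PiM {1..N} (\<lambda>_. borel)) (\<lambda>l \<omega>. \<lambda>i\<in>{1..N}. \<xi> i l \<omega>) {1..M}"
    and L: "0 < L" "\<And>l. l \<in> {1..M} \<Longrightarrow> L \<le> lambda_min (cov_matrix P N (\<lambda>i. \<xi> i l))"
    and g: "admissible_kernel g"
    and C1: "\<And>t x. t \<in> {0..1} \<Longrightarrow> x \<in> {0..1} \<Longrightarrow>
      (\<Sum>k<2^j1. (LINT s:{0..1}|lborel. Psi j1 k s * g (t - s, x))\<^sup>2) \<le> D1"
    and C2: "\<And>x. (\<Sum>k<2^j2. (periodize (dyadic \<eta> j2 (int k)) x)\<^sup>2) \<le> D2"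
    and j: "m1 \<le> j1" "m2 \<le> j2" and p: "1 \<le> p" and q: "1 \<le> q" and \<gamma>: "0 \<le> \<gamma>"
    and energy: "\<gamma>\<^sup>2 * (real M * real N * (D1 * D2)) \<le> 2 * (\<sigma>\<^sup>2 * L) * 2 ^ (j1 + j2)"
  shows
    "2 powr (real j1 * s_star s1 p + real j2 * s_star s2 p) * (\<gamma> * (2 ^ (j1 + j2)) powr recip p) \<le> A \<Longrightarrow>
      ennreal (2 ^ (j1 + j2) * \<gamma>\<^sup>2 / 16) \<le> minimax_risk P \<xi> g \<sigma> M N
        (besov_ball Psi m1 Eta m2 p q s1 s2 A \<inter> regression_functions)"
      (is "?dense \<Longrightarrow> ennreal ?d \<le> ?risk")
    and "2 powr (real j1 * s_star s1 p + real j2 * s_star s2 p) * \<gamma> \<le> A \<Longrightarrow>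
      ennreal (\<gamma>\<^sup>2 / 16) \<le> minimax_risk P \<xi> g \<sigma> M N
        (besov_ball Psi m1 Eta m2 p q s1 s2 A \<inter> regression_functions)"
      (is "?sparse \<Longrightarrow> ?S")
proof -
  let ?full = "{..<2^j1} \<times> {..<2^j2} :: (nat \<times> nat) set"
  define v where "v k i l = Eta j2 (snd k) (real l / real M) *
       (LINT s:{0..1}|lborel. Psi j1 (fst k) s * g (real i / real N - s, real l / real M))"
    for k and i l :: nat
  define e where "e k = (\<Sum>l\<in>{1..M}. \<Sum>i\<in>{1..N}. (v k i l)\<^sup>2)" for k
  define b where "b = \<gamma>\<^sup>2 / (4 * \<sigma>\<^sup>2 * L)"
  have b: "0 \<le> b" using L \<sigma> by (simp add: b_def)
  have card_full: "real (card ?full) = 2 ^ (j1 + j2)" by (simp add: card_cartesian_product power_add)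
  have full_ne: "?full \<noteq> {}" by (simp add: lessThan_empty_iff)
  have e_sum: "b * (\<Sum>k\<in>?full. e k) \<le> 2 ^ (j1 + j2) / 2"
  proof -
    have "b * (\<Sum>k\<in>?full. e k) \<le> b * (real M * real N * (D1 * D2))"
      unfolding e_def by (intro mult_left_mono b tensor_energy_le[where g = g] C1 C2 v_def)
    also have "\<dots> \<le> 2 ^ (j1 + j2) / 2"
      using energy L \<sigma> unfolding b_def by (simp add: field_simps)
    finally show ?thesis .
  qed
  have main: "ennreal (\<Sum>k\<in>K. \<gamma>\<^sup>2 / 8 * (1 - b * e k)) \<le> ?risk"
    if K: "K \<subseteq> ?full" "K \<noteq> {}" and
      size: "2 powr (real j1 * s_star s1 p + real j2 * s_star s2 p) * (\<gamma> * real (card K) powr recip p) \<le> A" for K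
    unfolding b_def e_def
  proof (rule minimax_risk_assouad[where u = "tensor j1 j2", OF P MN \<sigma> gauss indep L _ \<gamma>])
    have loc: "k \<in> locations m1 j1 \<times> locations m2 j2" if "k \<in> K" for k
      using K that by (force simp: locations_def)
    show "finite K" by (rule finite_subset[OF K(1)]) simp
    show "tensor j1 j2 k \<in> borel_measurable borel" for k
      by (rule borel_measurable_continuous_onI[OF continuous_tensor])
    show "integrable (square_measure) (\<lambda>z. (tensor j1 j2 k z)\<^sup>2)" for k
      by (intro integrable_square_continuous continuous_intros continuous_tensor)
    show "(\<integral>z. tensor j1 j2 k z * tensor j1 j2 k' z \<partial>square_measure) = (if k = k' then 1 else 0)"
      if "k \<in> K" "k' \<in> K" for k k'
      using tensor_orthonormal[OF j(1) j(1) j(2) j(2) loc[OF that(1)] loc[OF that(2)]] by simp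
    show "(\<lambda>z. \<Sum>k\<in>E. \<gamma> * tensor j1 j2 k z) \<in>
        besov_ball Psi m1 Eta m2 p q s1 s2 A \<inter> regression_functions"
      if "E \<subseteq> K" for E
      by (rule tensor_sum_in_besov_ball[OF j K that p q \<gamma> size])
    show "convolve (\<lambda>z. \<Sum>k\<in>E. \<gamma> * tensor j1 j2 k z) g (real i / real N) (real l / real M) = (\<Sum>k\<in>E. \<gamma> * v k i l)"
      if "i \<in> {1..N}" "l \<in> {1..M}" for E i l
      unfolding v_def using that by (intro convolve_tensor_sum g) (auto simp: divide_simps)
  qed
  show "ennreal ?d \<le> ?risk" if ?dense
  proof -
    have "2 ^ (j1 + j2) * \<gamma>\<^sup>2 / 16 = \<gamma>\<^sup>2 / 8 * (2 ^ (j1 + j2) - 2 ^ (j1 + j2) / 2)" by simp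
    also have "\<dots> \<le> \<gamma>\<^sup>2 / 8 * (real (card ?full) - b * (\<Sum>k\<in>?full. e k))"
      unfolding card_full by (intro mult_left_mono diff_mono e_sum) auto
    also have "\<dots> = (\<Sum>k\<in>?full. \<gamma>\<^sup>2 / 8 * (1 - b * e k))"
      unfolding sum_distrib_left[symmetric] sum_subtractf by simp
    finally have "ennreal (2 ^ (j1 + j2) * \<gamma>\<^sup>2 / 16) \<le> ennreal (\<Sum>k\<in>?full. \<gamma>\<^sup>2 / 8 * (1 - b * e k))"
      by (rule ennreal_leI)
    also have "\<dots> \<le> ?risk" using that by (intro main full_ne) (simp_all only: card_full order_refl)
    finally show ?thesis .
  qed
  show ?S if ?sparse
  proof -
    \<comment> \<open>Not all locations exceed the average. The choice of \<open>k\<close> may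
      depend on the design; the resulting bound does not.\<close>
    have "\<exists>k\<in>?full. b * e k \<le> 1 / 2"
    proof (rule ccontr)
      assume "\<not> ?thesis"
      hence *: "1 / 2 < b * e k" if "k \<in> ?full" for k using that not_le by blast
      have "(\<Sum>k\<in>?full. 1 / 2) < (\<Sum>k\<in>?full. b * e k)"
        by (intro sum_strict_mono * full_ne) simp
      thus False using e_sum card_full by (simp add: sum_distrib_left)
    qed
    then obtain k where k: "k \<in> ?full" "b * e k \<le> 1 / 2" by blast
    have "\<gamma>\<^sup>2 / 16 = \<gamma>\<^sup>2 / 8 * (1 - 1 / 2)" by simp
    also have "\<dots> \<le> \<gamma>\<^sup>2 / 8 * (1 - b * e k)" using k by (intro mult_left_mono) auto
    finally have "ennreal (\<gamma>\<^sup>2 / 16) \<le> ennreal (\<Sum>k\<in>{k}. \<gamma>\<^sup>2 / 8 * (1 - b * e k))"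
      by (intro ennreal_leI) simp
    also have "\<dots> \<le> ?risk" using that k by (intro main) auto
    finally show ?S .
  qed
qed

end

text \<open>The level m + ceil(log R / \<Delta>), with logarithm to base 2, exceeds the ideal real
  level by at most m + 1. This costs the factor 2^(-\<theta> (m + 1)), which is independent of
  \<open>R\<close>. The summand \<open>m\<close> secures the lowest resolution.\<close>

lemma dyadic_level:
  assumes R: "1 \<le> R" and \<Delta>: "0 < \<Delta>" and \<theta>: "0 \<le> \<theta>"
  obtains j where "m \<le> j" "R \<le> 2 powr (\<Delta> * real j)"
    "2 powr (- (\<theta> * (real m + 1))) * R powr (- (\<theta> / \<Delta>)) \<le> 2 powr (- (\<theta> * real j))"
proof -
  define y where "y = log 2 R / \<Delta>"
  have y: "0 \<le> y" using R \<Delta> by (simp add: y_def)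
  define n where "n = nat \<lceil>y\<rceil>"
  have n: "y \<le> real n" "real n \<le> y + 1" using y by (simp_all add: n_def)
  have R2: "R powr x = 2 powr (x * log 2 R)" for x using R by (simp add: powr_def log_def)
  have "log 2 R \<le> \<Delta> * real n" using n(1) \<Delta> by (simp add: y_def field_simps)
  also have "\<dots> \<le> \<Delta> * real (m + n)" using \<Delta> by simp
  finally have "R powr 1 \<le> 2 powr (\<Delta> * real (m + n))" unfolding R2 by simp
  hence 1: "R \<le> 2 powr (\<Delta> * real (m + n))" using R by simp
  have "\<theta> * real n \<le> \<theta> * (y + 1)" using n(2) \<theta> by (rule mult_left_mono)
  hence "- (\<theta> * (real m + 1)) + - (\<theta> / \<Delta>) * log 2 R \<le> - (\<theta> * real (m + n))"
    by (simp add: y_def algebra_simps)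
  hence "2 powr (- (\<theta> * (real m + 1))) * R powr (- (\<theta> / \<Delta>)) \<le> 2 powr (- (\<theta> * real (m + n)))"
    unfolding R2 powr_add[symmetric] by simp
  with 1 show ?thesis using that[of "m + n"] by simp
qed

text \<open>One constant serves both constraints on an amplitude: \<open>A / B\<close> for the Besov
  ball, \<open>1 / (D + 1)\<close> for the energy.\<close>

lemma small_amplitude:
  assumes "0 \<le> D" "0 < (B::real)" "0 < A"
  obtains c where "0 < c" "c\<^sup>2 * D \<le> 2" "B * c \<le> A"
proof -
  define c where "c = min (A / B) (1 / (D + 1))"
  have c: "0 < c" using assms by (simp add: c_def)
  have "c\<^sup>2 \<le> (1 / (D + 1))\<^sup>2" using c by (intro power_mono) (auto simp: c_def)
  hence "c\<^sup>2 * D \<le> (1 / (D + 1))\<^sup>2 * D" using assms(1) by (rule mult_right_mono)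
  also have "\<dots> \<le> 2" using assms(1) by (simp add: divide_simps power2_eq_square algebra_simps)
  finally have "c\<^sup>2 * D \<le> 2" .
  moreover have "B * c \<le> B * (A / B)" using assms by (intro mult_left_mono) (auto simp: c_def)
  ultimately show ?thesis using c assms that[of c] by simp
qed

theorem theorem1:
  fixes P :: "'w measure"
    and \<xi> :: "nat \<Rightarrow> nat \<Rightarrow> nat \<Rightarrow> nat \<Rightarrow> 'w \<Rightarrow> real"
    and g :: "real \<times> real \<Rightarrow> real"
    and \<phi> \<psi> \<phi>' \<eta> :: "real \<Rightarrow> real"
    and m1 m2 :: nat
    and \<alpha> :: "nat \<Rightarrow> nat \<Rightarrow> real"
    and \<sigma> c1 c2 \<nu> K1 K2 A s1 s2 so :: real
    and p q :: ereal
  assumes "prob_space P"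
    and "\<sigma> > 0"
    and gaussian: "\<And>M N l. 1 \<le> N \<Longrightarrow> l \<in> {1..M} \<Longrightarrow>
          gaussian_vector P N (\<lambda>i. \<xi> M N i l) (cov_matrix P N (\<lambda>i. \<xi> M N i l))"
    and indep: "\<And>M N. 1 \<le> M \<Longrightarrow> 1 \<le> N \<Longrightarrow>
          prob_space.indep_vars P (\<lambda>_. PiM {1..N} (\<lambda>_. borel))
            (\<lambda>l \<omega>. \<lambda>i\<in>{1..N}. \<xi> M N i l \<omega>) {1..M}"
    and "0 < c1" and "c1 \<le> c2"
    and long_memory_param: "\<And>M l. l \<in> {1..M} \<Longrightarrow> 0 < \<alpha> M l \<and> \<alpha> M l \<le> 1"
    and long_memory: "\<And>M N l. 1 \<le> N \<Longrightarrow> l \<in> {1..M} \<Longrightarrow>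
          c1 * real N powr (1 - \<alpha> M l) \<le> lambda_min (cov_matrix P N (\<lambda>i. \<xi> M N i l)) \<and>
          lambda_min (cov_matrix P N (\<lambda>i. \<xi> M N i l)) \<le> lambda_max (cov_matrix P N (\<lambda>i. \<xi> M N i l)) \<and>
          lambda_max (cov_matrix P N (\<lambda>i. \<xi> M N i l)) \<le> c2 * real N powr (1 - \<alpha> M l)"
    and "admissible_kernel g"
    and "\<nu> > 0" and "K1 > 0" and "K2 > 0"
    and kernel: "\<And>n x. n \<noteq> 0 \<Longrightarrow> x \<in> {0..1} \<Longrightarrow>
          K1 * \<bar>2 * pi * of_int n\<bar> powr (- 2 * \<nu>) \<le> (cmod (kernel_coeff g n x))\<^sup>2 \<and>
          (cmod (kernel_coeff g n x))\<^sup>2 \<le> K2 * \<bar>2 * pi * of_int n\<bar> powr (- 2 * \<nu>)"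
    and "periodized_wavelet_basis \<phi> \<psi> m1" and "meyer_type \<phi> \<psi>"
    and "periodized_wavelet_basis \<phi>' \<eta> m2" and "daubechies_type so \<phi>' \<eta>" and "so \<ge> s2"
    and "1 \<le> p" and "1 \<le> q" and "A > 0"
    and "min s1 s2 \<ge> max (recip p) (1/2)"
  shows "\<exists>C>0. \<forall>\<^sub>F (M, N) in sequentially \<times>\<^sub>F sequentially.
     (let \<alpha>_star = Max (\<alpha> M ` {1..M});
          \<rho> = \<sigma>\<^sup>2 / (A\<^sup>2 * real M * real N powr \<alpha>_star);
          rate = (if s1 > s2 * (2 * \<nu> + 1)
                    then \<rho> powr (2 * s2 / (2 * s2 + 1))
                  else if (2 * \<nu> + 1) * (recip p - 1/2) \<le> s1
                    then \<rho> powr (2 * s1 / (2 * s1 + 2 * \<nu> + 1))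
                  else \<rho> powr (2 * s_star s1 p / (2 * s_star s1 p + 2 * \<nu>)))
      in ennreal (C * A\<^sup>2 * rate)
           \<le> minimax_risk P (\<xi> M N) g \<sigma> M N
               (besov_ball (periodic_wavelet \<phi> \<psi>) m1 (periodic_wavelet \<phi>' \<eta>) m2 p q s1 s2 A
                  \<inter> regression_functions))"
proof -
  interpret W: tensor_wavelets \<phi> \<psi> \<phi>' \<eta> m1 m2
    by unfold_locales
       (use assms meyer_type_quadratic_decay[OF \<open>meyer_type \<phi> \<psi>\<close>]
          daubechies_type_quadratic_decay[OF \<open>daubechies_type so \<phi>' \<eta>\<close>] in auto)
  obtain C1 where C1: "0 \<le> C1" "\<And>j t x. m1 \<le> j \<Longrightarrow> t \<in> {0..1} \<Longrightarrow> x \<in> {0..1} \<Longrightarrow>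
      (\<Sum>k<2^j. (LINT s:{0..1}|lborel. periodic_wavelet \<phi> \<psi> j k s * g (t - s, x))\<^sup>2) \<le>
      C1 * 2 ^ j * (2 ^ j) powr (- 2 * \<nu>)"
    using meyer_blurred_energy[OF \<open>admissible_kernel g\<close> \<open>\<nu> > 0\<close> \<open>K2 > 0\<close> conjunct2[OF kernel] \<open>periodized_wavelet_basis \<phi> \<psi> m1\<close> \<open>meyer_type \<phi> \<psi>\<close>]
    by blast
  obtain C2 where C2: "0 \<le> C2" "\<And>j x. (\<Sum>k<2^j. (periodize (dyadic \<eta> j (int k)) x)\<^sup>2) \<le> C2 * 2 ^ j"
    using sum_periodize_dyadic_squared_le[OF W.decay(4)] by blast
  \<comment> \<open>Collects the constants: the energy condition becomes \<gamma>^2 D R 2^(-2 \<nu>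
    j1) <= 2, since the factors 2^(j1+j2) on its two sides cancel and N / N^(1-a) = N^a.\<close>
  define D where "D = C1 * C2 / (\<sigma>\<^sup>2 * c1)"
  have D: "0 \<le> D" using C1(1) C2(1) \<open>0 < c1\<close> by (simp add: D_def)
  \<comment> \<open>The effective sample size, the reciprocal of the quantity \<rho> up to the
    factor \<sigma>^2/A^2.\<close>
  define R where "R M N = real M * real N powr Max (\<alpha> M ` {1..M})" for M N
  define risk where "risk M N = minimax_risk P (\<xi> M N) g \<sigma> M N
     (besov_ball (periodic_wavelet \<phi> \<psi>) m1 (periodic_wavelet \<phi>' \<eta>) m2 p q s1 s2 A \<inter> regression_functions)" for M N
  have s: "1 / 2 \<le> s1" "1 / 2 \<le> s2" "recip p \<le> s1" "recip p \<le> s2" using \<open>min s1 s2 \<ge> max (recip p) (1/2)\<close> by auto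
  have star_nonneg: "0 \<le> Max (\<alpha> M ` {1..M})" if "1 \<le> M" for M
  proof -
    have "Max (\<alpha> M ` {1..M}) \<in> \<alpha> M ` {1..M}" using that by (intro Max_in) auto
    thus ?thesis using long_memory_param by (auto intro: less_imp_le)
  qed
  have R1: "1 \<le> R M N" if "1 \<le> M" "1 \<le> N" for M N
  proof -
    have "1 * 1 \<le> real M * real N powr Max (\<alpha> M ` {1..M})"
      using that star_nonneg by (intro mult_mono ge_one_powr_ge_zero) auto
    thus ?thesis by (simp add: R_def)
  qed
  have low:
    "2 powr (real j1 * (s1 + 1/2) + real j2 * (s2 + 1/2)) * \<gamma> \<le> A \<Longrightarrow>
       ennreal (2 powr (real j1 + real j2) * \<gamma>\<^sup>2 / 16) \<le> risk M N"
    "2 powr (real j1 * s_star s1 p + real j2 * s_star s2 p) * \<gamma> \<le> A \<Longrightarrow> ennreal (\<gamma>\<^sup>2 / 16) \<le> risk M N"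
    if MN: "1 \<le> M" "1 \<le> N" and j: "m1 \<le> j1" "m2 \<le> j2" and \<gamma>: "0 \<le> \<gamma>"
      and energy: "\<gamma>\<^sup>2 * D * R M N * 2 powr (- (2 * \<nu> * real j1)) \<le> 2" for M N j1 j2 \<gamma>
  proof -
    define a where "a = Max (\<alpha> M ` {1..M})"
    \<comment> \<open>As N >= 1, the power N^(1-\<alpha>) decreases in \<alpha>. The largest
      parameter thus gives a lower eigenvalue bound valid for all rows.\<close>
    define L where "L = c1 * real N powr (1 - a)"
    have L: "0 < L" using \<open>0 < c1\<close> MN by (simp add: L_def)
    have Ll: "L \<le> lambda_min (cov_matrix P N (\<lambda>i. \<xi> M N i l))" if l: "l \<in> {1..M}" for l
    proof -
      have "\<alpha> M l \<le> a" unfolding a_def using l by (intro Max_ge) auto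
      hence "L \<le> c1 * real N powr (1 - \<alpha> M l)"
        unfolding L_def using MN \<open>0 < c1\<close> by (intro mult_left_mono powr_mono) auto
      thus ?thesis using long_memory[OF MN(2) l] by linarith
    qed
    have j1: "(2 ^ j1) powr (- 2 * \<nu>) = 2 powr (- (2 * \<nu> * real j1))"
      by (simp add: powr_powr flip: powr_realpow) (simp add: mult_ac)
    have N: "real N = real N powr (1 - a) * real N powr a"
      using MN by (simp flip: powr_add)
    have "\<gamma>\<^sup>2 * (real M * real N * ((C1 * 2 ^ j1 * (2 ^ j1) powr (- 2 * \<nu>)) * (C2 * 2 ^ j2))) =
        (\<gamma>\<^sup>2 * D * R M N * 2 powr (- (2 * \<nu> * real j1))) * ((\<sigma>\<^sup>2 * L) * 2 ^ (j1 + j2))"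
      unfolding j1 using \<open>0 < \<sigma>\<close> \<open>0 < c1\<close>
      by (subst N) (simp add: D_def R_def L_def a_def power_add field_simps)
    also have "\<dots> \<le> 2 * ((\<sigma>\<^sup>2 * L) * 2 ^ (j1 + j2))"
      using energy L \<open>0 < \<sigma>\<close> by (intro mult_right_mono) auto
    finally have en: "\<gamma>\<^sup>2 * (real M * real N * ((C1 * 2 ^ j1 * (2 ^ j1) powr (- 2 * \<nu>)) * (C2 * 2 ^ j2))) \<le>
        2 * (\<sigma>\<^sup>2 * L) * 2 ^ (j1 + j2)" by simp
    note bound = W.minimax_risk_tensor[OF \<open>prob_space P\<close> MN \<open>0 < \<sigma>\<close> gaussian[OF MN(2)] indep[OF MN] L Ll
        \<open>admissible_kernel g\<close> C1(2)[OF j(1)] C2(2) j \<open>1 \<le> p\<close> \<open>1 \<le> q\<close> \<gamma> en, where ?s1.0 = s1 and ?s2.0 = s2 and A = A]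
    have pow: "2 ^ (j1 + j2) = 2 powr (real j1 + real j2)" by (simp add: powr_add powr_realpow power_add)
    \<comment> \<open>With all locations in use the norm adds 1/p to each \<open>s_star\<close>, so
      p cancels and s + 1/2 remains. This is why p does not occur in the first two
      exponents.\<close>
    have "2 powr (real j1 * s_star s1 p + real j2 * s_star s2 p) * (\<gamma> * (2 ^ (j1 + j2)) powr recip p) =
        2 powr (real j1 * (s1 + 1/2) + real j2 * (s2 + 1/2)) * \<gamma>"
    proof -
      have "2 powr (real j1 * s_star s1 p + real j2 * s_star s2 p) * (2 ^ (j1 + j2)) powr recip p =
          2 powr (real j1 * (s1 + 1/2) + real j2 * (s2 + 1/2))"
        unfolding pow powr_powr powr_add[symmetric]
        by (rule arg_cong[where f = "\<lambda>x. 2 powr x"]) (simp add: s_star_def algebra_simps)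
      thus ?thesis by (simp add: mult_ac)
    qed
    with bound(1) show "2 powr (real j1 * (s1 + 1/2) + real j2 * (s2 + 1/2)) * \<gamma> \<le> A \<Longrightarrow>
        ennreal (2 powr (real j1 + real j2) * \<gamma>\<^sup>2 / 16) \<le> risk M N"
      unfolding risk_def pow by simp
    from bound(2) show "2 powr (real j1 * s_star s1 p + real j2 * s_star s2 p) * \<gamma> \<le> A \<Longrightarrow>
        ennreal (\<gamma>\<^sup>2 / 16) \<le> risk M N"
      unfolding risk_def by simp
  qed
  have rho: "\<sigma>\<^sup>2 / (A\<^sup>2 * real M * real N powr Max (\<alpha> M ` {1..M})) = \<sigma>\<^sup>2 / A\<^sup>2 / R M N" for M N
    by (simp add: R_def mult.assoc)
  \<comment> \<open>The step common to the three regimes: a risk of at least w 2^(-\<theta> j) on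
    every level with R <= 2^(\<Delta> j) yields the exponent \<theta>/\<Delta>.\<close>
  have rate: "\<exists>C>0. \<forall>M N. 1 \<le> M \<longrightarrow> 1 \<le> N \<longrightarrow>
      ennreal (C * A\<^sup>2 * (\<sigma>\<^sup>2 / A\<^sup>2 / R M N) powr (\<theta> / \<Delta>)) \<le> risk M N"
    if \<Delta>: "0 < \<Delta>" and \<theta>: "0 \<le> \<theta>" and w: "0 < w" and
      level: "\<And>M N j. 1 \<le> M \<Longrightarrow> 1 \<le> N \<Longrightarrow> m \<le> j \<Longrightarrow> R M N \<le> 2 powr (\<Delta> * real j) \<Longrightarrow>
        ennreal (w * 2 powr (- (\<theta> * real j))) \<le> risk M N" for \<Delta> \<theta> w m
  proof -
    \<comment> \<open>Converts powers of \<open>R\<close> into powers of \<rho>; \<sigma> and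
      \<open>A\<close> are fixed, so it may be absorbed into \<open>C\<close>.\<close>
    define B where "B = A\<^sup>2 * (\<sigma>\<^sup>2 / A\<^sup>2) powr (\<theta> / \<Delta>)"
    have B: "0 < B" using \<open>0 < A\<close> \<open>0 < \<sigma>\<close> by (simp add: B_def)
    define C where "C = w * 2 powr (- (\<theta> * (real m + 1))) / B"
    have "ennreal (C * A\<^sup>2 * (\<sigma>\<^sup>2 / A\<^sup>2 / R M N) powr (\<theta> / \<Delta>)) \<le> risk M N"
      if MN: "1 \<le> M" "1 \<le> N" for M N
    proof -
      obtain j where j: "m \<le> j" "R M N \<le> 2 powr (\<Delta> * real j)"
        "2 powr (- (\<theta> * (real m + 1))) * R M N powr (- (\<theta> / \<Delta>)) \<le> 2 powr (- (\<theta> * real j))"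
        using dyadic_level[OF R1[OF MN] \<Delta> \<theta>] by blast
      have "(\<sigma>\<^sup>2 / A\<^sup>2 / R M N) powr (\<theta> / \<Delta>) =
          (\<sigma>\<^sup>2 / A\<^sup>2) powr (\<theta> / \<Delta>) * R M N powr (- (\<theta> / \<Delta>))"
        using R1[OF MN] by (simp add: powr_divide powr_mult powr_minus_divide)
      hence "C * A\<^sup>2 * (\<sigma>\<^sup>2 / A\<^sup>2 / R M N) powr (\<theta> / \<Delta>) =
          C * B * R M N powr (- (\<theta> / \<Delta>))" by (simp add: B_def)
      also have "\<dots> = w * (2 powr (- (\<theta> * (real m + 1))) * R M N powr (- (\<theta> / \<Delta>)))"
        using B by (simp add: C_def)
      also have "\<dots> \<le> w * 2 powr (- (\<theta> * real j))" using j(3) w by (intro mult_left_mono) auto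
      finally have "ennreal (C * A\<^sup>2 * (\<sigma>\<^sup>2 / A\<^sup>2 / R M N) powr (\<theta> / \<Delta>)) \<le>
          ennreal (w * 2 powr (- (\<theta> * real j)))" by (rule ennreal_leI)
      also have "\<dots> \<le> risk M N" by (rule level[OF MN j(1,2)])
      finally show ?thesis .
    qed
    moreover have "0 < C" using w B by (simp add: C_def)
    ultimately show ?thesis by blast
  qed
  have absorb: "\<gamma>\<^sup>2 * D * r * y \<le> 2" if "\<gamma>\<^sup>2 * y = c\<^sup>2 * z" "r * z \<le> 1" "c\<^sup>2 * D \<le> 2" for \<gamma> r y c z :: real
  proof -
    have "\<gamma>\<^sup>2 * D * r * y = (c\<^sup>2 * D) * (r * z)" using that(1) by (simp add: mult_ac)
    also have "\<dots> \<le> (c\<^sup>2 * D) * 1" using that(2) D by (intro mult_left_mono) auto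
    finally show ?thesis using that(3) by simp
  qed
  have decay: "R M N * 2 powr (- (\<Delta> * real j)) \<le> 1" if "R M N \<le> 2 powr (\<Delta> * real j)" for M N \<Delta> and j :: nat
    using that by (simp add: powr_minus_divide)
  \<comment> \<open>Matches \<theta>/\<Delta> with the exponent selected by the case distinction.
    The bound holds for all M, N >= 1, hence eventually.\<close>
  have fin: ?thesis if "\<exists>C>0. \<forall>M N. 1 \<le> M \<longrightarrow> 1 \<le> N \<longrightarrow>
      ennreal (C * A\<^sup>2 * (\<sigma>\<^sup>2 / A\<^sup>2 / R M N) powr (\<theta> / \<Delta>)) \<le> risk M N"
    and "\<theta> / \<Delta> = (if s1 > s2 * (2 * \<nu> + 1) then 2 * s2 / (2 * s2 + 1)
        else if (2 * \<nu> + 1) * (recip p - 1/2) \<le> s1 then 2 * s1 / (2 * s1 + 2 * \<nu> + 1)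
        else 2 * s_star s1 p / (2 * s_star s1 p + 2 * \<nu>))" for \<theta> \<Delta> :: real
  proof -
    from that(1) obtain C where C: "0 < C" "\<And>M N. 1 \<le> M \<Longrightarrow> 1 \<le> N \<Longrightarrow>
      ennreal (C * A\<^sup>2 * (\<sigma>\<^sup>2 / A\<^sup>2 / R M N) powr (\<theta> / \<Delta>)) \<le> risk M N"
      by blast
    have ev: "\<forall>\<^sub>F z in sequentially \<times>\<^sub>F sequentially. 1 \<le> fst z \<and> 1 \<le> snd z"
      using eventually_ge_at_top[of 1] eventually_ge_at_top[of 1]
      by (intro eventually_conj eventually_compose_filterlim[OF _ filterlim_fst] eventually_compose_filterlim[OF _ filterlim_snd])
    show ?thesis
    proof (rule exI[of _ C], rule conjI[OF C(1)], rule eventually_mono[OF ev])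
      fix z :: "nat \<times> nat" assume "1 \<le> fst z \<and> 1 \<le> snd z"
      with C(2)[of "fst z" "snd z"] show "case z of (M, N) \<Rightarrow>
       (let \<alpha>_star = Max (\<alpha> M ` {1..M});
          \<rho> = \<sigma>\<^sup>2 / (A\<^sup>2 * real M * real N powr \<alpha>_star);
          rate = (if s1 > s2 * (2 * \<nu> + 1)
                    then \<rho> powr (2 * s2 / (2 * s2 + 1))
                  else if (2 * \<nu> + 1) * (recip p - 1/2) \<le> s1
                    then \<rho> powr (2 * s1 / (2 * s1 + 2 * \<nu> + 1))
                  else \<rho> powr (2 * s_star s1 p / (2 * s_star s1 p + 2 * \<nu>)))
      in ennreal (C * A\<^sup>2 * rate)
           \<le> minimax_risk P (\<xi> M N) g \<sigma> M N
               (besov_ball (periodic_wavelet \<phi> \<psi>) m1 (periodic_wavelet \<phi>' \<eta>) m2 p q s1 s2 A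
                  \<inter> regression_functions))"
        unfolding that(2) risk_def Let_def split_def rho by (auto split: if_splits)
    qed
  qed
  have sq: "(2 powr y)\<^sup>2 = 2 powr (2 * y)" for y :: real
    by (simp add: power2_eq_square flip: powr_add)
  consider (smooth) "s1 > s2 * (2 * \<nu> + 1)"
    | (dense) "\<not> s1 > s2 * (2 * \<nu> + 1)" "(2 * \<nu> + 1) * (recip p - 1/2) \<le> s1"
    | (sparse) "\<not> s1 > s2 * (2 * \<nu> + 1)" "\<not> (2 * \<nu> + 1) * (recip p - 1/2) \<le> s1"
    by blast
  thus ?thesis
  proof cases
    case smooth
    obtain c where c: "0 < c" "c\<^sup>2 * D \<le> 2" "2 powr (real m1 * (s1 + 1/2)) * c \<le> A"
      using small_amplitude[OF D _ \<open>0 < A\<close>] by (metis powr_gt_zero zero_neq_numeral)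
    show ?thesis
    proof (rule fin[OF rate[where \<Delta> = "2 * s2 + 1" and \<theta> = "2 * s2" and w = "c\<^sup>2 / 16" and m = m2]])
      fix M N j assume MN: "1 \<le> M" "1 \<le> N" and j: "m2 \<le> j" "R M N \<le> 2 powr ((2 * s2 + 1) * real j)"
      \<comment> \<open>The largest amplitude, up to a constant, that the ball admits on level (m1,
        j) with all locations in use.\<close>
      define \<gamma> where "\<gamma> = c * 2 powr (- (real j * (s2 + 1/2)))"
      have \<gamma>2: "\<gamma>\<^sup>2 = c\<^sup>2 * 2 powr (- ((2 * s2 + 1) * real j))"
        unfolding \<gamma>_def power_mult_distrib sq
        by (rule arg_cong[where f = "\<lambda>x. c\<^sup>2 * 2 powr x"]) (simp add: algebra_simps)
      have "ennreal (2 powr (real m1 + real j) * \<gamma>\<^sup>2 / 16) \<le> risk M N"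
      proof (rule low(1)[OF MN order_refl j(1)])
        show "0 \<le> \<gamma>" using c by (simp add: \<gamma>_def)
        have "\<gamma>\<^sup>2 * 2 powr (- (2 * \<nu> * real m1)) = c\<^sup>2 * (2 powr (- ((2 * s2 + 1) * real j)) * 2 powr (- (2 * \<nu> * real m1)))"
          by (simp add: \<gamma>2)
        \<comment> \<open>The level in \<open>t\<close> is frozen, so the smoothing by the kernel
          contributes only the constant 2^(-2 \<nu> m1) <= 1; this is why \<nu> is absent from the
          first exponent.\<close>
        moreover have "R M N * (2 powr (- ((2 * s2 + 1) * real j)) * 2 powr (- (2 * \<nu> * real m1))) \<le> 1"
        proof -
          have "2 powr (- (2 * \<nu> * real m1)) \<le> 2 powr 0" using \<open>\<nu> > 0\<close> by (intro powr_mono) auto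
          hence "(R M N * 2 powr (- ((2 * s2 + 1) * real j))) * 2 powr (- (2 * \<nu> * real m1)) \<le> 1 * 1"
            using decay[OF j(2)] R1[OF MN] by (intro mult_mono) auto
          thus ?thesis by (simp add: mult.assoc)
        qed
        ultimately show "\<gamma>\<^sup>2 * D * R M N * 2 powr (- (2 * \<nu> * real m1)) \<le> 2"
          using c(2) by (rule absorb)
        have "2 powr (real m1 * (s1 + 1/2) + real j * (s2 + 1/2)) * \<gamma> = 2 powr (real m1 * (s1 + 1/2)) * c"
          by (simp add: \<gamma>_def powr_add powr_minus)
        thus "2 powr (real m1 * (s1 + 1/2) + real j * (s2 + 1/2)) * \<gamma> \<le> A" using c(3) by simp
      qed
      moreover have "c\<^sup>2 / 16 * 2 powr (- (2 * s2 * real j)) \<le> 2 powr (real m1 + real j) * \<gamma>\<^sup>2 / 16"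
      proof -
        \<comment> \<open>The number of locations turns 2^(-(2 s2 + 1) j) into 2^(-2 s2 j); the
          extra factor 2^m1 >= 1 is dropped.\<close>
        have "2 powr (- (2 * s2 * real j)) \<le> 2 powr (real m1 + real j + - ((2 * s2 + 1) * real j))"
          by (intro powr_mono) (auto simp: algebra_simps)
        hence "c\<^sup>2 * 2 powr (- (2 * s2 * real j)) \<le> c\<^sup>2 * (2 powr (real m1 + real j) * 2 powr (- ((2 * s2 + 1) * real j)))"
          unfolding powr_add by (intro mult_left_mono) auto
        thus ?thesis unfolding \<gamma>2 by (simp add: mult_ac)
      qed
      ultimately show "ennreal (c\<^sup>2 / 16 * 2 powr (- (2 * s2 * real j))) \<le> risk M N"
        using ennreal_leI order_trans by blast
    qed (use s c smooth in auto)
  next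
    case dense
    obtain c where c: "0 < c" "c\<^sup>2 * D \<le> 2" "2 powr (real m2 * (s2 + 1/2)) * c \<le> A"
      using small_amplitude[OF D _ \<open>0 < A\<close>] by (metis powr_gt_zero zero_neq_numeral)
    show ?thesis
    proof (rule fin[OF rate[where \<Delta> = "2 * s1 + 2 * \<nu> + 1" and \<theta> = "2 * s1" and w = "c\<^sup>2 / 16" and m = m1]])
      fix M N j assume MN: "1 \<le> M" "1 \<le> N" and j: "m1 \<le> j" "R M N \<le> 2 powr ((2 * s1 + 2 * \<nu> + 1) * real j)"
      \<comment> \<open>Now \<open>j\<close> is the level in \<open>t\<close>: the energy condition
        gains 2^(-2 \<nu> j), and \<Delta> becomes 2 s1 + 1 + 2 \<nu>.\<close>
      define \<gamma> where "\<gamma> = c * 2 powr (- (real j * (s1 + 1/2)))"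
      have \<gamma>2: "\<gamma>\<^sup>2 = c\<^sup>2 * 2 powr (- ((2 * s1 + 1) * real j))"
        unfolding \<gamma>_def power_mult_distrib sq
        by (rule arg_cong[where f = "\<lambda>x. c\<^sup>2 * 2 powr x"]) (simp add: algebra_simps)
      have "ennreal (2 powr (real j + real m2) * \<gamma>\<^sup>2 / 16) \<le> risk M N"
      proof (rule low(1)[OF MN j(1) order_refl])
        show "0 \<le> \<gamma>" using c by (simp add: \<gamma>_def)
        have "\<gamma>\<^sup>2 * 2 powr (- (2 * \<nu> * real j)) = c\<^sup>2 * 2 powr (- ((2 * s1 + 2 * \<nu> + 1) * real j))"
          unfolding \<gamma>2 mult.assoc powr_add[symmetric] by (simp add: algebra_simps)
        from absorb[OF this decay[OF j(2)] c(2)]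
        show "\<gamma>\<^sup>2 * D * R M N * 2 powr (- (2 * \<nu> * real j)) \<le> 2" .
        have "2 powr (real j * (s1 + 1/2) + real m2 * (s2 + 1/2)) * \<gamma> = 2 powr (real m2 * (s2 + 1/2)) * c"
          by (simp add: \<gamma>_def powr_add powr_minus)
        thus "2 powr (real j * (s1 + 1/2) + real m2 * (s2 + 1/2)) * \<gamma> \<le> A" using c(3) by simp
      qed
      moreover have "c\<^sup>2 / 16 * 2 powr (- (2 * s1 * real j)) \<le> 2 powr (real j + real m2) * \<gamma>\<^sup>2 / 16"
      proof -
        have "2 powr (- (2 * s1 * real j)) \<le> 2 powr (real j + real m2 + - ((2 * s1 + 1) * real j))"
          by (intro powr_mono) (auto simp: algebra_simps)
        hence "c\<^sup>2 * 2 powr (- (2 * s1 * real j)) \<le> c\<^sup>2 * (2 powr (real j + real m2) * 2 powr (- ((2 * s1 + 1) * real j)))"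
          unfolding powr_add by (intro mult_left_mono) auto
        thus ?thesis unfolding \<gamma>2 by (simp add: mult_ac)
      qed
      ultimately show "ennreal (c\<^sup>2 / 16 * 2 powr (- (2 * s1 * real j))) \<le> risk M N"
        using ennreal_leI order_trans by blast
    qed (use s c dense \<open>\<nu> > 0\<close> in auto)
  next
    case sparse
    \<comment> \<open>From s1 >= 1/p; it makes both \<theta> and \<Delta> positive.\<close>
    have star: "1 / 2 \<le> s_star s1 p" using s by (simp add: s_star_def)
    obtain c where c: "0 < c" "c\<^sup>2 * D \<le> 2" "2 powr (real m2 * s_star s2 p) * c \<le> A"
      using small_amplitude[OF D _ \<open>0 < A\<close>] by (metis powr_gt_zero zero_neq_numeral)
    show ?thesis
    proof (rule fin[OF rate[where \<Delta> = "2 * s_star s1 p + 2 * \<nu>" and \<theta> = "2 * s_star s1 p" and w = "c\<^sup>2 / 16" and m = m1]])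
      fix M N j assume MN: "1 \<le> M" "1 \<le> N" and j: "m1 \<le> j" "R M N \<le> 2 powr ((2 * s_star s1 p + 2 * \<nu>) * real j)"
      \<comment> \<open>A single location admits the larger amplitude 2^(-j s) with s =
        \<open>s_star s1 p\<close>, and the loss is \<gamma>^2 itself, without a count of
        locations.\<close>
      define \<gamma> where "\<gamma> = c * 2 powr (- (real j * s_star s1 p))"
      have \<gamma>2: "\<gamma>\<^sup>2 = c\<^sup>2 * 2 powr (- (2 * s_star s1 p * real j))"
        unfolding \<gamma>_def power_mult_distrib sq
        by (rule arg_cong[where f = "\<lambda>x. c\<^sup>2 * 2 powr x"]) (simp add: algebra_simps)
      have "ennreal (\<gamma>\<^sup>2 / 16) \<le> risk M N"
      proof (rule low(2)[OF MN j(1) order_refl])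
        show "0 \<le> \<gamma>" using c by (simp add: \<gamma>_def)
        have "\<gamma>\<^sup>2 * 2 powr (- (2 * \<nu> * real j)) = c\<^sup>2 * 2 powr (- ((2 * s_star s1 p + 2 * \<nu>) * real j))"
          unfolding \<gamma>2 mult.assoc powr_add[symmetric] by (simp add: algebra_simps)
        from absorb[OF this decay[OF j(2)] c(2)]
        show "\<gamma>\<^sup>2 * D * R M N * 2 powr (- (2 * \<nu> * real j)) \<le> 2" .
        have "2 powr (real j * s_star s1 p + real m2 * s_star s2 p) * \<gamma> = 2 powr (real m2 * s_star s2 p) * c"
          by (simp add: \<gamma>_def powr_add powr_minus)
        thus "2 powr (real j * s_star s1 p + real m2 * s_star s2 p) * \<gamma> \<le> A" using c(3) by simp
      qed
      thus "ennreal (c\<^sup>2 / 16 * 2 powr (- (2 * s_star s1 p * real j))) \<le> risk M N"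
        unfolding \<gamma>2 by simp
    qed (use star c sparse \<open>\<nu> > 0\<close> in auto)
  qed
qed

end
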